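(* Let $t$ be a positive integer and let $\mathcal M$ be a matrix class of $0,1$-matrices none of which has a $t\times t$ submatrix whose entries are all $1$. Then $k$-Induced Permutation restricted to matrices of $\mathcal M$ is fixed-parameter tractable with parameter $k$: there are a computable $h$ and an algorithm that, given $M\in\mathcal M$ and a $k\times k$ permutation matrix $P$, decides whether $P$ is a submatrix of $M$ in time $h(k)\cdot|M|^{\mathcal O(1)}$.
   Context: A matrix class is a set of matrices closed under taking submatrices (deleting rows and/or columns, not necessarily consecutive). A permutation matrix is a square $0,1$-matrix with exactly one $1$-entry per row and per column. *)

theory Defs
  imports "Jordan_Normal_Form.DL_Submatrix"
begin

section \<open>0,1-matrices, submatrices and matrix classes\<close>

definition zero_one_mat :: "nat mat \<Rightarrow> bool" where
  "zero_one_mat M \<longleftrightarrow> elements_mat M \<subseteq> {0, 1}"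

text \<open>The function \<^const>\<open>submatrix\<close> keeps the rows in \<open>I\<close> and the columns in \<open>J\<close>, in their
  original order; indices outside the range of \<open>M\<close> have no effect.\<close>

definition is_submatrix :: "'a mat \<Rightarrow> 'a mat \<Rightarrow> bool" where
  "is_submatrix A M \<longleftrightarrow> (\<exists>I J. A = submatrix M I J)"

definition matrix_class :: "'a mat set \<Rightarrow> bool" where
  "matrix_class \<M> \<longleftrightarrow> (\<forall>M\<in>\<M>. \<forall>A. is_submatrix A M \<longrightarrow> A \<in> \<M>)"

definition all_ones_mat :: "nat \<Rightarrow> nat mat" where
  "all_ones_mat t = mat t t (\<lambda>_. 1)"

definition permutation_matrix :: "nat \<Rightarrow> nat mat \<Rightarrow> bool" where
  "permutation_matrix k P \<longleftrightarrow> P \<in> carrier_mat k k \<and> zero_one_mat P \<and>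
     (\<forall>i<k. \<exists>!j. j < k \<and> P $$ (i, j) = 1) \<and>
     (\<forall>j<k. \<exists>!i. i < k \<and> P $$ (i, j) = 1)"


section \<open>Random access machines\<close>

text \<open>
  The machine model is a random access machine with natural-number cells, indirect addressing,
  addition and truncated subtraction, programmed by structured commands instead of jumps.
  The memory is a family of banks, \<open>s b i\<close> being the content of cell \<open>i\<close> of bank \<open>b\<close>. Bank numbers
  are literals of the program, so that a program has access to finitely many banks only, which a
  machine with a single address space can interleave; cell \<open>0\<close> of a bank serves as a register.

  Every node of an evaluated expression and every executed command costs one unit. As there is no
  multiplication, a single unit of time at most doubles the largest number in memory, and running
  times are polynomially related to those of Turing machines.
\<close>

type_synonym store = "nat \<Rightarrow> nat \<Rightarrow> nat"

datatype expr =
    Lit nat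
  | Get nat expr
  | Add expr expr
  | Sub expr expr

fun expr_val :: "expr \<Rightarrow> store \<Rightarrow> nat" where
  "expr_val (Lit n) s = n"
| "expr_val (Get b e) s = s b (expr_val e s)"
| "expr_val (Add e f) s = expr_val e s + expr_val f s"
| "expr_val (Sub e f) s = expr_val e s - expr_val f s"

fun expr_cost :: "expr \<Rightarrow> nat" where
  "expr_cost (Lit n) = 1"
| "expr_cost (Get b e) = 1 + expr_cost e"
| "expr_cost (Add e f) = 1 + expr_cost e + expr_cost f"
| "expr_cost (Sub e f) = 1 + expr_cost e + expr_cost f"

datatype prog =
    Skip
  | Put nat expr expr
  | Seq prog prog
  | Cond expr prog prog
  | While expr prog

text \<open>\<open>run p s n s'\<close>: started in \<open>s\<close>, the program \<open>p\<close> halts after \<open>n\<close> units of time in \<open>s'\<close>.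
  The command \<open>Put b e f\<close> stores the value of \<open>f\<close> at address \<open>e\<close> of bank \<open>b\<close>. Tests succeed on
  nonzero values.\<close>

inductive run :: "prog \<Rightarrow> store \<Rightarrow> nat \<Rightarrow> store \<Rightarrow> bool" where
  run_Skip: "run Skip s 1 s"
| run_Put: "run (Put b e f) s (1 + expr_cost e + expr_cost f)
    (s(b := (s b)(expr_val e s := expr_val f s)))"
| run_Seq: "run p s m s' \<Longrightarrow> run q s' n s'' \<Longrightarrow> run (Seq p q) s (1 + m + n) s''"
| run_Cond_true: "expr_val e s \<noteq> 0 \<Longrightarrow> run p s n s' \<Longrightarrow>
    run (Cond e p q) s (1 + expr_cost e + n) s'"
| run_Cond_false: "expr_val e s = 0 \<Longrightarrow> run q s n s' \<Longrightarrow>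
    run (Cond e p q) s (1 + expr_cost e + n) s'"
| run_While_false: "expr_val e s = 0 \<Longrightarrow> run (While e p) s (1 + expr_cost e) s"
| run_While_true: "expr_val e s \<noteq> 0 \<Longrightarrow> run p s m s' \<Longrightarrow> run (While e p) s' n s'' \<Longrightarrow>
    run (While e p) s (1 + expr_cost e + m + n) s''"

inductive_cases run_SkipE: "run Skip s n s'"
inductive_cases run_PutE: "run (Put b e f) s n s'"
inductive_cases run_SeqE: "run (Seq p q) s n s'"
inductive_cases run_CondE: "run (Cond e p q) s n s'"
inductive_cases run_WhileE: "run (While e p) s n s'"

text \<open>The machine is deterministic, so that the existential quantifiers over runs below speak about
  the only halting run.\<close>

lemma run_deterministic:
  assumes "run p s m s'" and "run p s n s''"
  shows "m = n \<and> s' = s''"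
  using assms
proof (induction arbitrary: n s'' rule: run.induct)
  case (run_Skip s)
  then show ?case by (rule run_SkipE) simp
next
  case (run_Put b e f s)
  then show ?case by (rule run_PutE) simp
next
  case (run_Seq p s m s' q k t)
  from run_Seq.prems show ?case
  proof (rule run_SeqE)
    fix m' u k' assume n: "n = Suc (m' + k')" and p: "run p s m' u" and q: "run q u k' s''"
    from run_Seq.IH(1)[OF p] have "m = m'" "s' = u" by simp_all
    with run_Seq.IH(2)[of k' s''] q n show ?thesis by simp
  qed
next
  case (run_Cond_true e s p k t q)
  from run_Cond_true.prems show ?case
  proof (rule run_CondE)
    fix k' assume "n = Suc (expr_cost e + k')" "run p s k' s''"
    with run_Cond_true.IH[of k' s''] show ?thesis by simp
  next
    assume "expr_val e s = 0"
    with run_Cond_true.hyps show ?thesis by simp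
  qed
next
  case (run_Cond_false e s q k t p)
  from run_Cond_false.prems show ?case
  proof (rule run_CondE)
    assume "0 < expr_val e s"
    with run_Cond_false.hyps show ?thesis by simp
  next
    fix k' assume "n = Suc (expr_cost e + k')" "run q s k' s''"
    with run_Cond_false.IH[of k' s''] show ?thesis by simp
  qed
next
  case (run_While_false e s p)
  from run_While_false.prems show ?case
  proof (rule run_WhileE)
    assume "n = Suc (expr_cost e)" "s'' = s"
    then show ?thesis by simp
  next
    assume "0 < expr_val e s"
    with run_While_false.hyps show ?thesis by simp
  qed
next
  case (run_While_true e s p m s' k t)
  from run_While_true.prems show ?case
  proof (rule run_WhileE)
    assume "expr_val e s = 0"
    with run_While_true.hyps show ?thesis by simp
  next
    fix m' u k'
    assume n: "n = Suc (expr_cost e + m' + k')" and p: "run p s m' u" and q: "run (While e p) u k' s''"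
    from run_While_true.IH(1)[OF p] have "m = m'" "s' = u" by simp_all
    with run_While_true.IH(2)[of k' s''] q n show ?thesis by simp
  qed
qed

text \<open>The input word is written to bank \<open>0\<close>, everything else is zero; the output is read off from
  cell \<open>0\<close> of bank \<open>0\<close>.\<close>

definition load :: "nat list \<Rightarrow> store" where
  "load xs = (\<lambda>b i. if b = 0 \<and> i < length xs then xs ! i else 0)"

definition computable :: "(nat \<Rightarrow> nat) \<Rightarrow> bool" where
  "computable h \<longleftrightarrow> (\<exists>p. \<forall>n. \<exists>T s. run p (load [n]) T s \<and> s 0 0 = h n)"

definition decides_within :: "prog \<Rightarrow> nat list \<Rightarrow> bool \<Rightarrow> nat \<Rightarrow> bool" where
  "decides_within p xs b T \<longleftrightarrow>
     (\<exists>n s. run p (load xs) n s \<and> n \<le> T \<and> s 0 0 = (if b then 1 else 0))"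

text \<open>A matrix is encoded by its dimensions followed by its entries, row by row. The length of this
  word, the number of entries plus \<open>2\<close>, is the size of the matrix; unlike the number of entries, it
  is positive for matrices without rows or columns, too.\<close>

definition encode_mat :: "nat mat \<Rightarrow> nat list" where
  "encode_mat M = dim_row M # dim_col M # concat (mat_to_list M)"

definition mat_size :: "nat mat \<Rightarrow> nat" where
  "mat_size M = length (encode_mat M)"

end

theory Submission
  imports Defs
begin

text \<open>A matrix is regarded as an ordered bipartite graph on its lines, the rows followed by the columns.
  Starting from one-element parts, two neighbouring parts of an interval partition of the lines are
  merged as long as the new part is joined to at most \<open>d\<close> parts. If no merge is possible although
  there are several parts, then the Marcus--Tardos theorem, applied to the quotient, yields a large
  inflation of the given permutation as a pattern, possibly with superfluous ones; in the absence of
  a \<open>t \<times> t\<close> submatrix of ones, one point of each block of the inflation can be chosen greedily such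
  that no superfluous ones remain, and the answer is yes. Otherwise all lines end up in one part, and
  the partitions met on the way form a contraction sequence of bounded red degree in the sense of
  twin-width. Along this sequence, dynamic programming determines the feasible partial embeddings of
  the pattern whose images are connected in the red graph: each of them breaks up into red-connected
  ones for the preceding partition, and there are boundedly many ways to do so for every starting
  line, since these parts are reached from it by short red walks.\<close>

section \<open>The Marcus--Tardos theorem\<close>

text \<open>Two points shape the construction. The partition into single lines has unbounded
  degrees, as a line may contain many ones. Hence the degree bound is imposed on larger parts only,
  and every larger part is refined into classes of equal adjacency to the one-element parts. A
  larger part is joined to at most \<open>d\<close> parts, so it has at most \<open>2 ^ d\<close>
  classes, and red degrees between classes are bounded in terms of \<open>d\<close>. The other point
  is time. The table is addressed by numbers of order \<open>L ^ (2 * k)\<close>, but it is never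
  traversed: a stage only tests one candidate for each starting line and each number below
  \<open>H = Q ^ D\<close>, where \<open>Q\<close> and \<open>D\<close> depend on \<open>k\<close>
  and \<open>t\<close> alone. All loops of the program are bounded by the number of lines or by such
  parameters, which the program computes itself. The size of the inflation is
  \<open>r = k * greedy_size (two_colour_bound t) k\<close>, and \<open>d = 8 * mt_const r\<close>
  is large enough for a stuck partition to violate the Marcus--Tardos bound.\<close>

definition contains_perm :: "nat \<Rightarrow> (nat \<Rightarrow> nat) \<Rightarrow> (nat \<times> nat) set \<Rightarrow> bool" where
  "contains_perm r \<sigma> S \<longleftrightarrow> (\<exists>f g. strict_mono_on {..<r} f \<and> strict_mono_on {..<r} g \<and>
     (\<forall>a<r. (f a, g (\<sigma> a)) \<in> S))"

lemma strict_mono_choice: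
  fixes X :: "nat set"
  assumes "finite X" and "r \<le> card X"
  obtains f where "strict_mono_on {..<r} f" and "\<And>a. a < r \<Longrightarrow> f a \<in> X"
proof
  let ?l = "sorted_list_of_set X"
  have len: "length ?l = card X"
    by simp
  show "strict_mono_on {..<r} (\<lambda>a. ?l ! a)"
    using strict_sorted_list_of_set[of X] assms(2) len
    by (auto simp: strict_mono_on_def sorted_wrt_iff_nth_less)
  show "?l ! a \<in> X" if "a < r" for a
    using nth_mem[of a ?l] that assms len by simp
qed

lemma large_fibre:
  assumes "finite X" and "finite Z" and "\<And>x. x \<in> X \<Longrightarrow> f x \<in> Z"
    and "r * card Z < card X"
  shows "\<exists>z\<in>Z. r < card {x \<in> X. f x = z}"
proof (rule ccontr)
  assume "\<not> ?thesis"
  then have *: "card {x \<in> X. f x = z} \<le> r" if "z \<in> Z" for z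
    using that by force
  have "X = (\<Union>z\<in>Z. {x \<in> X. f x = z})"
    using assms(3) by auto
  then have "card X \<le> (\<Sum>z\<in>Z. card {x \<in> X. f x = z})"
    using card_UN_le[OF assms(2), of "\<lambda>z. {x \<in> X. f x = z}"] by simp
  also have "\<dots> \<le> (\<Sum>z\<in>Z. r)"
    by (rule sum_mono) (rule *)
  finally show False
    using assms(4) by (simp add: mult.commute)
qed

text \<open>The columns of block column \<open>J\<close> that meet \<open>S\<close> inside block row
  \<open>I\<close>, for blocks of side \<open>q\<close>. The nonempty rows of a block come from the
  same definition with \<open>S\<inverse>\<close> and exchanged indices.\<close>

definition block_cols :: "nat \<Rightarrow> (nat \<times> nat) set \<Rightarrow> nat \<Rightarrow> nat \<Rightarrow> nat set" where
  "block_cols q S I J = {y. y div q = J \<and> (\<exists>x. x div q = I \<and> (x, y) \<in> S)}"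

lemma block_cols_subset: "q > 0 \<Longrightarrow> block_cols q S I J \<subseteq> {J * q..<J * q + q}"
  unfolding block_cols_def
  using dividend_less_div_times by (auto simp: add.commute)

text \<open>A block is wide if at least \<open>r\<close> of its columns are nonempty. Among many wide blocks of one block
  column, \<open>r\<close> have the same set of nonempty columns, by the pigeonhole principle.\<close>

lemma many_wide_blocks:
  assumes q: "q > 0" and N: "finite N"
    and many: "r * 2 ^ q < card {I \<in> N. r \<le> card (block_cols q S I J)}"
  shows "\<exists>f g. strict_mono_on {..<r} f \<and> strict_mono_on {..<r} g \<and>
    (\<forall>a<r. \<forall>b<r. \<exists>x. x div q = f a \<and> (x, g b) \<in> S)"
proof -
  define X where "X = {I \<in> N. r \<le> card (block_cols q S I J)}"
  have X: "finite X"
    using N by (simp add: X_def)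
  have cols: "block_cols q S I J \<in> Pow {J * q..<J * q + q}" for I
    using block_cols_subset[OF q] by (rule PowI)
  have many: "r * card (Pow {J * q..<J * q + q}) < card X"
    using many unfolding X_def by (simp add: card_Pow)
  obtain z where z: "z \<in> Pow {J * q..<J * q + q}" "r < card {I \<in> X. block_cols q S I J = z}"
    using large_fibre[OF X _ cols many] finite_atLeastLessThan[of "J * q" "J * q + q"]
    by (meson finite_Pow_iff)
  define Y where "Y = {I \<in> X. block_cols q S I J = z}"
  have Y: "finite Y" "r \<le> card Y"
    using X z(2) by (simp_all add: Y_def)
  have "card Y \<noteq> 0"
    using z(2) unfolding Y_def by linarith
  then obtain I where "I \<in> Y"
    by (metis card.empty all_not_in_conv)
  then have rz: "r \<le> card z"
    by (auto simp: Y_def X_def)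
  have "finite z"
    using z(1) finite_subset[OF _ finite_atLeastLessThan] by blast
  from strict_mono_choice[OF this rz] obtain g where
    g: "strict_mono_on {..<r} g" "\<And>a. a < r \<Longrightarrow> g a \<in> z"
    by metis
  from strict_mono_choice[OF Y] obtain f where
    f: "strict_mono_on {..<r} f" "\<And>a. a < r \<Longrightarrow> f a \<in> Y"
    by metis
  show ?thesis
  proof (rule exI[of _ f], rule exI[of _ g], intro conjI allI impI f(1) g(1))
    fix a b assume "a < r" "b < r"
    then have "g b \<in> block_cols q S (f a) J"
      using f(2)[of a] g(2)[of b] by (simp add: Y_def)
    then show "\<exists>x. x div q = f a \<and> (x, g b) \<in> S"
      by (auto simp: block_cols_def)
  qed
qed

lemma strict_mono_on_of_div:
  assumes "strict_mono_on {..<r} f" and "\<And>a. a < r \<Longrightarrow> x a div q = f a"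
  shows "strict_mono_on {..<r} (x :: nat \<Rightarrow> nat)"
proof (rule strict_mono_onI)
  fix a b assume "a \<in> {..<r}" "b \<in> {..<r}" "a < b"
  then have "x a div q < x b div q"
    using assms by (auto simp: strict_mono_on_def)
  then show "x a < x b"
    by (meson div_le_mono leD leI)
qed

text \<open>The \<open>r\<close> blocks found above meet each of \<open>r\<close> common columns. So
  a point of the prescribed column can be picked in each of them, and the rows increase because the
  blocks lie in different block rows.\<close>

lemma contains_perm_of_wide:
  assumes "\<And>a. a < r \<Longrightarrow> \<sigma> a < r" and "q > 0" and "finite N"
    and "r * 2 ^ q < card {I \<in> N. r \<le> card (block_cols q S I J)}"
  shows "contains_perm r \<sigma> S"
proof -
  from many_wide_blocks[OF assms(2-4)] obtain f g where
    "strict_mono_on {..<r} f \<and> strict_mono_on {..<r} g \<and>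
      (\<forall>a<r. \<forall>b<r. \<exists>x. x div q = f a \<and> (x, g b) \<in> S)"
    by (elim exE)
  note fg = this[THEN conjunct1] this[THEN conjunct2, THEN conjunct1]
    this[THEN conjunct2, THEN conjunct2, rule_format]
  then have "\<forall>a. \<exists>x. a < r \<longrightarrow> x div q = f a \<and> (x, g (\<sigma> a)) \<in> S"
    using assms(1) by blast
  from choice[OF this] obtain x where "\<forall>a. a < r \<longrightarrow> x a div q = f a \<and> (x a, g (\<sigma> a)) \<in> S"
    by (rule exE)
  then show ?thesis
    unfolding contains_perm_def using fg(2) strict_mono_on_of_div[OF fg(1), of x q] by blast
qed

text \<open>The transposed argument: the points found in \<open>S\<inverse>\<close> realise the
  inverse permutation.\<close>

lemma contains_perm_of_tall:
  assumes \<sigma>: "bij_betw \<sigma> {..<r} {..<r}" and "q > 0" and "finite N"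
    and "r * 2 ^ q < card {J \<in> N. r \<le> card (block_cols q (S\<inverse>) J I)}"
  shows "contains_perm r \<sigma> S"
proof -
  from many_wide_blocks[OF assms(2-4)] obtain f g where
    "strict_mono_on {..<r} f \<and> strict_mono_on {..<r} g \<and>
      (\<forall>a<r. \<forall>b<r. \<exists>x. x div q = f a \<and> (x, g b) \<in> S\<inverse>)"
    by (elim exE)
  note fg = this[THEN conjunct1] this[THEN conjunct2, THEN conjunct1]
    this[THEN conjunct2, THEN conjunct2, rule_format]
  let ?\<tau> = "inv_into {..<r} \<sigma>"
  have \<tau>: "?\<tau> b < r" if "b < r" for b
    using bij_betw_inv_into[OF \<sigma>] that by (auto simp: bij_betw_def)
  then have "\<forall>b. \<exists>x. b < r \<longrightarrow> x div q = f b \<and> (x, g (?\<tau> b)) \<in> S\<inverse>"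
    using fg(3) by blast
  from choice[OF this] obtain x where "\<forall>b. b < r \<longrightarrow> x b div q = f b \<and> (x b, g (?\<tau> b)) \<in> S\<inverse>"
    by (rule exE)
  then have x: "\<And>b. b < r \<Longrightarrow> x b div q = f b \<and> (g (?\<tau> b), x b) \<in> S"
    by simp
  have "(g a, x (\<sigma> a)) \<in> S" if "a < r" for a
    using x[of "\<sigma> a"] \<sigma> that by (auto simp: bij_betw_def inv_into_f_f)
  then show ?thesis
    unfolding contains_perm_def
    using fg(2) x strict_mono_on_of_div[OF fg(1), of x q] by blast
qed

text \<open>This is \<open>8 * q * r * 2 ^ q\<close> for the block side
  \<open>q = 4 * r\<^sup>2\<close>. With this side the recursion accounts for at most half of the
  bound; with the factor \<open>8\<close> the wide and the tall blocks account for at most a quarter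
  each.\<close>

definition mt_const :: "nat \<Rightarrow> nat" where
  "mt_const r = 8 * (4 * r\<^sup>2) * r * 2 ^ (4 * r\<^sup>2)"

text \<open>Preimages of strictly increasing labels under a monotone labelling are strictly
  increasing, so a pattern of the quotient lifts point by point. This serves for the blocks of the
  recursion and for the parts of an interval partition.\<close>

lemma contains_perm_quotient:
  assumes "contains_perm r \<sigma> ((\<lambda>(x, y). (\<phi> x, \<phi> y)) ` S)"
    and \<phi>: "mono_on D \<phi>" and S: "S \<subseteq> D \<times> D"
    and \<sigma>: "bij_betw \<sigma> {..<r} {..<r}"
  shows "contains_perm r \<sigma> S"
proof -
  obtain f g where fg: "strict_mono_on {..<r} f" "strict_mono_on {..<r} g"
    "\<And>a. a < r \<Longrightarrow> (f a, g (\<sigma> a)) \<in> (\<lambda>(x, y). (\<phi> x, \<phi> y)) ` S"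
    using assms(1) unfolding contains_perm_def by blast
  then have "\<forall>a. \<exists>x y. a < r \<longrightarrow> \<phi> x = f a \<and> \<phi> y = g (\<sigma> a) \<and> (x, y) \<in> S"
    by fastforce
  then obtain x y where xy: "\<And>a. a < r \<Longrightarrow>
      \<phi> (x a) = f a \<and> \<phi> (y a) = g (\<sigma> a) \<and> (x a, y a) \<in> S"
    by metis
  have lift: "strict_mono_on {..<r} z"
    if "strict_mono_on {..<r} h" and "\<And>a. a < r \<Longrightarrow> \<phi> (z a) = h a \<and> z a \<in> D" for h z
  proof (rule strict_mono_onI)
    fix a b assume ab: "a \<in> {..<r}" "b \<in> {..<r}" "a < b"
    then have "\<phi> (z a) < \<phi> (z b)"
      using that by (auto simp: strict_mono_on_def)
    then have "\<not> z b \<le> z a"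
      using \<phi> that(2) ab(1,2) by (metis lessThan_iff linorder_not_less mono_onD)
    then show "z a < z b"
      by simp
  qed
  \<comment> \<open>The preimages \<open>y\<close> are indexed by rows; the inverse permutation
    reindexes them by columns.\<close>
  let ?\<tau> = "inv_into {..<r} \<sigma>"
  have \<tau>: "?\<tau> b < r" "\<sigma> (?\<tau> b) = b" if "b < r" for b
    using bij_betw_inv_into[OF \<sigma>] that \<sigma> by (auto simp: bij_betw_def f_inv_into_f)
  have "strict_mono_on {..<r} (\<lambda>b. y (?\<tau> b))"
    by (rule lift[OF fg(2)]) (use xy \<tau> S in auto)
  moreover have "strict_mono_on {..<r} x"
    by (rule lift[OF fg(1)]) (use xy S in auto)
  moreover have "(x a, y (?\<tau> (\<sigma> a))) \<in> S" if "a < r" for a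
    using xy \<sigma> that by (auto simp: bij_betw_def inv_into_f_f)
  ultimately show ?thesis
    unfolding contains_perm_def by (intro exI[of _ x] exI[of _ "\<lambda>b. y (?\<tau> b)"]) auto
qed

theorem marcus_tardos:
  assumes \<sigma>: "bij_betw \<sigma> {..<r} {..<r}" and r: "r > 0"
    and "S \<subseteq> {..<n} \<times> {..<n}" and "\<not> contains_perm r \<sigma> S"
  shows "card S \<le> mt_const r * n"
  using assms(3,4)
proof (induction n arbitrary: S rule: less_induct)
  case (less n S)
  define q where "q = 4 * r\<^sup>2"
  have q: "q \<ge> 4"
    using r by (simp add: q_def)
  have c: "mt_const r = 8 * q * r * 2 ^ q"
    by (simp add: mt_const_def q_def)
  have finS: "finite S"
    using less.prems(1) finite_subset by blast
  show ?case
  \<comment> \<open>Below the block side the trivial bound \<open>n * n\<close> suffices.\<close>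
  proof (cases "n < q")
    case True
    have "card S \<le> card ({..<n} \<times> {..<n})"
      by (rule card_mono) (use less.prems(1) in auto)
    also have "\<dots> \<le> q * n"
      using True by simp
    also have "\<dots> \<le> mt_const r * n"
    proof (rule mult_right_mono)
      have "q * 1 \<le> q * (8 * r * 2 ^ q)"
        by (rule mult_left_mono) (use r in simp_all)
      then show "q \<le> mt_const r"
        by (simp add: c mult_ac)
    qed simp
    finally show ?thesis .
  next
    case False
    \<comment> \<open>Enough blocks to cover everything; rounding up costs at most a factor
      \<open>2\<close>, since \<open>n \<ge> q\<close>.\<close>
    define n' where "n' = n div q + 1"
    have "n div q \<ge> 1"
      using False q by (simp add: div_greater_zero_iff Suc_leI)
    then have "n' * q \<le> 2 * (n div q * q)"
      by (simp add: n'_def algebra_simps)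
    also have "n div q * q \<le> n"
      by simp
    finally have n'q: "n' * q \<le> 2 * n"
      by simp
    have "n' * 4 \<le> n' * q"
      using q by simp
    with n'q False q have n'n: "n' < n"
      by linarith
    define \<phi> :: "nat \<times> nat \<Rightarrow> nat \<times> nat" where "\<phi> = (\<lambda>(x, y). (x div q, y div q))"
    define S' where "S' = \<phi> ` S"
    have sub: "S' \<subseteq> {..<n'} \<times> {..<n'}"
    proof -
      have "x div q < n'" if "x < n" for x
        using div_le_mono[of x n q] that by (simp add: n'_def less_Suc_eq_le)
      then show ?thesis
        using less.prems(1) by (auto simp: S'_def \<phi>_def)
    qed
    have "mono_on UNIV (\<lambda>x. x div q)"
      by (intro mono_onI div_le_mono)
    then have "\<not> contains_perm r \<sigma> S'"
      using less.prems(2) contains_perm_quotient[of r \<sigma> "\<lambda>x. x div q" S UNIV] \<sigma>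
      unfolding S'_def \<phi>_def by auto
    then have IH: "card S' \<le> mt_const r * n'"
      using less.IH[OF n'n sub] by blast
    define Wd where "Wd J = {I \<in> {..<n'}. r \<le> card (block_cols q S I J)}" for J
    define Tl where "Tl I = {J \<in> {..<n'}. r \<le> card (block_cols q (S\<inverse>) J I)}" for I
    have Wd: "card (Wd J) \<le> r * 2 ^ q" for J
      using contains_perm_of_wide[of r \<sigma> q "{..<n'}" S J] less.prems(2) \<sigma> q
      unfolding Wd_def by (force simp: bij_betw_def)
    have Tl: "card (Tl I) \<le> r * 2 ^ q" for I
      using contains_perm_of_tall[of \<sigma> r q "{..<n'}" S I] less.prems(2) \<sigma> q
      unfolding Tl_def by force
    define blk where "blk p = {z \<in> S. \<phi> z = p}" for p
    have blk_sub: "blk (I, J) \<subseteq> block_cols q (S\<inverse>) J I \<times> block_cols q S I J" for I J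
      unfolding blk_def block_cols_def \<phi>_def by auto
    have fin_cols: "finite (block_cols q R I J)" for R I J
      using block_cols_subset[of q R I J] q finite_subset by fastforce
    have le_q: "card (block_cols q R I J) \<le> q" for R I J
      using card_mono[OF _ block_cols_subset[of q R I J]] q by simp
    have blk_card: "card (blk (I, J)) \<le> card (block_cols q (S\<inverse>) J I) * card (block_cols q S I J)" for I J
      using card_mono[OF _ blk_sub[of I J]] fin_cols by (simp add: card_cartesian_product)
    \<comment> \<open>A block that is neither wide nor tall has fewer than \<open>r\<close> nonempty
      rows and columns; for the others the full size of a block is charged.\<close>
    have bound: "card (blk (I, J)) \<le> r\<^sup>2 + (if I \<in> Wd J then q\<^sup>2 else 0) + (if J \<in> Tl I then q\<^sup>2 else 0)"
      if "I < n'" "J < n'" for I J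
    proof (cases "I \<in> Wd J \<or> J \<in> Tl I")
      case True
      have "card (blk (I, J)) \<le> q * q"
        using blk_card[of I J] mult_le_mono[OF le_q[of "S\<inverse>" J I] le_q[of S I J]] by linarith
      with True show ?thesis
        by (auto simp: power2_eq_square)
    next
      case False
      then have "card (block_cols q (S\<inverse>) J I) \<le> r" "card (block_cols q S I J) \<le> r"
        using that by (auto simp: Wd_def Tl_def)
      then have "card (blk (I, J)) \<le> r * r"
        using blk_card[of I J] mult_le_mono by (meson le_trans)
      with False show ?thesis
        by (auto simp: power2_eq_square)
    qed
    have finS': "finite S'"
      using finS by (simp add: S'_def)
    have "S = (\<Union>p\<in>S'. blk p)"
      by (auto simp: S'_def blk_def)
    then have "card S \<le> (\<Sum>p\<in>S'. card (blk p))"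
      using card_UN_le[OF finS', of blk] by simp
    also have "\<dots> \<le> (\<Sum>p\<in>S'. r\<^sup>2 + (if fst p \<in> Wd (snd p) then q\<^sup>2 else 0) + (if snd p \<in> Tl (fst p) then q\<^sup>2 else 0))"
    proof (rule sum_mono)
      fix p assume "p \<in> S'"
      then show "card (blk p) \<le> r\<^sup>2 + (if fst p \<in> Wd (snd p) then q\<^sup>2 else 0)
          + (if snd p \<in> Tl (fst p) then q\<^sup>2 else 0)"
        using bound[of "fst p" "snd p"] sub by (cases p) (simp only: fst_conv snd_conv, blast)
    qed
    also have "\<dots> = r\<^sup>2 * card S' + (\<Sum>p\<in>S'. if fst p \<in> Wd (snd p) then q\<^sup>2 else 0)
        + (\<Sum>p\<in>S'. if snd p \<in> Tl (fst p) then q\<^sup>2 else 0)"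
      by (simp add: sum.distrib)
    also have "(\<Sum>p\<in>S'. if fst p \<in> Wd (snd p) then q\<^sup>2 else 0)
        \<le> (\<Sum>p\<in>{..<n'} \<times> {..<n'}. if fst p \<in> Wd (snd p) then q\<^sup>2 else 0)"
      by (rule sum_mono2) (use sub in auto)
    also have "\<dots> = (\<Sum>J<n'. \<Sum>I<n'. if I \<in> Wd J then q\<^sup>2 else 0)"
      by (subst sum.swap) (simp add: sum.cartesian_product case_prod_beta)
    also have "\<dots> = (\<Sum>J<n'. q\<^sup>2 * card (Wd J))"
      by (rule sum.cong) (auto simp: Wd_def sum.If_cases intro!: arg_cong[where f = card])
    also have "\<dots> \<le> (\<Sum>J<n'. q\<^sup>2 * (r * 2 ^ q))"
      by (intro sum_mono mult_left_mono Wd) simp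
    also have "\<dots> = n' * (q\<^sup>2 * (r * 2 ^ q))"
      by simp
    also have "(\<Sum>p\<in>S'. if snd p \<in> Tl (fst p) then q\<^sup>2 else 0)
        \<le> (\<Sum>p\<in>{..<n'} \<times> {..<n'}. if snd p \<in> Tl (fst p) then q\<^sup>2 else 0)"
      by (rule sum_mono2) (use sub in auto)
    also have "\<dots> = (\<Sum>I<n'. \<Sum>J<n'. if J \<in> Tl I then q\<^sup>2 else 0)"
      by (simp add: sum.cartesian_product case_prod_beta)
    also have "\<dots> = (\<Sum>I<n'. q\<^sup>2 * card (Tl I))"
      by (rule sum.cong) (auto simp: Tl_def sum.If_cases intro!: arg_cong[where f = card])
    also have "\<dots> \<le> (\<Sum>I<n'. q\<^sup>2 * (r * 2 ^ q))"
      by (intro sum_mono mult_left_mono Tl) simp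
    also have "\<dots> = n' * (q\<^sup>2 * (r * 2 ^ q))"
      by simp
    finally have S: "card S \<le> r\<^sup>2 * card S' + n' * (q\<^sup>2 * (r * 2 ^ q)) + n' * (q\<^sup>2 * (r * 2 ^ q))"
      by simp
    have "4 * (r\<^sup>2 * card S') \<le> 4 * (r\<^sup>2 * (mt_const r * n'))"
      using IH by simp
    \<comment> \<open>The block side was chosen for this: \<open>4 * r\<^sup>2 = q\<close>.\<close>
    also have "\<dots> = mt_const r * (n' * q)"
      by (simp add: q_def)
    also have "\<dots> \<le> mt_const r * (2 * n)"
      using n'q by simp
    finally have 1: "2 * (r\<^sup>2 * card S') \<le> mt_const r * n"
      by linarith
    \<comment> \<open>The whole bound is \<open>8 * w * n\<close>, and the wide or tall blocks
      contribute at most \<open>2 * n * w\<close> each.\<close>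
    define w where "w = q * r * 2 ^ q"
    have "n' * (q\<^sup>2 * (r * 2 ^ q)) = (n' * q) * w"
      by (simp add: power2_eq_square w_def)
    also have "\<dots> \<le> (2 * n) * w"
      using n'q by (rule mult_right_mono) simp
    finally have "4 * (n' * (q\<^sup>2 * (r * 2 ^ q))) \<le> 4 * ((2 * n) * w)"
      by (rule mult_left_mono) simp
    moreover have "4 * ((2 * n) * w) = mt_const r * n"
      by (simp add: c w_def)
    ultimately have 2: "4 * (n' * (q\<^sup>2 * (r * 2 ^ q))) \<le> mt_const r * n"
      by metis
    from S 1 2 show ?thesis
      by linarith
  qed
qed

section \<open>Induced permutations in large permutation patterns\<close>

text \<open>The room needed in each of \<open>Suc k\<close> sets: \<open>T * greedy_size T k\<close>
  vertices may be lost to \<open>T\<close> sets of compatible vertices that are too small, and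
  \<open>T * Suc k\<close> leaves \<open>T\<close> vertices over and exceeds the pigeonhole
  threshold \<open>T * k\<close>.\<close>

primrec greedy_size :: "nat \<Rightarrow> nat \<Rightarrow> nat" where
  "greedy_size T 0 = 0"
| "greedy_size T (Suc k) = T * greedy_size T k + T * Suc k"

text \<open>A greedy selection: a vertex of some \<open>V i0\<close> is fixed such that every other
  set keeps \<open>greedy_size T k\<close> vertices compatible with it, and the induction continues
  inside these.\<close>

lemma independent_choice:
  fixes V :: "'i \<Rightarrow> 'v set" and bad :: "'i \<Rightarrow> 'v \<Rightarrow> 'i \<Rightarrow> 'v \<Rightarrow> bool"
  assumes T: "T > 0" and sym: "\<And>i u j v. bad i u j v \<longleftrightarrow> bad j v i u"
    and free: "\<And>i j A B. \<lbrakk>i \<noteq> j; T \<le> card A; T \<le> card B; A \<subseteq> V i; B \<subseteq> V j\<rbrakk> \<Longrightarrow>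
      \<exists>u\<in>A. \<exists>v\<in>B. \<not> bad i u j v"
    and "finite I" and "\<And>i. i \<in> I \<Longrightarrow> finite (V i) \<and> greedy_size T (card I) \<le> card (V i)"
  shows "\<exists>u. \<forall>i\<in>I. u i \<in> V i \<and> (\<forall>j\<in>I. i \<noteq> j \<longrightarrow> \<not> bad i (u i) j (u j))"
  using assms(3-)
proof (induction "card I" arbitrary: I V)
  case 0
  then show ?case by simp
next
  case (Suc k I V)
  then obtain i0 where i0: "i0 \<in> I"
    by (metis card.empty ex_in_conv nat.distinct(1))
  define J where "J = I - {i0}"
  have J: "finite J" "card J = k" "i0 \<notin> J" "I = insert i0 J"
    using Suc.hyps(2) Suc.prems(2) i0 by (auto simp: J_def)
  have size: "finite (V i) \<and> T * greedy_size T k + T * Suc k \<le> card (V i)" if "i \<in> I" for i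
    using Suc.prems(3)[OF that] Suc.hyps(2)[symmetric] by simp
  define good where "good u j = {v \<in> V j. \<not> bad i0 u j v}" for u j
  \<comment> \<open>Otherwise \<open>T\<close> vertices of \<open>V i0\<close> are bad for all but few vertices of the same \<open>V j\<close>.\<close>
  have "\<exists>u\<in>V i0. \<forall>j\<in>J. greedy_size T k \<le> card (good u j)"
  proof (rule ccontr)
    assume "\<not> ?thesis"
    then have "\<forall>u. \<exists>j. u \<in> V i0 \<longrightarrow> j \<in> J \<and> card (good u j) < greedy_size T k"
      by (auto simp: not_le)
    from choice[OF this] obtain c
      where c: "\<forall>u. u \<in> V i0 \<longrightarrow> c u \<in> J \<and> card (good u (c u)) < greedy_size T k"
      by (rule exE)
    have "T * card J < card (V i0)"
      using size[OF i0] J(2) T by simp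
    then have "\<exists>j\<in>J. T < card {u \<in> V i0. c u = j}"
      using size[OF i0] J(1) c by (intro large_fibre) auto
    then obtain j where j: "j \<in> J" "T < card {u \<in> V i0. c u = j}"
      by blast
    then obtain A where A: "A \<subseteq> {u \<in> V i0. c u = j}" "card A = T"
      using obtain_subset_with_card_n[OF less_imp_le[OF j(2)]] by blast
    have finA: "finite A"
      using A(2) T card_gt_0_iff by metis
    define B where "B = V j - (\<Union>u\<in>A. good u j)"
    have "card (\<Union>u\<in>A. good u j) \<le> (\<Sum>u\<in>A. card (good u j))"
      by (rule card_UN_le[OF finA])
    also have "\<dots> \<le> (\<Sum>u\<in>A. greedy_size T k)"
      by (rule sum_mono) (use A(1) c in \<open>auto intro: less_imp_le\<close>)
    also have "\<dots> = T * greedy_size T k"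
      using A(2) by simp
    finally have "card (\<Union>u\<in>A. good u j) \<le> T * greedy_size T k" .
    moreover have "T * greedy_size T k + T \<le> card (V j)"
      using size[of j] j(1) J(4) by simp
    moreover have "card (V j) - card (\<Union>u\<in>A. good u j) \<le> card B"
      unfolding B_def by (rule diff_card_le_card_Diff)
        (use finA size[of j] j(1) J(4) in \<open>auto simp: good_def\<close>)
    ultimately have "T \<le> card B"
      by linarith
    moreover have "i0 \<noteq> j"
      using j(1) J(3) by blast
    ultimately have "\<exists>u\<in>A. \<exists>v\<in>B. \<not> bad i0 u j v"
      using A by (intro Suc.prems(1)) (auto simp: B_def)
    then show False
      by (auto simp: B_def good_def)
  qed
  then obtain u0 where u0: "u0 \<in> V i0" "\<And>j. j \<in> J \<Longrightarrow> greedy_size T k \<le> card (good u0 j)"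
    by blast
  have "\<exists>u. \<forall>i\<in>J. u i \<in> good u0 i \<and> (\<forall>j\<in>J. i \<noteq> j \<longrightarrow> \<not> bad i (u i) j (u j))"
  proof (rule Suc.hyps(1))
    show "k = card J"
      by (simp add: J(2))
    show "\<exists>u\<in>A. \<exists>v\<in>B. \<not> bad i u j v"
      if "i \<noteq> j" "T \<le> card A" "T \<le> card B" "A \<subseteq> good u0 i" "B \<subseteq> good u0 j" for i j A B
      using that by (intro Suc.prems(1)) (auto simp: good_def)
    show "finite J"
      by (fact J(1))
    show "finite (good u0 i) \<and> greedy_size T (card J) \<le> card (good u0 i)" if "i \<in> J" for i
      using u0(2)[OF that] size[of i] that J(2,4) by (auto simp: good_def)
  qed
  then obtain u where u: "\<forall>i\<in>J. u i \<in> good u0 i \<and> (\<forall>j\<in>J. i \<noteq> j \<longrightarrow> \<not> bad i (u i) j (u j))"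
    by (rule exE)
  show ?case
  proof (rule exI[of _ "u(i0 := u0)"])
    show "\<forall>i\<in>I. (u(i0 := u0)) i \<in> V i \<and>
        (\<forall>j\<in>I. i \<noteq> j \<longrightarrow> \<not> bad i ((u(i0 := u0)) i) j ((u(i0 := u0)) j))"
      using u u0(1) J(3,4) sym by (auto simp: good_def)
  qed
qed

section \<open>Relations without large bicliques\<close>

definition biclique_free :: "nat \<Rightarrow> (nat \<Rightarrow> nat \<Rightarrow> bool) \<Rightarrow> bool" where
  "biclique_free t R \<longleftrightarrow> \<not> (\<exists>X Y. card X = t \<and> card Y = t \<and> (\<forall>x\<in>X. \<forall>y\<in>Y. R x y))"

lemma biclique_freeD:
  assumes "biclique_free t R" and "t \<le> card X" and "t \<le> card Y"
  shows "\<exists>x\<in>X. \<exists>y\<in>Y. \<not> R x y"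
proof (rule ccontr)
  assume *: "\<not> ?thesis"
  obtain X' Y' where XY: "X' \<subseteq> X" "card X' = t" "Y' \<subseteq> Y" "card Y' = t"
    using assms(2,3) obtain_subset_with_card_n by metis
  with * have "\<forall>x\<in>X'. \<forall>y\<in>Y'. R x y"
    by blast
  with XY assms(1) show False
    unfolding biclique_free_def by blast
qed

text \<open>A set of \<open>2 * t\<close> vertices has \<open>2 ^ (2 * t)\<close> subsets; with more
  than \<open>t * 2 ^ (2 * t)\<close> vertices on the other side, more than \<open>t\<close> of them
  have the same neighbourhood in it.\<close>

definition two_colour_bound :: "nat \<Rightarrow> nat" where
  "two_colour_bound t = t * 2 ^ (2 * t) + 2 * t + 1"

lemma biclique_free_union:
  fixes a b c d :: "nat \<Rightarrow> nat"
  assumes R: "biclique_free t R" and inj: "inj_on a A" "inj_on b B" "inj_on c B" "inj_on d A"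
    and A: "two_colour_bound t \<le> card A" and B: "two_colour_bound t \<le> card B"
  shows "\<exists>u\<in>A. \<exists>v\<in>B. \<not> R (a u) (b v) \<and> \<not> R (c v) (d u)"
proof (rule ccontr)
  assume *: "\<not> ?thesis"
  obtain A0 where A0: "A0 \<subseteq> A" "card A0 = 2 * t" "finite A0"
  proof (rule obtain_subset_with_card_n[of "2 * t + 0" A])
    show "2 * t + 0 \<le> card A"
      using A by (simp add: two_colour_bound_def)
  qed (use that in auto)
  define col where "col v = {u \<in> A0. R (a u) (b v)}" for v
  have finB: "finite B"
    using B by (intro card_ge_0_finite) (simp add: two_colour_bound_def)
  have "t * card (Pow A0) < card B"
    using B A0(2,3) by (simp add: card_Pow two_colour_bound_def)
  then have "\<exists>z\<in>Pow A0. t < card {v \<in> B. col v = z}"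
    using A0(3) finB by (intro large_fibre) (auto simp: col_def)
  then obtain z where z: "z \<subseteq> A0" "t < card {v \<in> B. col v = z}"
    by blast
  let ?B = "{v \<in> B. col v = z}"
  show False
  proof (cases "t \<le> card z")
    case True
    then have "t \<le> card (a ` z)" "t \<le> card (b ` ?B)"
      using z A0(1) inj by (auto simp: card_image inj_on_subset[OF inj(1)] inj_on_subset[OF inj(2)])
    from biclique_freeD[OF R this] show False
      by (auto simp: col_def)
  next
    case False
    then have "t \<le> card (A0 - z)"
      using A0 z(1) by (simp add: card_Diff_subset finite_subset)
    then have "t \<le> card (d ` (A0 - z))" "t \<le> card (c ` ?B)"
      using z A0(1) inj_on_subset[OF inj(4) order_trans[OF Diff_subset A0(1)]]
      by (auto simp: card_image inj_on_subset[OF inj(3)])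
    from biclique_freeD[OF R this(2,1)] obtain v u where
      "v \<in> B" "col v = z" "u \<in> A0 - z" "\<not> R (c v) (d u)"
      by auto
    with * A0(1) show False
      by (auto simp: col_def)
  qed
qed

text \<open>The inflation of \<open>\<sigma>\<close>: every point becomes an increasing sequence of
  \<open>N\<close> points.\<close>

definition inflate :: "nat \<Rightarrow> (nat \<Rightarrow> nat) \<Rightarrow> nat \<Rightarrow> nat" where
  "inflate N \<sigma> a = \<sigma> (a div N) * N + a mod N"

lemma block_less: "i < k \<Longrightarrow> u < N \<Longrightarrow> i * N + u < k * (N :: nat)"
proof -
  assume "i < k" "u < N"
  then have "i * N + u < Suc i * N"
    by simp
  also have "\<dots> \<le> k * N"
    by (rule mult_le_mono1) (use \<open>i < k\<close> in simp)
  finally show ?thesis .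
qed

lemma inflate_block: "u < N \<Longrightarrow> inflate N \<sigma> (i * N + u) = \<sigma> i * N + u"
  by (simp add: inflate_def)

lemma bij_betw_inflate:
  assumes \<sigma>: "bij_betw \<sigma> {..<k} {..<k}"
  shows "bij_betw (inflate N \<sigma>) {..<k * N} {..<k * N}"
proof (cases "N = 0")
  case False
  have lt: "\<sigma> i < k" if "i < k" for i
    using \<sigma> that by (auto simp: bij_betw_def)
  have div: "a div N < k" if "a < k * N" for a
    using that by (simp add: less_mult_imp_div_less)
  have "inj_on (inflate N \<sigma>) {..<k * N}"
  proof (rule inj_onI)
    fix a b assume ab: "a \<in> {..<k * N}" "b \<in> {..<k * N}" "inflate N \<sigma> a = inflate N \<sigma> b"
    then have "inflate N \<sigma> a div N = inflate N \<sigma> b div N" "inflate N \<sigma> a mod N = inflate N \<sigma> b mod N"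
      by simp_all
    then have "\<sigma> (a div N) = \<sigma> (b div N)" "a mod N = b mod N"
      using False by (simp_all add: inflate_def)
    with \<sigma> div ab(1,2) have "a div N = b div N" "a mod N = b mod N"
      by (auto simp: bij_betw_def dest: inj_onD)
    then show "a = b"
      by (metis div_mult_mod_eq)
  qed
  moreover have "inflate N \<sigma> ` {..<k * N} \<subseteq> {..<k * N}"
    using False div lt by (auto simp: inflate_def intro!: block_less)
  ultimately show ?thesis
    by (simp add: bij_betw_def endo_inj_surj)
qed (simp add: bij_betw_def)

text \<open>One point per block is ordered like \<open>\<sigma>\<close> whatever the choice. Only
  points in the row chosen for one block and the column chosen for another must be avoided, and this
  is a conflict relation on pairs of blocks.\<close>

theorem induced_perm_of_contains_perm:
  assumes R: "biclique_free t R" and \<sigma>: "bij_betw \<sigma> {..<k} {..<k}"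
    and N: "N = greedy_size (two_colour_bound t) k"
    and "contains_perm (k * N) (inflate N \<sigma>) {(x, y). R x y}"
  shows "\<exists>f g. strict_mono_on {..<k} f \<and> strict_mono_on {..<k} g \<and>
    (\<forall>i<k. \<forall>j<k. R (f i) (g j) \<longleftrightarrow> \<sigma> i = j)"
proof -
  from assms(4) obtain f g where fg: "strict_mono_on {..<k * N} f" "strict_mono_on {..<k * N} g"
    "\<And>a. a < k * N \<Longrightarrow> R (f a) (g (inflate N \<sigma> a))"
    unfolding contains_perm_def by auto
  define x where "x i u = f (i * N + u)" for i u
  define y where "y i u = g (\<sigma> i * N + u)" for i u
  have \<sigma>lt: "\<sigma> i < k" if "i < k" for i
    using \<sigma> that by (auto simp: bij_betw_def)
  have Rxy: "R (x i u) (y i u)" if "i < k" "u < N" for i u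
    using fg(3)[OF block_less[OF that]] inflate_block[OF that(2)] by (simp add: x_def y_def)
  have "inj_on (\<lambda>u. h (j * N + u)) {..<N}" if h: "strict_mono_on {..<k * N} h" and "j < k" for h :: "nat \<Rightarrow> nat" and j
  proof (rule inj_onI)
    fix u v assume "u \<in> {..<N}" "v \<in> {..<N}" "h (j * N + u) = h (j * N + v)"
    then have "j * N + u = j * N + v"
      using inj_onD[OF strict_mono_on_imp_inj_on[OF h], of "j * N + u" "j * N + v"]
        block_less[OF \<open>j < k\<close>] by simp
    then show "u = v"
      by simp
  qed
  note block_inj = this
  have inj: "inj_on (x i) {..<N}" "inj_on (y i) {..<N}" if "i < k" for i
    unfolding x_def y_def using block_inj[OF fg(1) that] block_inj[OF fg(2) \<sigma>lt[OF that]] by blast+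
  define bad where "bad i u j v \<longleftrightarrow> i < k \<and> j < k \<longrightarrow> R (x i u) (y j v) \<or> R (x j v) (y i u)" for i u j v
  \<comment> \<open>Beyond \<open>k\<close> the sets are empty, so that a subset with
    \<open>?T > 0\<close> elements forces its index below \<open>k\<close>.\<close>
  let ?T = "two_colour_bound t" and ?V = "\<lambda>i. if i < k then {..<N} else {}"
  have "\<exists>u. \<forall>i\<in>{..<k}. u i \<in> ?V i \<and> (\<forall>j\<in>{..<k}. i \<noteq> j \<longrightarrow> \<not> bad i (u i) j (u j))"
  proof (rule independent_choice[of ?T])
    show "0 < ?T"
      by (simp add: two_colour_bound_def)
    show "bad i u j v \<longleftrightarrow> bad j v i u" for i u j v
      by (auto simp: bad_def)
    show "\<exists>u\<in>A. \<exists>v\<in>B. \<not> bad i u j v"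
      if "i \<noteq> j" "?T \<le> card A" "?T \<le> card B" "A \<subseteq> ?V i" "B \<subseteq> ?V j" for i j A B
    proof -
      have ij: "i < k" "j < k"
        using that by (auto simp: two_colour_bound_def split: if_splits)
      with that have "A \<subseteq> {..<N}" "B \<subseteq> {..<N}"
        by auto
      then have "inj_on (x i) A" "inj_on (y j) B" "inj_on (x j) B" "inj_on (y i) A"
        using inj ij inj_on_subset by metis+
      from biclique_free_union[OF R this that(2,3)] show ?thesis
        using ij by (auto simp: bad_def)
    qed
  qed (auto simp: N)
  then obtain u where u: "\<And>i. i < k \<Longrightarrow> u i < N"
    "\<And>i j. i < k \<Longrightarrow> j < k \<Longrightarrow> i \<noteq> j \<Longrightarrow> \<not> R (x i (u i)) (y j (u j))"
    unfolding bad_def by (metis lessThan_iff)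
  let ?\<tau> = "inv_into {..<k} \<sigma>"
  have \<tau>: "?\<tau> b < k" "\<sigma> (?\<tau> b) = b" if "b < k" for b
    using bij_betw_inv_into[OF \<sigma>] that \<sigma> by (auto simp: bij_betw_def f_inv_into_f)
  have \<tau>\<sigma>: "?\<tau> (\<sigma> i) = i" if "i < k" for i
    using \<sigma> that by (auto simp: bij_betw_def inv_into_f_f)
  have less: "i * N + a < j * N + b" if "i < j" "a < N" for i j a b :: nat
  proof -
    have "i * N + a < Suc i * N"
      using that by simp
    also have "\<dots> \<le> j * N"
      by (rule mult_le_mono1) (use that in simp)
    finally show ?thesis
      by simp
  qed
  \<comment> \<open>The columns follow the values of \<open>\<sigma>\<close>, so \<open>?g\<close>
    meets the blocks in the order of the inverse permutation.\<close>
  let ?f = "\<lambda>i. x i (u i)" and ?g = "\<lambda>b. y (?\<tau> b) (u (?\<tau> b))"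
  have "strict_mono_on {..<k} ?f"
    unfolding x_def using fg(1) u(1) block_less less
    by (auto simp: strict_mono_on_def)
  moreover have "strict_mono_on {..<k} ?g"
    unfolding y_def using fg(2) u(1) block_less less \<tau>
    by (auto simp: strict_mono_on_def)
  moreover have "R (?f i) (?g j) \<longleftrightarrow> \<sigma> i = j" if ij: "i < k" "j < k" for i j
  proof
    show "\<sigma> i = j" if "R (?f i) (?g j)"
      using u(2)[OF ij(1) \<tau>(1)[OF ij(2)]] that \<tau>(2)[OF ij(2)] by metis
    show "R (?f i) (?g j)" if "\<sigma> i = j"
      using Rxy[OF ij(1) u(1)[OF ij(1)]] \<tau>\<sigma>[OF ij(1)] that by auto
  qed
  ultimately show ?thesis
    by (intro exI[of _ ?f] exI[of _ ?g]) auto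
qed

section \<open>Interval partitions and partial embeddings\<close>

text \<open>A vertex is a line (row or column) of the matrix, and \<open>E\<close> joins a row to a column. A partition
  into intervals is given by the labelling \<open>P\<close> of vertices by parts. Vertices of one part that are
  joined to the same one-element parts form a class. For two classes that are not \<open>red\<close> to each
  other, the order and the adjacency of two members do not depend on the members.\<close>

locale line_graph =
  fixes L K :: nat and E EP :: "nat \<Rightarrow> nat \<Rightarrow> bool"
  assumes E_less: "E x y \<Longrightarrow> x < y"
begin

definition adj :: "nat \<Rightarrow> nat \<Rightarrow> bool" where
  "adj x y \<longleftrightarrow> E x y \<or> E y x"

definition cell :: "(nat \<Rightarrow> nat) \<Rightarrow> nat \<Rightarrow> nat \<Rightarrow> bool" where
  "cell P i j \<longleftrightarrow> (\<exists>x<L. \<exists>y<L. P x = i \<and> P y = j \<and> adj x y)"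

definition sing :: "(nat \<Rightarrow> nat) \<Rightarrow> nat \<Rightarrow> bool" where
  "sing P u \<longleftrightarrow> (\<forall>w<L. P w = P u \<longrightarrow> w = u)"

definition eqv :: "(nat \<Rightarrow> nat) \<Rightarrow> nat \<Rightarrow> nat \<Rightarrow> bool" where
  "eqv P x y \<longleftrightarrow> P x = P y \<and> (\<forall>u<L. sing P u \<longrightarrow> (adj x u \<longleftrightarrow> adj y u))"

definition cls :: "(nat \<Rightarrow> nat) \<Rightarrow> nat \<Rightarrow> nat" where
  "cls P x = (LEAST y. eqv P y x)"

text \<open>The pairs for which classes leave something open: the order inside a part, and the
  adjacency between two larger parts joined by some edge. A one-element part is red to no other
  part, because classes record the adjacency to it.\<close>

definition red :: "(nat \<Rightarrow> nat) \<Rightarrow> nat \<Rightarrow> nat \<Rightarrow> bool" where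
  "red P x y \<longleftrightarrow> P x = P y \<or> (\<not> sing P x \<and> \<not> sing P y \<and> cell P (P x) (P y))"

definition interval_partition :: "(nat \<Rightarrow> nat) \<Rightarrow> bool" where
  "interval_partition P \<longleftrightarrow> (\<forall>y<L. \<forall>x\<le>y. P x \<le> P y)"

definition coarser :: "(nat \<Rightarrow> nat) \<Rightarrow> (nat \<Rightarrow> nat) \<Rightarrow> bool" where
  "coarser P P2 \<longleftrightarrow> (\<forall>x<L. \<forall>y<L. P x = P y \<longrightarrow> P2 x = P2 y)"

lemma eqv_refl: "eqv P x x"
  by (simp add: eqv_def)

lemma eqv_sym: "eqv P x y \<Longrightarrow> eqv P y x"
  by (simp add: eqv_def)

lemma eqv_trans: "eqv P x y \<Longrightarrow> eqv P y z \<Longrightarrow> eqv P x z"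
  by (simp add: eqv_def)

lemma eqv_cls: "eqv P (cls P x) x"
  unfolding cls_def by (rule LeastI[of "\<lambda>y. eqv P y x" x]) (rule eqv_refl)

lemma cls_le: "cls P x \<le> x"
  unfolding cls_def by (rule Least_le) (rule eqv_refl)

lemma cls_eqI: "eqv P x y \<Longrightarrow> cls P x = cls P y"
  unfolding cls_def by (metis eqv_sym eqv_trans)

lemma cls_cls [simp]: "cls P (cls P x) = cls P x"
  by (rule cls_eqI) (rule eqv_cls)

lemma part_cls [simp]: "P (cls P x) = P x"
  using eqv_cls[of P x] by (simp add: eqv_def)

lemma adj_sym: "adj x y \<longleftrightarrow> adj y x"
  by (auto simp: adj_def)

lemma cell_sym: "cell P i j \<longleftrightarrow> cell P j i"
  using adj_sym by (auto simp: cell_def)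

lemma sing_part: "sing P x \<Longrightarrow> P x = P y \<Longrightarrow> y < L \<Longrightarrow> y = x"
  unfolding sing_def by metis

lemma red_sym: "red P x y \<longleftrightarrow> red P y x"
  using cell_sym by (auto simp: red_def)

lemma red_refl: "red P x x"
  by (simp add: red_def)

lemma red_cong:
  assumes "P x = P x'" "P y = P y'" "x < L" "x' < L" "y < L" "y' < L"
  shows "red P x y \<longleftrightarrow> red P x' y'"
proof -
  have "sing P x \<longleftrightarrow> sing P x'" "sing P y \<longleftrightarrow> sing P y'"
    using assms sing_part by metis+
  then show ?thesis
    using assms by (simp add: red_def)
qed

lemma red_cls: "x < L \<Longrightarrow> y < L \<Longrightarrow> red P (cls P x) (cls P y) \<longleftrightarrow> red P x y"
  using cls_le[of P x] cls_le[of P y] by (intro red_cong) simp_all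

lemma sing_coarser: "coarser P P2 \<Longrightarrow> u < L \<Longrightarrow> sing P2 u \<Longrightarrow> sing P u"
  unfolding coarser_def sing_def by blast

text \<open>A coarser partition has fewer one-element parts, hence fewer conditions on equivalent
  lines.\<close>

lemma eqv_coarser:
  assumes "coarser P P2" "eqv P x y" "x < L" "y < L"
  shows "eqv P2 x y"
proof -
  have "adj x u \<longleftrightarrow> adj y u" if "u < L" "sing P2 u" for u
    using assms(2) sing_coarser[OF assms(1) that] that(1) unfolding eqv_def by blast
  moreover have "P2 x = P2 y"
    using assms unfolding coarser_def eqv_def by blast
  ultimately show ?thesis
    unfolding eqv_def by blast
qed

lemma cls_coarser: "coarser P P2 \<Longrightarrow> x < L \<Longrightarrow> cls P2 (cls P x) = cls P2 x"
  using cls_le[of P x] by (intro cls_eqI eqv_coarser[OF _ eqv_cls]) simp_all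

section \<open>Partial embeddings and their states\<close>

definition ok :: "nat \<Rightarrow> nat \<Rightarrow> nat \<Rightarrow> nat \<Rightarrow> bool" where
  "ok x y s s' \<longleftrightarrow> (s < s' \<longrightarrow> x < y \<and> (E x y \<longleftrightarrow> EP s s'))"

text \<open>Lines of different intervals are ordered like the intervals. As to adjacency, either one
  of the parts is a single line and the class of the other line decides, or the parts are not joined
  at all.\<close>

lemma ok_transfer:
  assumes P: "interval_partition P" and x: "eqv P x x'" and y: "eqv P y y'" and nr: "\<not> red P x y"
    and L: "x < L" "x' < L" "y < L" "y' < L" and ok: "ok x y s s'"
  shows "ok x' y' s s'"
proof (cases "s < s'")
  case True
  with ok have xy: "x < y" "E x y \<longleftrightarrow> EP s s'"
    by (auto simp: ok_def)
  have parts: "P x = P x'" "P y = P y'" "P x \<noteq> P y"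
    using x y nr by (auto simp: eqv_def red_def)
  have "P x \<le> P y"
    using P xy(1) L(3) less_imp_le unfolding interval_partition_def by blast
  then have "P x < P y"
    using parts by simp
  then have "x' < y'"
    using parts P L unfolding interval_partition_def by (metis leD linorder_le_less_linear)
  have adj_E: "adj a b \<longleftrightarrow> E a b" if "a < b" for a b
    using that E_less by (auto simp: adj_def dest: less_asym)
  have "adj x y \<longleftrightarrow> adj x' y'"
  proof -
    consider "sing P x" | "sing P y" | "\<not> cell P (P x) (P y)"
      using nr by (auto simp: red_def)
    then show ?thesis
    proof cases
      case 1
      then have "x' = x"
        using sing_part parts L by blast
      then show ?thesis
        using y 1 L adj_sym by (auto simp: eqv_def)
    next
      case 2
      then have "y' = y"
        using sing_part parts L by blast
      then show ?thesis
        using x 2 L by (auto simp: eqv_def)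
    next
      case 3
      then show ?thesis
        using parts L by (auto simp: cell_def)
    qed
  qed
  then show ?thesis
    using xy \<open>x' < y'\<close> True adj_E by (simp add: ok_def)
qed (simp add: ok_def)

text \<open>A state \<open>ds\<close> assigns to pattern vertices their class representative plus one, and \<open>0\<close> to the
  pattern vertices that are absent.\<close>

definition feasible :: "(nat \<Rightarrow> nat) \<Rightarrow> (nat \<Rightarrow> nat) \<Rightarrow> bool" where
  "feasible P ds \<longleftrightarrow> (\<exists>f. \<forall>s<K. ds s \<noteq> 0 \<longrightarrow> f s < L \<and> Suc (cls P (f s)) = ds s \<and>
     (\<forall>s'<K. ds s' \<noteq> 0 \<longrightarrow> ok (f s) (f s') s s'))"

definition red_rel :: "(nat \<Rightarrow> nat) \<Rightarrow> (nat \<Rightarrow> nat) \<Rightarrow> (nat \<times> nat) set" where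
  "red_rel P ds = {(a, b). a < K \<and> b < K \<and> ds a \<noteq> 0 \<and> ds b \<noteq> 0 \<and> red P (ds a - 1) (ds b - 1)}"

definition red_connected :: "(nat \<Rightarrow> nat) \<Rightarrow> (nat \<Rightarrow> nat) \<Rightarrow> bool" where
  "red_connected P ds \<longleftrightarrow> (\<forall>s<K. \<forall>s'<K. ds s \<noteq> 0 \<longrightarrow> ds s' \<noteq> 0 \<longrightarrow> (s, s') \<in> (red_rel P ds)\<^sup>*)"

definition block :: "(nat \<Rightarrow> nat) \<Rightarrow> nat \<Rightarrow> (nat \<Rightarrow> nat) \<Rightarrow> nat \<Rightarrow> nat" where
  "block lab l ds s = (if lab s = l then ds s else 0)"

definition present :: "(nat \<Rightarrow> nat) \<Rightarrow> bool" where
  "present ds \<longleftrightarrow> (\<exists>s<K. ds s \<noteq> 0)"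

text \<open>\<open>T\<close> stands for membership in the table and \<open>Q\<close> for a bound on
  the labels, some of which may have empty blocks. Pairs from different blocks are tested on
  representatives only; this is enough because red pairs are excluded.\<close>

definition splits :: "(nat \<Rightarrow> nat) \<Rightarrow> ((nat \<Rightarrow> nat) \<Rightarrow> bool) \<Rightarrow> nat \<Rightarrow> (nat \<Rightarrow> nat) \<Rightarrow> (nat \<Rightarrow> nat) \<Rightarrow> bool" where
  "splits P T Q lab ds \<longleftrightarrow> (\<forall>l<Q. present (block lab l ds) \<longrightarrow> T (block lab l ds)) \<and>
     (\<forall>s<K. \<forall>s'<K. ds s \<noteq> 0 \<and> ds s' \<noteq> 0 \<and> lab s \<noteq> lab s' \<longrightarrow>
        \<not> red P (ds s - 1) (ds s' - 1) \<and> ok (ds s - 1) (ds s' - 1) s s')"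

definition push :: "(nat \<Rightarrow> nat) \<Rightarrow> (nat \<Rightarrow> nat) \<Rightarrow> nat \<Rightarrow> nat" where
  "push P2 ds s = (if ds s = 0 then 0 else Suc (cls P2 (ds s - 1)))"

section \<open>Coarsening, glueing and splitting of states\<close>

lemma feasible_push:
  assumes "coarser P P2" and "feasible P ds"
  shows "feasible P2 (push P2 ds)"
proof -
  from assms(2) obtain f where f: "\<forall>s<K. ds s \<noteq> 0 \<longrightarrow> f s < L \<and> Suc (cls P (f s)) = ds s \<and>
     (\<forall>s'<K. ds s' \<noteq> 0 \<longrightarrow> ok (f s) (f s') s s')"
    unfolding feasible_def by (rule exE)
  have "cls P2 (ds s - 1) = cls P2 (f s)" if "s < K" "ds s \<noteq> 0" for s
    using f that cls_coarser[OF assms(1), of "f s"] by (metis diff_Suc_1)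
  then show ?thesis
    unfolding feasible_def push_def using f by (intro exI[of _ f]) auto
qed

text \<open>The blocks are embedded independently of each other. Two vertices of different blocks
  are not red, so the test on their representatives carries over to the lines chosen for
  them.\<close>

lemma feasible_glue:
  assumes P: "interval_partition P" and T: "\<And>ds. T ds \<Longrightarrow> feasible P ds"
    and sp: "splits P T Q lab ds" and lab: "\<And>s. s < K \<Longrightarrow> lab s < Q"
  shows "feasible P ds"
proof -
  have "\<forall>l. \<exists>f. l < Q \<longrightarrow> (\<forall>s<K. block lab l ds s \<noteq> 0 \<longrightarrow> f s < L \<and> Suc (cls P (f s)) = block lab l ds s \<and>
     (\<forall>s'<K. block lab l ds s' \<noteq> 0 \<longrightarrow> ok (f s) (f s') s s'))"
  proof (intro allI)
    fix l
    show "\<exists>f. l < Q \<longrightarrow> (\<forall>s<K. block lab l ds s \<noteq> 0 \<longrightarrow> f s < L \<and> Suc (cls P (f s)) = block lab l ds s \<and>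
     (\<forall>s'<K. block lab l ds s' \<noteq> 0 \<longrightarrow> ok (f s) (f s') s s'))"
    proof (cases "l < Q \<and> present (block lab l ds)")
      case True
      then have "feasible P (block lab l ds)"
        using T sp by (simp add: splits_def)
      then show ?thesis
        unfolding feasible_def by blast
    next
      case False
      then show ?thesis
        by (auto simp: present_def)
    qed
  qed
  from choice[OF this] obtain F where F: "\<forall>l. l < Q \<longrightarrow> (\<forall>s<K. block lab l ds s \<noteq> 0 \<longrightarrow>
      F l s < L \<and> Suc (cls P (F l s)) = block lab l ds s \<and>
     (\<forall>s'<K. block lab l ds s' \<noteq> 0 \<longrightarrow> ok (F l s) (F l s') s s'))"
    by (rule exE)
  let ?f = "\<lambda>s. F (lab s) s"
  have f: "?f s < L" "ds s - 1 = cls P (?f s)" "Suc (cls P (?f s)) = ds s"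
    if "s < K" "ds s \<noteq> 0" for s
    using F[rule_format, OF lab[OF that(1)] that(1)] that by (auto simp: block_def)
  have "ok (?f s) (?f s') s s'" if s: "s < K" "ds s \<noteq> 0" "s' < K" "ds s' \<noteq> 0" for s s'
  proof (cases "lab s = lab s'")
    case True
    then show ?thesis
      using F[rule_format, OF lab[OF s(1)] s(1)] s by (auto simp: block_def)
  next
    case False
    then have nr: "\<not> red P (cls P (?f s)) (cls P (?f s'))" and ok: "ok (cls P (?f s)) (cls P (?f s')) s s'"
      using sp s unfolding splits_def by (metis f(2))+
    show ?thesis
      using cls_le[of P "?f s"] cls_le[of P "?f s'"] f(1)[OF s(1,2)] f(1)[OF s(3,4)]
      by (intro ok_transfer[OF P eqv_cls eqv_cls nr _ _ _ _ ok]) simp_all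
  qed
  then show ?thesis
    unfolding feasible_def using f by (intro exI[of _ ?f]) auto
qed

text \<open>The vertices represent classes of the finer partition \<open>P\<close>, while the steps
  are red for the coarser \<open>P2\<close>: the state that is broken up is known to be connected
  only after the merge.\<close>

definition red_walk :: "(nat \<Rightarrow> nat) \<Rightarrow> (nat \<Rightarrow> nat) \<Rightarrow> nat \<Rightarrow> (nat \<Rightarrow> nat) \<Rightarrow> bool" where
  "red_walk P P2 W w \<longleftrightarrow> (\<forall>j\<le>W. w j < L \<and> cls P (w j) = w j) \<and> (\<forall>j<W. red P2 (w j) (w (Suc j)))"

lemma relpow_walk:
  assumes "(a, b) \<in> (red_rel P ds) ^^ n" and "n \<le> W"
    and "\<And>s. s < K \<Longrightarrow> ds s \<noteq> 0 \<Longrightarrow> u s < L \<and> cls P' (u s) = u s"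
    and "\<And>s s'. (s, s') \<in> red_rel P ds \<Longrightarrow> red P2 (u s) (u s')"
    and "a < K" "ds a \<noteq> 0"
  shows "\<exists>w. red_walk P' P2 W w \<and> w 0 = u a \<and> w W = u b"
proof -
  from assms(1) obtain p where p: "p 0 = a" "p n = b" "\<forall>i<n. (p i, p (Suc i)) \<in> red_rel P ds"
    unfolding relpow_fun_conv by blast
  have in_K: "p i < K \<and> ds (p i) \<noteq> 0" if "i \<le> n" for i
    using that p assms(5,6) by (cases i) (auto simp: red_rel_def)
  \<comment> \<open>All walks get the same length \<open>W\<close>: after \<open>n\<close> steps the
    walk waits, which is possible as \<open>red\<close> is reflexive.\<close>
  let ?w = "\<lambda>j. u (p (min j n))"
  have "red P2 (?w j) (?w (Suc j))" for j
    using p(3) assms(4) by (cases "j < n") (auto simp: min_def red_refl not_less_eq_eq)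
  then have "red_walk P' P2 W ?w"
    using in_K assms(3) by (auto simp: red_walk_def)
  then show ?thesis
    using p(1,2) assms(2) by (intro exI[of _ ?w]) (auto simp: min_def)
qed

text \<open>The number of pairs in the relation bounds the number of steps needed. This crude bound
  is the origin of the walk length \<open>K * K\<close>.\<close>

lemma rtrancl_red_rel_relpow:
  assumes "(a, b) \<in> (red_rel P ds)\<^sup>*"
  shows "\<exists>n\<le>K * K. (a, b) \<in> (red_rel P ds) ^^ n"
proof -
  have sub: "red_rel P ds \<subseteq> {..<K} \<times> {..<K}"
    by (auto simp: red_rel_def)
  then have "finite (red_rel P ds)" "card (red_rel P ds) \<le> K * K"
    using finite_subset[OF sub] card_mono[OF _ sub] by (simp_all add: card_cartesian_product)
  with assms show ?thesis
    using rtrancl_finite_eq_relpow[of "red_rel P ds"] by (auto intro: le_trans)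
qed

text \<open>An embedding for the coarser partition is read with the classes of the finer one and cut
  into red components there. Vertices of different components are not red, so their representatives
  satisfy the cross conditions as well. Connectedness with respect to \<open>P2\<close> supplies
  walks to all vertices from one line \<open>X\<close>.\<close>

lemma feasible_split:
  assumes P: "interval_partition P" and co: "coarser P P2"
    and fe: "feasible P2 ds2" and con: "red_connected P2 ds2" and pr: "present ds2" and Q: "K \<le> Q"
  shows "\<exists>ds lab X. (\<forall>s<K. lab s < K) \<and> (\<forall>s<K. push P2 ds s = ds2 s) \<and> (\<forall>s<K. ds s \<le> L) \<and>
    splits P (\<lambda>ds. feasible P ds \<and> red_connected P ds) Q lab ds \<and> X < L \<and>
    (\<forall>s<K. ds s \<noteq> 0 \<longrightarrow> (\<exists>w. red_walk P P2 (K * K) w \<and> w 0 = X \<and> Suc (w (K * K)) = ds s))"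
proof -
  from fe obtain f where f: "\<forall>s<K. ds2 s \<noteq> 0 \<longrightarrow> f s < L \<and> Suc (cls P2 (f s)) = ds2 s \<and>
     (\<forall>s'<K. ds2 s' \<noteq> 0 \<longrightarrow> ok (f s) (f s') s s')"
    unfolding feasible_def by (rule exE)
  define ds where "ds s = (if ds2 s = 0 then 0 else Suc (cls P (f s)))" for s
  define R where "R = red_rel P ds"
  \<comment> \<open>A component is named by its least member, so that the labels stay below
    \<open>K\<close>.\<close>
  define lab where "lab s = (if ds s = 0 then 0 else LEAST s'. (s', s) \<in> R\<^sup>*)" for s
  have ds0: "ds s = 0 \<longleftrightarrow> ds2 s = 0" for s
    by (simp add: ds_def)
  have fL: "f s < L" "ds s - 1 = cls P (f s)" "ds2 s - 1 = cls P2 (f s)" if "s < K" "ds s \<noteq> 0" for s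
    using f that by (auto simp: ds_def split: if_splits)
  have symR: "sym R"
    using red_sym by (auto simp: R_def red_rel_def sym_def)
  have lab_le: "lab s \<le> s" for s
    by (auto simp: lab_def intro: Least_le)
  have lab_rtrancl: "(lab s, s) \<in> R\<^sup>*" if "ds s \<noteq> 0" for s
    using that LeastI[of "\<lambda>s'. (s', s) \<in> R\<^sup>*" s] by (simp add: lab_def)
  have lab_R: "lab a = lab b" if "(a, b) \<in> R\<^sup>*" "ds a \<noteq> 0" "ds b \<noteq> 0" for a b
  proof -
    have "(s', a) \<in> R\<^sup>* \<longleftrightarrow> (s', b) \<in> R\<^sup>*" for s'
      using that(1) symR by (meson rtrancl_trans sym_rtrancl symD)
    with that show ?thesis
      by (simp add: lab_def)
  qed
  have feas: "feasible P (block lab l ds)" for l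
    unfolding feasible_def using f
    by (intro exI[of _ f]) (auto simp: block_def ds_def)
  have conn: "red_connected P (block lab l ds)" for l
    unfolding red_connected_def
  proof (intro allI impI)
    fix s s' assume s: "s < K" "s' < K" "block lab l ds s \<noteq> 0" "block lab l ds s' \<noteq> 0"
    have "(s, s') \<in> R\<^sup>*"
      using s lab_rtrancl[of s] lab_rtrancl[of s'] symR
      by (auto simp: block_def split: if_splits) (metis rtrancl_trans sym_rtrancl symD)
    then have "(s, s') \<in> (red_rel P (block lab l ds))\<^sup>* \<and> block lab l ds s' \<noteq> 0"
    proof (induction rule: rtrancl_induct)
      case base
      then show ?case using s by simp
    next
      case (step y z)
      from step(2) have yz: "ds y \<noteq> 0" "ds z \<noteq> 0"
        by (auto simp: R_def red_rel_def)
      then have "lab y = lab z"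
        using lab_R[of y z] step(2) by blast
      with step(3) yz have *: "block lab l ds y = ds y" "block lab l ds z = ds z"
        by (auto simp: block_def split: if_splits)
      with step(2) have "(y, z) \<in> red_rel P (block lab l ds)"
        by (auto simp: R_def red_rel_def)
      with step(3) * yz show ?case
        by (auto intro: rtrancl_into_rtrancl)
    qed
    then show "(s, s') \<in> (red_rel P (block lab l ds))\<^sup>*"
      by (rule conjunct1)
  qed
  have "splits P (\<lambda>ds. feasible P ds \<and> red_connected P ds) Q lab ds"
    unfolding splits_def
  proof (intro conjI allI impI)
    fix s s' assume "s < K" "s' < K" and *: "ds s \<noteq> 0 \<and> ds s' \<noteq> 0 \<and> lab s \<noteq> lab s'"
    note s = \<open>s < K\<close> \<open>s' < K\<close> *
    have "(s, s') \<notin> R"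
      using s lab_R[of s s'] by blast
    then show nr: "\<not> red P (ds s - 1) (ds s' - 1)"
      using s by (simp add: R_def red_rel_def)
    then have nr': "\<not> red P (f s) (f s')"
      using red_cls[of "f s" "f s'" P] fL s by simp
    have ok: "ok (f s) (f s') s s'"
      using f s by (simp add: ds0)
    have "ok (cls P (f s)) (cls P (f s')) s s'"
      using fL s cls_le[of P "f s"] cls_le[of P "f s'"]
      by (intro ok_transfer[OF P eqv_sym[OF eqv_cls] eqv_sym[OF eqv_cls] nr' _ _ _ _ ok])
        (metis le_less_trans)+
    then show "ok (ds s - 1) (ds s' - 1) s s'"
      using fL s by simp
  qed (simp_all add: feas conn)
  moreover have "push P2 ds s = ds2 s" if "s < K" for s
    using f that fL[of s] cls_coarser[OF co, of "f s"] by (cases "ds2 s = 0") (auto simp: push_def ds_def)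
  moreover obtain s0 where s0: "s0 < K" "ds2 s0 \<noteq> 0"
    using pr by (auto simp: present_def)
  moreover have "\<exists>w. red_walk P P2 (K * K) w \<and> w 0 = cls P (f s0) \<and> Suc (w (K * K)) = ds s"
    if s: "s < K" "ds s \<noteq> 0" for s
  proof -
    have "(s0, s) \<in> (red_rel P2 ds2)\<^sup>*"
      using con s0 s by (simp add: red_connected_def ds0)
    then obtain n where n: "n \<le> K * K" "(s0, s) \<in> (red_rel P2 ds2) ^^ n"
      using rtrancl_red_rel_relpow by blast
    have "\<exists>w. red_walk P P2 (K * K) w \<and> w 0 = cls P (f s0) \<and> w (K * K) = cls P (f s)"
    proof (rule relpow_walk[OF n(2,1)])
      show "cls P (f s) < L \<and> cls P (cls P (f s)) = cls P (f s)" if "s < K" "ds2 s \<noteq> 0" for s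
        using fL[of s] that cls_le[of P "f s"] by (simp add: ds0)
      show "red P2 (cls P (f a)) (cls P (f b))" if "(a, b) \<in> red_rel P2 ds2" for a b
      proof -
        have ab: "a < K" "b < K" "ds a \<noteq> 0" "ds b \<noteq> 0" "red P2 (cls P2 (f a)) (cls P2 (f b))"
          using that fL by (auto simp: red_rel_def ds0)
        then have L: "f a < L" "f b < L"
          using fL by blast+
        then have "red P2 (cls P2 (cls P (f a))) (cls P2 (cls P (f b)))"
          using ab(5) cls_coarser[OF co] by simp
        then show ?thesis
          using L cls_le[of P "f a"] cls_le[of P "f b"] red_cls[of "cls P (f a)" "cls P (f b)" P2] by simp
      qed
    qed (use s0 in auto)
    then show ?thesis
      using s by (auto simp: ds_def split: if_splits)
  qed
  moreover have "cls P (f s0) < L"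
    using fL[of s0] s0 cls_le[of P "f s0"] by (simp add: ds0)
  moreover have "lab s < K" if "s < K" for s
    using lab_le[of s] that by simp
  moreover have "ds s \<le> L" if "s < K" for s
    using fL[of s] that cls_le[of P "f s"] by (cases "ds s = 0") auto
  ultimately show ?thesis
    by (rule_tac exI[of _ ds], rule_tac exI[of _ lab], rule_tac exI[of _ "cls P (f s0)"]) blast
qed

section \<open>The finest and the coarsest partition\<close>

lemma sing_id: "sing (\<lambda>x. x) u"
  by (simp add: sing_def)

lemma cls_id: "cls (\<lambda>x. x) u = u"
  by (metis part_cls)

lemma feasible_single: "x < L \<Longrightarrow> feasible (\<lambda>x. x) ((\<lambda>_. 0)(s := Suc x))"
  unfolding feasible_def by (intro exI[of _ "\<lambda>_. x"]) (auto simp: cls_id ok_def)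

text \<open>Among single lines only equal ones are red to each other, whereas \<open>ok\<close>
  sends distinct pattern vertices to distinct lines. So no two pattern vertices can be
  connected.\<close>

lemma feasible_id_single:
  assumes "feasible (\<lambda>x. x) ds" "red_connected (\<lambda>x. x) ds" "present ds"
  shows "\<exists>s<K. \<exists>x<L. \<forall>s'<K. ds s' = ((\<lambda>_. 0)(s := Suc x)) s'"
proof -
  from assms(1) obtain f where f: "\<forall>s<K. ds s \<noteq> 0 \<longrightarrow> f s < L \<and> Suc (f s) = ds s \<and>
     (\<forall>s'<K. ds s' \<noteq> 0 \<longrightarrow> ok (f s) (f s') s s')"
    unfolding feasible_def cls_id by (rule exE)
  obtain s where s: "s < K" "ds s \<noteq> 0"
    using assms(3) by (auto simp: present_def)
  have "ds s' = 0" if "s' < K" "s' \<noteq> s" for s'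
  proof (rule ccontr)
    assume s': "ds s' \<noteq> 0"
    have "(s, s') \<in> (red_rel (\<lambda>x. x) ds)\<^sup>*"
      using assms(2) s s' that by (simp add: red_connected_def)
    then have "ds s' = ds s"
    proof (induction rule: rtrancl_induct)
      case (step y z)
      then show ?case
        by (auto simp: red_rel_def red_def sing_id)
    qed simp
    then have "f s = f s'"
      using f s s' that by (metis Suc_inject)
    moreover have "ok (f s) (f s') s s'" "ok (f s') (f s) s' s"
      using f s s' that by blast+
    ultimately show False
      using that(2) by (cases "s < s'") (auto simp: ok_def)
  qed
  then show ?thesis
    using s f by (intro exI[of _ s] exI[of _ "f s"] conjI) auto
qed

text \<open>With at least two lines in the only part there is no one-element part. All lines then
  form one class with representative \<open>0\<close>, stored as \<open>1\<close>, and the state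
  retains no information about the images.\<close>

lemma feasible_one_part:
  assumes "\<And>x. x < L \<Longrightarrow> P x = 0" and "2 \<le> L"
  shows "feasible P (\<lambda>s. if s < K then 1 else 0) \<longleftrightarrow>
      (\<exists>f. \<forall>s<K. f s < L \<and> (\<forall>s'<K. ok (f s) (f s') s s'))" (is ?A)
    and "red_connected P (\<lambda>s. if s < K then 1 else 0)" (is ?B)
proof -
  have ns: "\<not> sing P u" if "u < L" for u
  proof
    assume "sing P u"
    moreover have "P 0 = P u" "P 1 = P u" "0 < L" "1 < L"
      using assms that by simp_all
    ultimately have "0 = u" "1 = u"
      unfolding sing_def by blast+
    then show False
      by simp
  qed
  have cls: "cls P x = 0" if "x < L" for x
  proof -
    have "eqv P 0 x"
      using assms that ns by (simp add: eqv_def)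
    then show ?thesis
      unfolding cls_def by (metis Least_eq_0)
  qed
  have "(\<forall>s<K. (if s < K then 1 else 0) \<noteq> (0 :: nat) \<longrightarrow>
      f s < L \<and> Suc (cls P (f s)) = (if s < K then 1 else 0) \<and>
      (\<forall>s'<K. (if s' < K then 1 else 0) \<noteq> (0 :: nat) \<longrightarrow> ok (f s) (f s') s s')) \<longleftrightarrow>
    (\<forall>s<K. f s < L \<and> (\<forall>s'<K. ok (f s) (f s') s s'))" for f
    using cls by (simp cong: conj_cong)
  then show ?A
    unfolding feasible_def by simp
  show ?B
    by (auto simp: red_connected_def red_rel_def red_refl intro!: r_into_rtrancl)
qed

end

section \<open>Merging neighbouring parts\<close>

context line_graph
begin

text \<open>Here \<open>v\<close> is the last line of its part, and the next part is joined to it by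
  lowering all later labels. For \<open>v = L\<close> the label of no line changes.\<close>

definition merge :: "(nat \<Rightarrow> nat) \<Rightarrow> nat \<Rightarrow> nat \<Rightarrow> nat" where
  "merge P v x = (if v < x then P x - 1 else P x)"

text \<open>Since the labels of \<open>v\<close> and \<open>Suc v\<close> differ, \<open>v\<close>
  ends its part. The parts are counted as they are before the merge; their number can only drop by
  it.\<close>

definition mergeable :: "nat \<Rightarrow> (nat \<Rightarrow> nat) \<Rightarrow> nat \<Rightarrow> bool" where
  "mergeable d P v \<longleftrightarrow> Suc v < L \<and> P v \<noteq> P (Suc v) \<and>
     card {j. j < L \<and> (cell P (P v) j \<or> cell P (P (Suc v)) j)} \<le> d"

text \<open>One-element parts are exempt from the degree bound: they cause no red edges.\<close>

definition good_partition :: "nat \<Rightarrow> (nat \<Rightarrow> nat) \<Rightarrow> bool" where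
  "good_partition d P \<longleftrightarrow> interval_partition P \<and> P 0 = 0 \<and>
     (\<forall>x. Suc x < L \<longrightarrow> P (Suc x) \<le> Suc (P x)) \<and>
     (\<forall>x<L. \<not> sing P x \<longrightarrow> card {j. cell P (P x) j} \<le> d)"

lemma part_mono: "good_partition d P \<Longrightarrow> x \<le> y \<Longrightarrow> y < L \<Longrightarrow> P x \<le> P y"
  by (simp add: good_partition_def interval_partition_def)

lemma part_le: "good_partition d P \<Longrightarrow> x < L \<Longrightarrow> P x \<le> x"
proof (induction x)
  case (Suc x)
  then have "P (Suc x) \<le> Suc (P x)"
    by (simp add: good_partition_def)
  with Suc show ?case
    by simp
qed (simp add: good_partition_def)

lemma finite_cells: "finite {j. cell P i j}"
  by (rule finite_subset[of _ "P ` {..<L}"]) (auto simp: cell_def)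

lemma good_partition_id: "good_partition d (\<lambda>x. x)"
  by (auto simp: good_partition_def interval_partition_def sing_id)

text \<open>In memory a labelling is an array with arbitrary entries from \<open>L\<close> on, so
  properties have to be transferred between labellings that agree on the lines.\<close>

lemma good_partition_cong:
  assumes "good_partition d P" and eq: "\<And>x. x < L \<Longrightarrow> P x = P' x" and "0 < L"
  shows "good_partition d P'" and "coarser P P'"
proof -
  have s: "sing P' x \<longleftrightarrow> sing P x" if "x < L" for x
    using eq that by (auto simp: sing_def)
  have c: "cell P' i j \<longleftrightarrow> cell P i j" for i j
    by (simp add: cell_def eq cong: conj_cong)
  show "good_partition d P'"
    unfolding good_partition_def interval_partition_def
  proof (intro conjI allI impI)
    show "P' x \<le> P' y" if "y < L" "x \<le> y" for x y
      using part_mono[OF assms(1) that(2,1)] eq[of x] eq[of y] that by simp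
    show "P' 0 = 0"
      using assms(1,3) eq[of 0] by (simp add: good_partition_def)
    show "P' (Suc x) \<le> Suc (P' x)" if "Suc x < L" for x
    proof -
      have "P (Suc x) \<le> Suc (P x)"
        using assms(1) that by (simp add: good_partition_def)
      then show ?thesis
        using eq[of x] eq[of "Suc x"] that by simp
    qed
    show "card {j. cell P' (P' x) j} \<le> d" if "x < L" "\<not> sing P' x" for x
    proof -
      have "card {j. cell P (P x) j} \<le> d"
        using assms(1) s[of x] that by (simp add: good_partition_def)
      then show ?thesis
        using eq[of x] that c by simp
    qed
  qed
  show "coarser P P'"
    unfolding coarser_def using eq by auto
qed

lemma merge_none: "x < L \<Longrightarrow> L \<le> v \<Longrightarrow> merge P v x = P x"
  by (simp add: merge_def)

context
  fixes d P v
  assumes good: "good_partition d P" and me: "mergeable d P v"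
begin

lemma merge_facts: "P (Suc v) = Suc (P v)" "Suc v < L"
proof -
  show L: "Suc v < L"
    using me by (simp add: mergeable_def)
  have "P v \<le> P (Suc v)" "P (Suc v) \<le> Suc (P v)" "P v \<noteq> P (Suc v)"
    using part_mono[OF good, of v "Suc v"] L good me by (simp_all add: good_partition_def mergeable_def)
  then show "P (Suc v) = Suc (P v)"
    by simp
qed

lemma less_iff_part: "y < L \<Longrightarrow> v < y \<longleftrightarrow> P v < P y"
  using part_mono[OF good, of "Suc v" y] part_mono[OF good, of y v] merge_facts by fastforce

lemma merge_label: "y < L \<Longrightarrow> merge P v y = (if P v < P y then P y - 1 else P y)"
  using less_iff_part by (simp add: merge_def)

lemma coarser_merge: "coarser P (merge P v)"
  unfolding coarser_def by (simp add: merge_label)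

lemma merge_last: "merge P v (L - 1) = P (L - 1) - 1" "0 < P (L - 1)"
proof -
  have "v < L - 1" "L - 1 < L"
    using merge_facts by simp_all
  then show "merge P v (L - 1) = P (L - 1) - 1" "0 < P (L - 1)"
    using less_iff_part[of "L - 1"] by (simp_all add: merge_def)
qed

lemma cell_merge:
  assumes "cell (merge P v) i j"
  shows "\<exists>i' j'. cell P i' j' \<and> i = (if P v < i' then i' - 1 else i') \<and> j = (if P v < j' then j' - 1 else j')"
proof -
  from assms obtain x y where xy: "x < L" "y < L" "merge P v x = i" "merge P v y = j" "adj x y"
    unfolding cell_def by blast
  then have "cell P (P x) (P y)"
    unfolding cell_def by blast
  with xy show ?thesis
    using merge_label[of x] merge_label[of y] by blast
qed

text \<open>The new part obeys the degree bound by \<open>mergeable\<close>. Any other part keeps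
  its members, and the parts joined to it are images of the former ones under the relabelling
  \<open>?\<mu>\<close>.\<close>

lemma good_partition_merge: "good_partition d (merge P v)"
proof -
  have "interval_partition (merge P v)"
    unfolding interval_partition_def
  proof (intro allI impI)
    fix x y assume "y < L" "x \<le> y"
    then show "merge P v x \<le> merge P v y"
      using part_mono[OF good, of x y] merge_label[of x] merge_label[of y] by (auto split: if_splits)
  qed
  moreover have "merge P v 0 = 0"
    using good by (simp add: merge_def good_partition_def)
  moreover have "merge P v (Suc x) \<le> Suc (merge P v x)" if "Suc x < L" for x
  proof -
    have "P (Suc x) \<le> Suc (P x)"
      using good that by (simp add: good_partition_def)
    moreover have "P (Suc v) = Suc (P v)"
      by (rule merge_facts)
    ultimately show ?thesis
      using that merge_label[of x] merge_label[of "Suc x"] by (auto split: if_splits)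
  qed
  moreover have "card {j. cell (merge P v) (merge P v x) j} \<le> d" if x: "x < L" "\<not> sing (merge P v) x" for x
  proof -
    let ?\<mu> = "\<lambda>i. if P v < i then i - 1 else i"
    show ?thesis
    proof (cases "P x = P v \<or> P x = Suc (P v)")
      case True
      then have mx: "merge P v x = P v"
        using merge_label[OF x(1)] by auto
      have lab: "j < L" if "cell P i j" for i j
        using that part_le[OF good] unfolding cell_def by (metis le_less_trans)
      let ?A = "{j. j < L \<and> (cell P (P v) j \<or> cell P (P (Suc v)) j)}"
      have "{j. cell (merge P v) (merge P v x) j} \<subseteq> ?\<mu> ` ?A"
      proof
        fix j assume "j \<in> {j. cell (merge P v) (merge P v x) j}"
        then obtain i' j' where ij: "cell P i' j'" "P v = ?\<mu> i'" "j = ?\<mu> j'"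
          using cell_merge mx by (metis mem_Collect_eq)
        then have "i' = P v \<or> i' = Suc (P v)"
          by (auto split: if_splits)
        then have "j' \<in> ?A"
          using ij(1) lab merge_facts by auto
        with ij(3) show "j \<in> ?\<mu> ` ?A"
          by blast
      qed
      then have "card {j. cell (merge P v) (merge P v x) j} \<le> card ?A"
        by (rule surj_card_le[rotated]) simp
      also have "\<dots> \<le> d"
        using me by (simp add: mergeable_def)
      finally show ?thesis .
    next
      case False
      have "\<not> sing P x"
      proof
        assume "sing P x"
        have "sing (merge P v) x"
          unfolding sing_def
        proof (intro allI impI)
          fix w assume w: "w < L" "merge P v w = merge P v x"
          then have "P w = P x"
            using False merge_label[OF w(1)] merge_label[OF x(1)] by (auto split: if_splits)
          then show "w = x"
            using sing_part[OF \<open>sing P x\<close>, of w] w by simp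
        qed
        with x show False
          by simp
      qed
      have "{j. cell (merge P v) (merge P v x) j} \<subseteq> ?\<mu> ` {j. cell P (P x) j}"
      proof
        fix j assume "j \<in> {j. cell (merge P v) (merge P v x) j}"
        then obtain i' j' where ij: "cell P i' j'" "merge P v x = ?\<mu> i'" "j = ?\<mu> j'"
          using cell_merge by (metis mem_Collect_eq)
        then have "i' = P x"
          using False merge_label[OF x(1)] by (auto split: if_splits)
        with ij show "j \<in> ?\<mu> ` {j. cell P (P x) j}"
          by blast
      qed
      then have "card {j. cell (merge P v) (merge P v x) j} \<le> card {j. cell P (P x) j}"
        by (rule surj_card_le[rotated]) (rule finite_cells)
      also have "\<dots> \<le> d"
        using good \<open>\<not> sing P x\<close> x by (simp add: good_partition_def)
      finally show ?thesis .
    qed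
  qed
  ultimately show ?thesis
    by (simp add: good_partition_def)
qed

end

section \<open>Bounded red neighbourhoods\<close>

definition red_nbrs :: "(nat \<Rightarrow> nat) \<Rightarrow> (nat \<Rightarrow> nat) \<Rightarrow> nat \<Rightarrow> nat set" where
  "red_nbrs P P2 X = {y. y < L \<and> cls P y = y \<and> red P2 X y}"

text \<open>A one-element part has a single class. The classes of a larger part are told apart by
  the one-element parts they are joined to, which are among the at most \<open>d\<close> parts
  joined to the whole part.\<close>

lemma card_part_reps:
  assumes good: "good_partition d P"
  shows "card {y. y < L \<and> cls P y = y \<and> P y = i} \<le> 2 ^ d" (is "card ?A \<le> _")
proof (cases "\<exists>y<L. P y = i \<and> sing P y")
  case True
  then obtain y where "y < L" "P y = i" "sing P y"
    by blast
  then have "?A \<subseteq> {y}"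
    using sing_part by auto
  then have "card ?A \<le> card {y}"
    by (intro card_mono) auto
  also have "\<dots> \<le> 2 ^ d"
    by simp
  finally show ?thesis .
next
  case False
  show ?thesis
  proof (cases "?A = {}")
    case False
    then obtain y0 where y0: "y0 < L" "P y0 = i"
      by blast
    with \<open>\<not> (\<exists>y<L. P y = i \<and> sing P y)\<close> have "\<not> sing P y0"
      by blast
    with good y0 have d: "card {j. cell P i j} \<le> d"
      by (auto simp: good_partition_def)
    let ?h = "\<lambda>y. {j. \<exists>u<L. sing P u \<and> P u = j \<and> adj y u}"
    have "inj_on ?h ?A"
    proof (rule inj_onI)
      fix y z assume yz: "y \<in> ?A" "z \<in> ?A" "?h y = ?h z"
      have "adj y u \<longleftrightarrow> adj z u" if u: "u < L" "sing P u" for u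
      proof -
        have "P u \<in> ?h y \<longleftrightarrow> P u \<in> ?h z"
          using yz(3) by simp
        moreover have "P u \<in> ?h w \<longleftrightarrow> adj w u" for w
          using u sing_part[OF u(2)] by (auto dest: sym)
        ultimately show ?thesis
          by blast
      qed
      then have "eqv P y z"
        using yz by (simp add: eqv_def)
      then show "y = z"
        using yz cls_eqI[of P y z] by simp
    qed
    moreover have "?h ` ?A \<subseteq> Pow {j. cell P i j}"
      by (auto simp: cell_def)
    ultimately have "card ?A \<le> card (Pow {j. cell P i j})"
      by (rule card_inj_on_le) (simp add: finite_cells)
    also have "\<dots> = 2 ^ card {j. cell P i j}"
      by (rule card_Pow[OF finite_cells])
    also have "\<dots> \<le> 2 ^ d"
      using d by simp
    finally show ?thesis .
  next
    case True
    then show ?thesis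
      by (metis card.empty zero_le)
  qed
qed

text \<open>Red neighbours lie in at most \<open>d + 1\<close> parts of \<open>P2\<close>. Each
  label of \<open>P2\<close> comes from at most two labels of \<open>P\<close>, and each part of
  \<open>P\<close> has at most \<open>2 ^ d\<close> classes.\<close>

lemma card_red_nbrs:
  assumes P: "good_partition d P" and P2: "good_partition d P2" and X: "X < L"
    and near: "\<And>y. y < L \<Longrightarrow> P y = P2 y \<or> P y = Suc (P2 y)"
  shows "card (red_nbrs P P2 X) \<le> 2 * (d + 1) * 2 ^ d"
proof -
  \<comment> \<open>The own part is always included, and a one-element part is red to nothing
    else.\<close>
  define N2 where "N2 = insert (P2 X) (if sing P2 X then {} else {j. cell P2 (P2 X) j})"
  have N2: "finite N2" "card N2 \<le> d + 1"
    using P2 X finite_cells by (auto simp: N2_def good_partition_def card_insert_if)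
  let ?N = "N2 \<union> Suc ` N2"
  have fin: "finite ?N"
    using N2 by simp
  have "card ?N \<le> card N2 + card (Suc ` N2)"
    by (rule card_Un_le)
  also have "\<dots> \<le> 2 * (d + 1)"
    using N2(2) by (simp add: card_image)
  finally have cN: "card ?N \<le> 2 * (d + 1)" .
  have "red_nbrs P P2 X \<subseteq> (\<Union>i\<in>?N. {y. y < L \<and> cls P y = y \<and> P y = i})"
  proof
    fix y assume y: "y \<in> red_nbrs P P2 X"
    then have "P2 y \<in> N2"
      by (auto simp: red_nbrs_def N2_def red_def)
    then have "P y \<in> ?N"
      using near[of y] y by (auto simp: red_nbrs_def)
    then show "y \<in> (\<Union>i\<in>?N. {y. y < L \<and> cls P y = y \<and> P y = i})"
      using y by (auto simp: red_nbrs_def)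
  qed
  then have "card (red_nbrs P P2 X) \<le> card (\<Union>i\<in>?N. {y. y < L \<and> cls P y = y \<and> P y = i})"
    by (rule card_mono[rotated]) (use fin in auto)
  also have "\<dots> \<le> (\<Sum>i\<in>?N. card {y. y < L \<and> cls P y = y \<and> P y = i})"
    by (rule card_UN_le[OF fin])
  also have "\<dots> \<le> (\<Sum>i\<in>?N. 2 ^ d)"
    by (rule sum_mono) (rule card_part_reps[OF P])
  also have "\<dots> \<le> 2 * (d + 1) * 2 ^ d"
    using mult_right_mono[OF cN, of "2 ^ d"] by simp
  finally show ?thesis .
qed

lemma merge_near: "good_partition d P \<Longrightarrow> mergeable d P v \<Longrightarrow> y < L \<Longrightarrow>
    P y = merge P v y \<or> P y = Suc (merge P v y)"
  by (auto simp: merge_label)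

text \<open>Any two consecutive parts are together joined to more than \<open>d\<close> parts. In
  the sum over the consecutive pairs each part occurs at most twice and each entry of the quotient
  is seen from both sides, whence a factor \<open>4\<close>. Replacing the number \<open>n\<close>
  of parts by \<open>2 * (n - 1)\<close> makes it \<open>8\<close>.\<close>

theorem stuck_contains_perm:
  assumes good: "good_partition d P" and stuck: "\<And>v. \<not> mergeable d P v" and parts: "0 < P (L - 1)"
    and \<sigma>: "bij_betw \<sigma> {..<r} {..<r}" and r: "r > 0" and d: "8 * mt_const r \<le> d"
  shows "contains_perm r \<sigma> {(x, y). E x y}"
proof (rule ccontr)
  assume not_contains: "\<not> ?thesis"
  define D where "D = {(x, y). E x y \<and> x < L \<and> y < L}"
  define n where "n = Suc (P (L - 1))"
  define S where "S = (\<lambda>(x, y). (P x, P y)) ` D"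
  have L: "0 < L"
  proof (rule ccontr)
    assume "\<not> 0 < L"
    then have "P (L - 1) = P 0"
      by simp
    with parts good show False
      by (simp add: good_partition_def)
  qed
  have lab: "P x < n" if "x < L" for x
  proof -
    have "x \<le> L - 1" "L - 1 < L"
      using that by simp_all
    then show ?thesis
      using part_mono[OF good, of x "L - 1"] by (simp add: n_def)
  qed
  have "\<not> contains_perm r \<sigma> D"
    using not_contains unfolding contains_perm_def D_def by blast
  moreover have "mono_on {..<L} P"
    using part_mono[OF good] by (auto intro: mono_onI)
  moreover have "D \<subseteq> {..<L} \<times> {..<L}"
    by (auto simp: D_def)
  ultimately have "\<not> contains_perm r \<sigma> S"
    using contains_perm_quotient[of r \<sigma> P D "{..<L}"] \<sigma> unfolding S_def by blast
  moreover have Sn: "S \<subseteq> {..<n} \<times> {..<n}"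
    using lab by (auto simp: S_def D_def)
  ultimately have cS: "card S \<le> mt_const r * n"
    using marcus_tardos[OF \<sigma> r] by blast
  define C where "C i = {j. cell P i j}" for i
  have Cn: "C i \<subseteq> {..<n}" for i
    using lab by (auto simp: C_def cell_def)
  have pair: "d < card (C i) + card (C (Suc i))" if i: "Suc i < n" for i
  proof -
    \<comment> \<open>The last line of part \<open>i\<close>. As labels increase by at most one, the
      next line belongs to part \<open>Suc i\<close>.\<close>
    let ?v = "Max {x. x < L \<and> P x \<le> i}"
    have fin: "finite {x. x < L \<and> P x \<le> i}" and ne: "{x. x < L \<and> P x \<le> i} \<noteq> {}"
      using L good by (auto simp: good_partition_def intro!: exI[of _ 0])
    have v: "?v < L" "P ?v \<le> i"
      using Max_in[OF fin ne] by auto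
    have "?v \<noteq> L - 1"
      using v(2) i by (auto simp: n_def)
    with v have v1: "Suc ?v < L"
      by simp
    have "\<not> P (Suc ?v) \<le> i"
    proof
      assume "P (Suc ?v) \<le> i"
      then have "Suc ?v \<in> {x. x < L \<and> P x \<le> i}"
        using v1 by (intro CollectI conjI)
      from Max_ge[OF fin this] show False
        by linarith
    qed
    moreover have "P (Suc ?v) \<le> Suc (P ?v)"
      using good v1 by (simp add: good_partition_def)
    ultimately have P: "P ?v = i" "P (Suc ?v) = Suc i"
      using v by linarith+
    have "j < L" if "cell P a j" for a j
      using that part_le[OF good] unfolding cell_def by (metis le_less_trans)
    then have "{j. j < L \<and> (cell P (P ?v) j \<or> cell P (P (Suc ?v)) j)} = C i \<union> C (Suc i)"
      using P by (auto simp: C_def)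
    moreover have "\<not> card {j. j < L \<and> (cell P (P ?v) j \<or> cell P (P (Suc ?v)) j)} \<le> d"
      using stuck[of ?v] v1 P by (simp add: mergeable_def)
    ultimately have "d < card (C i \<union> C (Suc i))"
      by simp
    also have "\<dots> \<le> card (C i) + card (C (Suc i))"
      by (rule card_Un_le)
    finally show ?thesis .
  qed
  \<comment> \<open>\<open>E\<close> leads from smaller to larger lines only, but
    \<open>cell\<close> is symmetric.\<close>
  have "(SIGMA i:{..<n}. C i) \<subseteq> S \<union> S\<inverse>"
    by (auto simp: C_def cell_def S_def D_def adj_def image_iff)
  moreover have finS: "finite S"
    using Sn finite_subset by blast
  ultimately have "card (SIGMA i:{..<n}. C i) \<le> card (S \<union> S\<inverse>)"
    by (intro card_mono) auto
  also have "\<dots> \<le> card S + card S"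
    using card_Un_le[of S "S\<inverse>"] by (simp add: card_inverse)
  finally have sum: "(\<Sum>i<n. card (C i)) \<le> 2 * card S"
    by (subst (asm) card_SigmaI) (auto intro: finite_subset[OF Cn])
  have n: "n = Suc (P (L - 1))"
    by (simp add: n_def)
  have "(\<Sum>i<P (L - 1). d + 1) \<le> (\<Sum>i<P (L - 1). card (C i) + card (C (Suc i)))"
    by (rule sum_mono) (use pair n in force)
  also have "\<dots> = (\<Sum>i<P (L - 1). card (C i)) + (\<Sum>i<P (L - 1). card (C (Suc i)))"
    by (rule sum.distrib)
  also have "\<dots> \<le> (\<Sum>i<n. card (C i)) + (\<Sum>i<n. card (C i))"
    unfolding n using sum.lessThan_Suc_shift[of "\<lambda>i. card (C i)" "P (L - 1)"]
      sum.lessThan_Suc[of "\<lambda>i. card (C i)" "P (L - 1)"] by linarith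
  finally have "P (L - 1) * (d + 1) \<le> 4 * card S"
    using sum by simp
  also have "\<dots> \<le> 4 * (mt_const r * n)"
    using cS by simp
  also have "\<dots> \<le> 4 * (mt_const r * (2 * P (L - 1)))"
    using parts by (simp add: n_def)
  also have "\<dots> = P (L - 1) * (8 * mt_const r)"
    by simp
  finally have "P (L - 1) * (d + 1) \<le> P (L - 1) * (8 * mt_const r)" .
  then have "d + 1 \<le> 8 * mt_const r"
    using parts unfolding mult_le_cancel1 by blast
  with d show False
    by simp
qed

end

section \<open>A language with bounded sums and loops\<close>

text \<open>The variables of an expression or command are the cells \<open>0\<close> of banks. The bound of a sum or
  of a loop is a variable that is read once, on entry. The constant \<open>40\<close> below is a generous bound
  for the overhead of the compiled code at one node.\<close>

datatype aexp =
    N nat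
  | Rd nat aexp
  | Plus aexp aexp
  | Minus aexp aexp
  | Ite aexp aexp aexp
  | Sum nat nat aexp

abbreviation V :: "nat \<Rightarrow> aexp" where
  "V b \<equiv> Rd b (N 0)"

definition put :: "nat \<Rightarrow> nat \<Rightarrow> store \<Rightarrow> store" where
  "put x i s = s(x := (s x)(0 := i))"

lemma put_apply: "put x i s b = (if b = x then (s x)(0 := i) else s b)"
  by (simp add: put_def)

primrec aval :: "aexp \<Rightarrow> store \<Rightarrow> nat" where
  "aval (N n) s = n"
| "aval (Rd b e) s = s b (aval e s)"
| "aval (Plus e f) s = aval e s + aval f s"
| "aval (Minus e f) s = aval e s - aval f s"
| "aval (Ite c e f) s = (if aval c s \<noteq> 0 then aval e s else aval f s)"
| "aval (Sum x b e) s = (\<Sum>i<s b 0. aval e (put x i s))"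

datatype cmd =
    Nop
  | Asg nat aexp aexp
  | Sq cmd cmd
  | If aexp cmd cmd
  | For nat nat cmd

primrec exec :: "cmd \<Rightarrow> store \<Rightarrow> store" where
  "exec Nop s = s"
| "exec (Asg b i e) s = s(b := (s b)(aval i s := aval e s))"
| "exec (Sq c d) s = exec d (exec c s)"
| "exec (If e c d) s = (if aval e s \<noteq> 0 then exec c s else exec d s)"
| "exec (For x b c) s = fold (\<lambda>i s. exec c (put x i s)) [0..<s b 0] s"

text \<open>Banks from \<open>r\<close> on do not occur, so that compiled code may use them for
  temporaries.\<close>

primrec a_below :: "nat \<Rightarrow> aexp \<Rightarrow> bool" where
  "a_below r (N n) = True"
| "a_below r (Rd b e) = (b < r \<and> a_below r e)"
| "a_below r (Plus e f) = (a_below r e \<and> a_below r f)"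
| "a_below r (Minus e f) = (a_below r e \<and> a_below r f)"
| "a_below r (Ite c e f) = (a_below r c \<and> a_below r e \<and> a_below r f)"
| "a_below r (Sum x b e) = (x < r \<and> b < r \<and> a_below r e)"

primrec c_below :: "nat \<Rightarrow> cmd \<Rightarrow> bool" where
  "c_below r Nop = True"
| "c_below r (Asg b i e) = (b < r \<and> a_below r i \<and> a_below r e)"
| "c_below r (Sq c d) = (c_below r c \<and> c_below r d)"
| "c_below r (If e c d) = (a_below r e \<and> c_below r c \<and> c_below r d)"
| "c_below r (For x b c) = (x < r \<and> b < r \<and> c_below r c)"

lemma a_below_mono: "a_below r e \<Longrightarrow> r \<le> r' \<Longrightarrow> a_below r' e"
  by (induction e) auto

lemma c_below_mono: "c_below r c \<Longrightarrow> r \<le> r' \<Longrightarrow> c_below r' c"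
  by (induction c) (auto intro: a_below_mono)

text \<open>\<open>a_bounded U\<close> and \<open>c_bounded U\<close>: no loop bound that is met during evaluation exceeds \<open>U\<close>.\<close>

primrec a_bounded :: "nat \<Rightarrow> aexp \<Rightarrow> store \<Rightarrow> bool" where
  "a_bounded U (N n) s = True"
| "a_bounded U (Rd b e) s = a_bounded U e s"
| "a_bounded U (Plus e f) s = (a_bounded U e s \<and> a_bounded U f s)"
| "a_bounded U (Minus e f) s = (a_bounded U e s \<and> a_bounded U f s)"
| "a_bounded U (Ite c e f) s = (a_bounded U c s \<and> a_bounded U e s \<and> a_bounded U f s)"
| "a_bounded U (Sum x b e) s = (s b 0 \<le> U \<and> (\<forall>i<s b 0. a_bounded U e (put x i s)))"

primrec c_bounded :: "nat \<Rightarrow> cmd \<Rightarrow> store \<Rightarrow> bool" where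
  "c_bounded U Nop s = True"
| "c_bounded U (Asg b i e) s = (a_bounded U i s \<and> a_bounded U e s)"
| "c_bounded U (Sq c d) s = (c_bounded U c s \<and> c_bounded U d (exec c s))"
| "c_bounded U (If e c d) s = (a_bounded U e s \<and> (if aval e s \<noteq> 0 then c_bounded U c s else c_bounded U d s))"
| "c_bounded U (For x b c) s = (s b 0 \<le> U \<and>
     (\<forall>i<s b 0. c_bounded U c (put x i (fold (\<lambda>i s. exec c (put x i s)) [0..<i] s))))"

primrec a_time :: "nat \<Rightarrow> aexp \<Rightarrow> nat" where
  "a_time U (N n) = 40"
| "a_time U (Rd b e) = 40 + a_time U e"
| "a_time U (Plus e f) = 40 + a_time U e + a_time U f"
| "a_time U (Minus e f) = 40 + a_time U e + a_time U f"
| "a_time U (Ite c e f) = 40 + a_time U c + a_time U e + a_time U f"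
| "a_time U (Sum x b e) = 40 + U * (40 + a_time U e)"

primrec c_time :: "nat \<Rightarrow> cmd \<Rightarrow> nat" where
  "c_time U Nop = 40"
| "c_time U (Asg b i e) = 40 + a_time U i + a_time U e"
| "c_time U (Sq c d) = 40 + c_time U c + c_time U d"
| "c_time U (If e c d) = 40 + a_time U e + c_time U c + c_time U d"
| "c_time U (For x b c) = 40 + U * (40 + c_time U c)"

section \<open>Compilation to the machine\<close>

abbreviation reg :: "nat \<Rightarrow> expr" where
  "reg b \<equiv> Get b (Lit 0)"

text \<open>The value is left in cell \<open>0\<close> of bank \<open>r\<close>. In a
  \<open>Sum\<close> the bound variable itself counts the rounds, as the summand cannot change it;
  its former value is kept in bank \<open>r\<close> and restored, because expressions have no side
  effects.\<close>

primrec a_comp :: "aexp \<Rightarrow> nat \<Rightarrow> prog" where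
  "a_comp (N n) r = Put r (Lit 0) (Lit n)"
| "a_comp (Rd b e) r = Seq (a_comp e r) (Put r (Lit 0) (Get b (reg r)))"
| "a_comp (Plus e f) r = Seq (a_comp e r) (Seq (a_comp f (r + 1)) (Put r (Lit 0) (Add (reg r) (reg (r + 1)))))"
| "a_comp (Minus e f) r = Seq (a_comp e r) (Seq (a_comp f (r + 1)) (Put r (Lit 0) (Sub (reg r) (reg (r + 1)))))"
| "a_comp (Ite c e f) r = Seq (a_comp c r) (Cond (reg r) (a_comp e r) (a_comp f r))"
| "a_comp (Sum x b e) r = Seq (Put r (Lit 0) (reg x)) (Seq (Put (r + 1) (Lit 0) (reg b))
     (Seq (Put (r + 2) (Lit 0) (Lit 0)) (Seq (Put x (Lit 0) (Lit 0))
     (Seq (While (Sub (reg (r + 1)) (reg x)) (Seq (a_comp e (r + 3))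
        (Seq (Put (r + 2) (Lit 0) (Add (reg (r + 2)) (reg (r + 3)))) (Put x (Lit 0) (Add (reg x) (Lit 1))))))
     (Seq (Put x (Lit 0) (reg r)) (Put r (Lit 0) (reg (r + 2))))))))"

text \<open>A loop body may overwrite the loop variable and the bound. So the rounds are counted in
  bank \<open>r\<close>, the bound is copied to bank \<open>r + 1\<close>, and the variable is set
  anew in every round.\<close>

primrec c_comp :: "cmd \<Rightarrow> nat \<Rightarrow> prog" where
  "c_comp Nop r = Skip"
| "c_comp (Asg b i e) r = Seq (a_comp i r) (Seq (a_comp e (r + 1)) (Put b (reg r) (reg (r + 1))))"
| "c_comp (Sq c d) r = Seq (c_comp c r) (c_comp d r)"
| "c_comp (If e c d) r = Seq (a_comp e r) (Cond (reg r) (c_comp c r) (c_comp d r))"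
| "c_comp (For x b c) r = Seq (Put r (Lit 0) (Lit 0)) (Seq (Put (r + 1) (Lit 0) (reg b))
     (While (Sub (reg (r + 1)) (reg r)) (Seq (Put x (Lit 0) (reg r))
        (Seq (c_comp c (r + 2)) (Put r (Lit 0) (Add (reg r) (Lit 1)))))))"

section \<open>Runs within a time bound\<close>

definition runs :: "prog \<Rightarrow> store \<Rightarrow> nat \<Rightarrow> store \<Rightarrow> bool" where
  "runs p s T s' \<longleftrightarrow> (\<exists>n\<le>T. run p s n s')"

lemma runs_mono: "runs p s T s' \<Longrightarrow> T \<le> T' \<Longrightarrow> runs p s T' s'"
  unfolding runs_def using le_trans by blast

lemma runs_Skip: "runs Skip s 1 s"
  unfolding runs_def using run_Skip by blast

lemma runs_Put: "runs (Put b e f) s (1 + expr_cost e + expr_cost f)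
    (s(b := (s b)(expr_val e s := expr_val f s)))"
  unfolding runs_def using run_Put by blast

lemma runs_Put_reg: "runs (Put b (Lit 0) f) s (2 + expr_cost f) (put b (expr_val f s) s)"
  using runs_Put[of b "Lit 0" f s] by (simp add: put_def)

lemma runs_Seq:
  assumes "runs p s m s'" and "runs q s' n s''"
  shows "runs (Seq p q) s (1 + m + n) s''"
proof -
  from assms obtain m' n' where "m' \<le> m" "n' \<le> n" "run p s m' s'" "run q s' n' s''"
    unfolding runs_def by blast
  then show ?thesis
    unfolding runs_def using run_Seq[of p s m' s' q n' s''] by (intro exI[of _ "1 + m' + n'"]) simp
qed

lemma runs_Cond:
  assumes "if expr_val e s \<noteq> 0 then runs p s n s' else runs q s n s'"
  shows "runs (Cond e p q) s (1 + expr_cost e + n) s'"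
proof -
  from assms obtain n' where n': "n' \<le> n" "if expr_val e s \<noteq> 0 then run p s n' s' else run q s n' s'"
    unfolding runs_def by (auto split: if_splits)
  then have "run (Cond e p q) s (1 + expr_cost e + n') s'"
    using run_Cond_true[of e s p n' s' q] run_Cond_false[of e s q n' s' p]
    by (cases "expr_val e s = 0") simp_all
  with n'(1) show ?thesis
    unfolding runs_def by (intro exI[of _ "1 + expr_cost e + n'"]) simp
qed

text \<open>The number of rounds is known beforehand: the invariant carries the number of the
  round.\<close>

lemma runs_While:
  assumes "Inv j s"
    and "\<And>i s. i < n \<Longrightarrow> Inv i s \<Longrightarrow> expr_val e s \<noteq> 0 \<and> (\<exists>s'. runs p s T s' \<and> Inv (Suc i) s')"
    and "\<And>s. Inv n s \<Longrightarrow> expr_val e s = 0" and "j \<le> n"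
  shows "\<exists>s'. runs (While e p) s ((n - j) * (1 + expr_cost e + T) + 1 + expr_cost e) s' \<and> Inv n s'"
  using assms(1,4)
proof (induction "n - j" arbitrary: j s)
  case 0
  then have "j = n"
    by simp
  with 0 assms(3) have "expr_val e s = 0" "Inv n s"
    by blast+
  then show ?case
    unfolding runs_def using run_While_false[of e s p] \<open>j = n\<close> by auto
next
  case (Suc m)
  then have j: "j < n"
    by simp
  from assms(2)[OF j Suc.prems(1)] obtain s' where s': "expr_val e s \<noteq> 0" "runs p s T s'" "Inv (Suc j) s'"
    by blast
  have "m = n - Suc j"
    using Suc.hyps(2) by simp
  from Suc.hyps(1)[OF this s'(3)] j obtain s'' where
    "runs (While e p) s' ((n - Suc j) * (1 + expr_cost e + T) + 1 + expr_cost e) s''" "Inv n s''"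
    using Suc_leI by blast
  note w = this
  obtain a b where ab: "a \<le> T" "run p s a s'"
    "b \<le> (n - Suc j) * (1 + expr_cost e + T) + 1 + expr_cost e" "run (While e p) s' b s''"
    using s'(2) w(1) unfolding runs_def by blast
  have "1 + expr_cost e + a + b \<le> (n - j) * (1 + expr_cost e + T) + 1 + expr_cost e"
  proof -
    have "n - j = Suc (n - Suc j)"
      using j by simp
    then show ?thesis
      using ab(1,3) by simp
  qed
  then show ?case
    unfolding runs_def using run_While_true[OF s'(1) ab(2,4)] w(2) by blast
qed

text \<open>Compiled code leaves garbage in its temporaries; this congruence and the next ones show
  that the banks below \<open>r\<close> determine everything.\<close>

lemma aval_cong:
  "a_below r e \<Longrightarrow> (\<And>b. b < r \<Longrightarrow> s b = t b) \<Longrightarrow> aval e s = aval e t"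
proof (induction e arbitrary: s t)
  case (N n)
  show ?case by simp
next
  case (Rd b e)
  have "aval e s = aval e t"
    using Rd.prems by (intro Rd.IH) auto
  moreover have "s b = t b"
    using Rd.prems by simp
  ultimately show ?case by simp
next
  case (Plus e f)
  have "aval e s = aval e t" "aval f s = aval f t"
    using Plus.prems by (intro Plus.IH; simp)+
  then show ?case by simp
next
  case (Minus e f)
  have "aval e s = aval e t" "aval f s = aval f t"
    using Minus.prems by (intro Minus.IH; simp)+
  then show ?case by simp
next
  case (Ite c e f)
  have "aval c s = aval c t" "aval e s = aval e t" "aval f s = aval f t"
    using Ite.prems by (intro Ite.IH; simp)+
  then show ?case by simp
next
  case (Sum x b e)
  have "aval e (put x i s) = aval e (put x i t)" for i
    using Sum.prems by (intro Sum.IH) (auto simp: put_apply)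
  moreover have "s b = t b"
    using Sum.prems by simp
  ultimately show ?case by simp
qed

lemma a_bounded_cong:
  "a_below r e \<Longrightarrow> (\<And>b. b < r \<Longrightarrow> s b = t b) \<Longrightarrow> a_bounded U e s = a_bounded U e t"
proof (induction e arbitrary: s t)
  case (N n)
  show ?case by simp
next
  case (Rd b e)
  have "a_bounded U e s = a_bounded U e t"
    using Rd.prems by (intro Rd.IH) auto
  moreover have "s b = t b"
    using Rd.prems by simp
  ultimately show ?case by simp
next
  case (Plus e f)
  have "a_bounded U e s = a_bounded U e t" "a_bounded U f s = a_bounded U f t"
    using Plus.prems by (intro Plus.IH; simp)+
  then show ?case by simp
next
  case (Minus e f)
  have "a_bounded U e s = a_bounded U e t" "a_bounded U f s = a_bounded U f t"
    using Minus.prems by (intro Minus.IH; simp)+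
  then show ?case by simp
next
  case (Ite c e f)
  have "a_bounded U c s = a_bounded U c t" "a_bounded U e s = a_bounded U e t" "a_bounded U f s = a_bounded U f t"
    using Ite.prems by (intro Ite.IH; simp)+
  then show ?case by simp
next
  case (Sum x b e)
  have "a_bounded U e (put x i s) = a_bounded U e (put x i t)" for i
    using Sum.prems by (intro Sum.IH) (auto simp: put_apply)
  moreover have "s b = t b"
    using Sum.prems by simp
  ultimately show ?case by simp
qed

lemma exec_frame: "c_below r c \<Longrightarrow> r \<le> b \<Longrightarrow> exec c s b = s b"
proof (induction c arbitrary: s)
  case (For x y c)
  have "fold (\<lambda>i s. exec c (put x i s)) is s b = s b" for "is"
  proof (induction "is" arbitrary: s)
    case (Cons i "is")
    then show ?case
      using For.IH[of "put x i s"] For.prems by (simp add: put_apply)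
  qed simp
  then show ?case
    by simp
qed auto

lemma exec_cong:
  "c_below r c \<Longrightarrow> (\<And>b. b < r \<Longrightarrow> s b = t b) \<Longrightarrow> b < r \<Longrightarrow> exec c s b = exec c t b"
proof (induction c arbitrary: s t b)
  case (Asg x i e)
  then have "aval i s = aval i t" "aval e s = aval e t" "s x = t x" "s b = t b"
    by (auto intro: aval_cong)
  then show ?case
    by (cases "b = x") simp_all
next
  case (If e c d)
  have "aval e s = aval e t"
    using If.prems by (intro aval_cong[of r]) auto
  moreover have "exec c s b = exec c t b" "exec d s b = exec d t b"
    using If.prems by (intro If.IH; simp)+
  ultimately show ?case
    by simp
next
  case (For x y c)
  have fold_eq: "b < r \<Longrightarrow> fold (\<lambda>i s. exec c (put x i s)) is s b = fold (\<lambda>i s. exec c (put x i s)) is t b"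
    if "\<And>b. b < r \<Longrightarrow> s b = t b" for "is" s t b
    using that
  proof (induction "is" arbitrary: s t b)
    case (Cons i "is")
    have *: "exec c (put x i s) b = exec c (put x i t) b" if "b < r" for b
      using For.prems(1) Cons.prems that by (intro For.IH) (auto simp: put_apply)
    have "fold (\<lambda>i s. exec c (put x i s)) is (exec c (put x i s)) b =
        fold (\<lambda>i s. exec c (put x i s)) is (exec c (put x i t)) b"
      by (rule Cons.IH) (use * Cons.prems in auto)
    then show ?case
      by simp
  qed simp
  have "s y = t y"
    using For.prems by simp
  then show ?case
    using fold_eq[OF For.prems(2,3)] by simp
next
  case (Sq c d)
  show ?case
    unfolding exec.simps
  proof (rule Sq.IH(2))
    show "exec c s b = exec c t b" if "b < r" for b
      using Sq.prems that by (intro Sq.IH(1)) auto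
  qed (use Sq.prems in auto)
qed simp

lemma fold_exec_cong:
  assumes "c_below r c" and "\<And>b. b < r \<Longrightarrow> s b = t b" and "b < r"
  shows "fold (\<lambda>i s. exec c (put x i s)) is s b = fold (\<lambda>i s. exec c (put x i s)) is t b"
  using assms(2,3)
proof (induction "is" arbitrary: s t b)
  case (Cons i "is")
  have *: "exec c (put x i s) b = exec c (put x i t) b" if "b < r" for b
    using assms(1) Cons.prems that by (intro exec_cong[of r]) (auto simp: put_apply)
  have "fold (\<lambda>i s. exec c (put x i s)) is (exec c (put x i s)) b =
      fold (\<lambda>i s. exec c (put x i s)) is (exec c (put x i t)) b"
    by (rule Cons.IH) (use * Cons.prems in auto)
  then show ?case
    by simp
qed simp

lemma c_bounded_cong:
  "c_below r c \<Longrightarrow> (\<And>b. b < r \<Longrightarrow> s b = t b) \<Longrightarrow> c_bounded U c s = c_bounded U c t"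
proof (induction c arbitrary: s t)
  case (Asg x i e)
  then show ?case
    using a_bounded_cong[of r i s t] a_bounded_cong[of r e s t] by simp
next
  case (Sq c d)
  have "c_bounded U d (exec c s) = c_bounded U d (exec c t)"
    using Sq.prems exec_cong[of r c s t] by (intro Sq.IH(2)) auto
  moreover have "c_bounded U c s = c_bounded U c t"
    using Sq.prems by (intro Sq.IH(1)) auto
  ultimately show ?case
    by simp
next
  case (If e c d)
  have "c_bounded U c s = c_bounded U c t" "c_bounded U d s = c_bounded U d t"
    using If.prems by (intro If.IH; simp)+
  moreover have "a_bounded U e s = a_bounded U e t" "aval e s = aval e t"
    using If.prems a_bounded_cong[of r e s t] aval_cong[of r e s t] by auto
  ultimately show ?case
    by simp
next
  case (For x y c)
  have "c_bounded U c (put x i (fold (\<lambda>i s. exec c (put x i s)) [0..<i] s)) =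
    c_bounded U c (put x i (fold (\<lambda>i s. exec c (put x i s)) [0..<i] t))" for i
    using For.prems fold_exec_cong[of r c s t _ x "[0..<i]"]
    by (intro For.IH) (auto simp: put_apply)
  moreover have "s y = t y"
    using For.prems by simp
  ultimately show ?case
    by simp
qed simp

text \<open>The induction varies \<open>r\<close>, since later subexpressions are compiled above the
  values already held. As the banks below \<open>r\<close> are unchanged, these subexpressions have
  the same values as in the original store.\<close>

lemma a_comp_correct:
  "a_below r e \<Longrightarrow> a_bounded U e s \<Longrightarrow>
    \<exists>s'. runs (a_comp e r) s (a_time U e) s' \<and> s' r 0 = aval e s \<and> (\<forall>b<r. s' b = s b)"
proof (induction e arbitrary: r s)
  case (N n)
  have "runs (a_comp (N n) r) s (a_time U (N n)) (put r n s)"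
    using runs_Put_reg[of r "Lit n" s] by (simp add: runs_mono)
  moreover have "put r n s r 0 = aval (N n) s" "\<forall>b<r. put r n s b = s b"
    by (simp_all add: put_apply)
  ultimately show ?case
    by blast
next
  case (Rd b e)
  then obtain s' where s': "runs (a_comp e r) s (a_time U e) s'" "s' r 0 = aval e s" "\<forall>b<r. s' b = s b"
    by fastforce
  let ?s = "put r (s' b (s' r 0)) s'"
  have "runs (a_comp (Rd b e) r) s (a_time U (Rd b e)) ?s"
    using runs_Seq[OF s'(1) runs_Put_reg[of r "Get b (reg r)"]] by (simp add: runs_mono)
  moreover have "?s r 0 = aval (Rd b e) s" "\<forall>b<r. ?s b = s b"
    using s' Rd.prems by (simp_all add: put_apply)
  ultimately show ?case
    by blast
next
  case (Plus e f)
  then obtain s' where s': "runs (a_comp e r) s (a_time U e) s'" "s' r 0 = aval e s" "\<forall>b<r. s' b = s b"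
    by fastforce
  have f: "a_below (r + 1) f" "a_bounded U f s'" "aval f s' = aval f s"
    using Plus.prems s'(3) a_bounded_cong[of r f s' s] aval_cong[of r f s' s] a_below_mono[of r f "r + 1"]
    by auto
  from Plus.IH(2)[OF f(1,2)] obtain s'' where s'': "runs (a_comp f (r + 1)) s' (a_time U f) s''"
    "s'' (r + 1) 0 = aval f s'" "\<forall>b<r + 1. s'' b = s' b"
    by blast
  let ?s = "put r (s'' r 0 + s'' (r + 1) 0) s''"
  have "runs (a_comp (Plus e f) r) s (a_time U (Plus e f)) ?s"
    using runs_Seq[OF s'(1) runs_Seq[OF s''(1) runs_Put_reg[of r "Add (reg r) (reg (r + 1))"]]]
    by (simp add: runs_mono)
  moreover have "?s r 0 = aval (Plus e f) s" "\<forall>b<r. ?s b = s b"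
    using s' s'' f by (simp_all add: put_apply)
  ultimately show ?case
    by blast
next
  case (Minus e f)
  then obtain s' where s': "runs (a_comp e r) s (a_time U e) s'" "s' r 0 = aval e s" "\<forall>b<r. s' b = s b"
    by fastforce
  have f: "a_below (r + 1) f" "a_bounded U f s'" "aval f s' = aval f s"
    using Minus.prems s'(3) a_bounded_cong[of r f s' s] aval_cong[of r f s' s] a_below_mono[of r f "r + 1"]
    by auto
  from Minus.IH(2)[OF f(1,2)] obtain s'' where s'': "runs (a_comp f (r + 1)) s' (a_time U f) s''"
    "s'' (r + 1) 0 = aval f s'" "\<forall>b<r + 1. s'' b = s' b"
    by blast
  let ?s = "put r (s'' r 0 - s'' (r + 1) 0) s''"
  have "runs (a_comp (Minus e f) r) s (a_time U (Minus e f)) ?s"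
    using runs_Seq[OF s'(1) runs_Seq[OF s''(1) runs_Put_reg[of r "Sub (reg r) (reg (r + 1))"]]]
    by (simp add: runs_mono)
  moreover have "?s r 0 = aval (Minus e f) s" "\<forall>b<r. ?s b = s b"
    using s' s'' f by (simp_all add: put_apply)
  ultimately show ?case
    by blast
next
  case (Ite c e f)
  have "\<exists>s'. runs (a_comp c r) s (a_time U c) s' \<and> s' r 0 = aval c s \<and> (\<forall>b<r. s' b = s b)"
    using Ite.prems by (intro Ite.IH(1)) simp_all
  then obtain s' where s': "runs (a_comp c r) s (a_time U c) s'" "s' r 0 = aval c s" "\<forall>b<r. s' b = s b"
    by blast
  define g where "g = (if aval c s \<noteq> 0 then e else f)"
  have g: "a_below r g" "a_bounded U g s" "aval g s = aval (Ite c e f) s" "a_time U g \<le> a_time U e + a_time U f"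
    using Ite.prems by (simp_all add: g_def)
  then have g': "a_bounded U g s'" "aval g s' = aval g s"
    using s'(3) a_bounded_cong[of r g s' s] aval_cong[of r g s' s] by blast+
  have "\<exists>s''. runs (a_comp g r) s' (a_time U g) s'' \<and> s'' r 0 = aval g s' \<and> (\<forall>b<r. s'' b = s' b)"
  proof (cases "aval c s = 0")
    case True
    then have "g = f"
      by (simp add: g_def)
    then show ?thesis
      using Ite.IH(3) g(1) g'(1) by blast
  next
    case False
    then have "g = e"
      by (simp add: g_def)
    then show ?thesis
      using Ite.IH(2) g(1) g'(1) by blast
  qed
  then obtain s'' where s'': "runs (a_comp g r) s' (a_time U g) s''" "s'' r 0 = aval g s'" "\<forall>b<r. s'' b = s' b"
    by blast
  have "runs (Cond (reg r) (a_comp e r) (a_comp f r)) s' (1 + expr_cost (reg r) + a_time U g) s''"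
    using s''(1) s'(2) by (intro runs_Cond) (simp add: g_def split: if_splits)
  from runs_Seq[OF s'(1) this] have "runs (a_comp (Ite c e f) r) s (a_time U (Ite c e f)) s''"
    unfolding a_comp.simps by (rule runs_mono) (use g(4) in simp)
  moreover have "s'' r 0 = aval (Ite c e f) s" "\<forall>b<r. s'' b = s b"
    using s' s'' g g' by simp_all
  ultimately show ?case
    by blast
next
  case (Sum x b e)
  let ?n = "s b 0"
  \<comment> \<open>Below \<open>r\<close>, only cell \<open>0\<close> of bank \<open>x\<close>
    differs from the original store, and bank \<open>r\<close> remembers its content.\<close>
  define Inv where "Inv i s' \<longleftrightarrow> s' x 0 = i \<and> (\<forall>c<r. c \<noteq> x \<longrightarrow> s' c = s c) \<and> (\<forall>j. j \<noteq> 0 \<longrightarrow> s' x j = s x j) \<and>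
    s' r 0 = s x 0 \<and> s' (r + 1) 0 = ?n \<and> s' (r + 2) 0 = (\<Sum>i<i. aval e (put x i s))" for i s'
  from Sum.prems have below: "x < r" "b < r" "a_below r e" "?n \<le> U" "\<And>i. i < ?n \<Longrightarrow> a_bounded U e (put x i s)"
    by auto
  let ?body = "Seq (a_comp e (r + 3))
        (Seq (Put (r + 2) (Lit 0) (Add (reg (r + 2)) (reg (r + 3)))) (Put x (Lit 0) (Add (reg x) (Lit 1))))"
  define s1 where "s1 = put x 0 (put (r + 2) 0 (put (r + 1) ?n (put r (s x 0) s)))"
  have step: "expr_val (Sub (reg (r + 1)) (reg x)) s' \<noteq> 0 \<and>
      (\<exists>s''. runs ?body s' (a_time U e + 20) s'' \<and> Inv (Suc i) s'')" if i: "i < ?n" and s': "Inv i s'" for i s'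
  proof -
    have agree: "s' c = put x i s c" if "c < r" for c
      using s' that by (auto simp: Inv_def put_apply)
    have e: "a_below (r + 3) e" "a_bounded U e s'" "aval e s' = aval e (put x i s)"
      using below i agree a_bounded_cong[of r e s' "put x i s"] aval_cong[of r e s' "put x i s"] a_below_mono[of r e "r + 3"]
      by auto
    from Sum.IH[OF e(1,2)] obtain s2 where s2: "runs (a_comp e (r + 3)) s' (a_time U e) s2"
      "s2 (r + 3) 0 = aval e s'" "\<forall>b<r + 3. s2 b = s' b"
      by blast
    let ?s3 = "put (r + 2) (s2 (r + 2) 0 + s2 (r + 3) 0) s2"
    let ?s4 = "put x (?s3 x 0 + 1) ?s3"
    have "runs ?body s' (a_time U e + 20) ?s4"
      using runs_Seq[OF s2(1) runs_Seq[OF runs_Put_reg[of "r + 2" "Add (reg (r + 2)) (reg (r + 3))"]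
          runs_Put_reg[of x "Add (reg x) (Lit 1)"]]]
      by (simp add: runs_mono)
    moreover have "Inv (Suc i) ?s4"
      using s' s2 e(3) below unfolding Inv_def by (simp add: put_apply)
    moreover have "expr_val (Sub (reg (r + 1)) (reg x)) s' \<noteq> 0"
      using s' i by (simp add: Inv_def)
    ultimately show ?thesis
      by blast
  qed
  have init: "Inv 0 s1"
    using below by (simp add: Inv_def s1_def put_apply)
  have final: "expr_val (Sub (reg (r + 1)) (reg x)) s' = 0" if "Inv ?n s'" for s'
    using that by (simp add: Inv_def)
  note runs_While[of Inv 0 s1 ?n "Sub (reg (r + 1)) (reg x)" ?body "a_time U e + 20", OF init step final le0]
  then obtain s2 where s2: "runs (While (Sub (reg (r + 1)) (reg x)) ?body) s1
      ((?n - 0) * (1 + expr_cost (Sub (reg (r + 1)) (reg x)) + (a_time U e + 20)) + 1 + expr_cost (Sub (reg (r + 1)) (reg x))) s2"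
      "Inv ?n s2"
    by blast
  let ?s3 = "put x (s2 r 0) s2"
  let ?s4 = "put r (?s3 (r + 2) 0) ?s3"
  \<comment> \<open>A round costs \<open>20\<close> besides the summand and \<open>6\<close> for the
    test.\<close>
  have "?n * (26 + a_time U e) \<le> U * (40 + a_time U e)"
    using below(4) by (intro mult_le_mono) simp_all
  moreover have "runs (a_comp (Sum x b e) r) s (?n * (26 + a_time U e) + 40) ?s4"
  proof -
    have "put r (s x 0) s b 0 = ?n"
      using below by (simp add: put_apply)
    then have s1: "runs (Put x (Lit 0) (Lit 0)) (put (r + 2) 0 (put (r + 1) ?n (put r (s x 0) s))) 3 s1"
      "runs (Put (r + 2) (Lit 0) (Lit 0)) (put (r + 1) ?n (put r (s x 0) s)) 3 (put (r + 2) 0 (put (r + 1) ?n (put r (s x 0) s)))"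
      "runs (Put (r + 1) (Lit 0) (reg b)) (put r (s x 0) s) 4 (put (r + 1) ?n (put r (s x 0) s))"
      "runs (Put r (Lit 0) (reg x)) s 4 (put r (s x 0) s)"
      using runs_Put_reg[of x "Lit 0" "put (r + 2) 0 (put (r + 1) ?n (put r (s x 0) s))"]
        runs_Put_reg[of "r + 2" "Lit 0" "put (r + 1) ?n (put r (s x 0) s)"]
        runs_Put_reg[of "r + 1" "reg b" "put r (s x 0) s"] runs_Put_reg[of r "reg x" s]
      by (simp_all add: s1_def)
    have s3: "runs (Put x (Lit 0) (reg r)) s2 4 ?s3" "runs (Put r (Lit 0) (reg (r + 2))) ?s3 4 ?s4"
      using runs_Put_reg[of x "reg r" s2] runs_Put_reg[of r "reg (r + 2)" ?s3] by simp_all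
    from runs_Seq[OF s1(4) runs_Seq[OF s1(3) runs_Seq[OF s1(2) runs_Seq[OF s1(1) runs_Seq[OF s2(1) runs_Seq[OF s3]]]]]]
    show ?thesis
      unfolding a_comp.simps by (rule runs_mono) simp
  qed
  ultimately have "runs (a_comp (Sum x b e) r) s (a_time U (Sum x b e)) ?s4"
    by (auto elim!: runs_mono)
  moreover have "?s4 c = s c" if "c < r" for c
    using s2(2) that below by (auto simp: Inv_def put_apply fun_eq_iff)
  moreover have "?s4 r 0 = aval (Sum x b e) s"
    using s2(2) below by (simp add: Inv_def put_apply)
  ultimately show ?case
    by blast
qed

text \<open>Stores are compared below \<open>r\<close> only, which is enough for the command that
  follows. A loop counter in bank \<open>r\<close> survives, as the body is compiled for
  \<open>r + 2\<close> and does not mention bank \<open>r\<close>.\<close>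

lemma c_comp_correct:
  "c_below r c \<Longrightarrow> c_bounded U c s \<Longrightarrow>
    \<exists>s'. runs (c_comp c r) s (c_time U c) s' \<and> (\<forall>b<r. s' b = exec c s b)"
proof (induction c arbitrary: r s)
  case Nop
  have "runs (c_comp Nop r) s (c_time U Nop) s"
    using runs_Skip[of s] by (simp add: runs_mono)
  then show ?case
    by auto
next
  case (Asg b i e)
  then have below: "b < r" "a_below r i" "a_below r e" "a_bounded U i s" "a_bounded U e s"
    by auto
  from a_comp_correct[OF below(2,4)] obtain s' where
    s': "runs (a_comp i r) s (a_time U i) s'" "s' r 0 = aval i s" "\<forall>b<r. s' b = s b"
    by blast
  have e: "a_below (r + 1) e" "a_bounded U e s'" "aval e s' = aval e s"
    using below s'(3) a_bounded_cong[of r e s' s] aval_cong[of r e s' s] a_below_mono[of r e "r + 1"] by auto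
  from a_comp_correct[OF e(1,2)] obtain s'' where s'': "runs (a_comp e (r + 1)) s' (a_time U e) s''"
    "s'' (r + 1) 0 = aval e s'" "\<forall>b<r + 1. s'' b = s' b"
    by blast
  let ?s = "s''(b := (s'' b)(s'' r 0 := s'' (r + 1) 0))"
  have "runs (c_comp (Asg b i e) r) s (c_time U (Asg b i e)) ?s"
    using runs_Seq[OF s'(1) runs_Seq[OF s''(1) runs_Put[of b "reg r" "reg (r + 1)"]]]
    by (simp add: runs_mono)
  moreover have "\<forall>b'<r. ?s b' = exec (Asg b i e) s b'"
    using s' s'' e below by simp
  ultimately show ?case
    by blast
next
  case (Sq c d)
  then obtain s' where s': "runs (c_comp c r) s (c_time U c) s'" "\<forall>b<r. s' b = exec c s b"
    by fastforce
  have "c_below r d" "c_bounded U d s'"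
    using Sq.prems s'(2) c_bounded_cong[of r d s' "exec c s"] by auto
  from Sq.IH(2)[OF this] obtain s'' where s'': "runs (c_comp d r) s' (c_time U d) s''" "\<forall>b<r. s'' b = exec d s' b"
    by blast
  have "runs (c_comp (Sq c d) r) s (c_time U (Sq c d)) s''"
    using runs_Seq[OF s'(1) s''(1)] by (simp add: runs_mono)
  moreover have "\<forall>b<r. s'' b = exec (Sq c d) s b"
    using s'' s' Sq.prems exec_cong[of r d s' "exec c s"] by simp
  ultimately show ?case
    by blast
next
  case (If e c d)
  then have "a_below r e" "a_bounded U e s"
    by auto
  from a_comp_correct[OF this] obtain s' where
    s': "runs (a_comp e r) s (a_time U e) s'" "s' r 0 = aval e s" "\<forall>b<r. s' b = s b"
    by blast
  define g where "g = (if aval e s \<noteq> 0 then c else d)"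
  have g: "c_below r g" "c_bounded U g s" "exec g s = exec (If e c d) s" "c_time U g \<le> c_time U c + c_time U d"
    using If.prems by (simp_all add: g_def)
  have g': "c_bounded U g s'"
    using g(1,2) s'(3) c_bounded_cong[of r g s' s] by blast
  have g'': "exec g s' b = exec g s b" if "b < r" for b
    using g(1) s'(3) that by (intro exec_cong[of r]) simp_all
  have "\<exists>s''. runs (c_comp g r) s' (c_time U g) s'' \<and> (\<forall>b<r. s'' b = exec g s' b)"
  proof (cases "aval e s = 0")
    case True
    then have "g = d"
      by (simp add: g_def)
    then show ?thesis
      using If.IH(2) g(1) g' by blast
  next
    case False
    then have "g = c"
      by (simp add: g_def)
    then show ?thesis
      using If.IH(1) g(1) g' by blast
  qed
  then obtain s'' where s'': "runs (c_comp g r) s' (c_time U g) s''" "\<forall>b<r. s'' b = exec g s' b"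
    by blast
  have "runs (Cond (reg r) (c_comp c r) (c_comp d r)) s' (1 + expr_cost (reg r) + c_time U g) s''"
    using s''(1) s'(2) by (intro runs_Cond) (simp add: g_def split: if_splits)
  from runs_Seq[OF s'(1) this] have "runs (c_comp (If e c d) r) s (c_time U (If e c d)) s''"
    unfolding c_comp.simps by (rule runs_mono) (use g(4) in simp)
  moreover have "\<forall>b<r. s'' b = exec (If e c d) s b"
    using s'' g'' g(3) by simp
  ultimately show ?case
    by blast
next
  case (For x b c)
  let ?n = "s b 0"
  let ?it = "\<lambda>i. fold (\<lambda>i s. exec c (put x i s)) [0..<i] s"
  define Inv where "Inv i s' \<longleftrightarrow> (\<forall>b<r. s' b = ?it i b) \<and> s' r 0 = i \<and> s' (r + 1) 0 = ?n" for i s'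
  from For.prems have below: "x < r" "b < r" "c_below r c" "?n \<le> U"
    "\<And>i. i < ?n \<Longrightarrow> c_bounded U c (put x i (?it i))"
    by auto
  let ?body = "Seq (Put x (Lit 0) (reg r)) (Seq (c_comp c (r + 2)) (Put r (Lit 0) (Add (reg r) (Lit 1))))"
  have step: "expr_val (Sub (reg (r + 1)) (reg r)) s' \<noteq> 0 \<and>
      (\<exists>s''. runs ?body s' (c_time U c + 20) s'' \<and> Inv (Suc i) s'')" if i: "i < ?n" and s': "Inv i s'" for i s'
  proof -
    let ?s1 = "put x i s'"
    have agree: "?s1 b = put x i (?it i) b" if "b < r" for b
      using s' that below(1) by (simp add: Inv_def put_apply)
    have c: "c_below (r + 2) c" "c_bounded U c ?s1"
      using below i agree c_bounded_cong[of r c ?s1 "put x i (?it i)"] c_below_mono[of r c "r + 2"] by auto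
    from For.IH[OF this] obtain s2 where s2: "runs (c_comp c (r + 2)) ?s1 (c_time U c) s2"
      "\<forall>b<r + 2. s2 b = exec c ?s1 b"
      by blast
    have "runs (Put x (Lit 0) (reg r)) s' 4 ?s1"
      using runs_Put_reg[of x "reg r" s'] s' by (simp add: Inv_def)
    from runs_Seq[OF this runs_Seq[OF s2(1) runs_Put_reg[of r "Add (reg r) (Lit 1)" s2]]]
    have "runs ?body s' (c_time U c + 20) (put r (s2 r 0 + 1) s2)"
      by (simp add: runs_mono)
    moreover have "Inv (Suc i) (put r (s2 r 0 + 1) s2)"
    proof -
      have "s2 r 0 = i" "s2 (r + 1) 0 = ?n"
        using s2(2) exec_frame[OF below(3), of r ?s1] exec_frame[OF below(3), of "r + 1" ?s1] s' below(1)
        by (simp_all add: Inv_def put_apply)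
      moreover have "s2 b = ?it (Suc i) b" if "b < r" for b
        using s2(2) that exec_cong[OF below(3), of ?s1 "put x i (?it i)" b] agree by simp
      ultimately show ?thesis
        by (simp add: Inv_def put_apply)
    qed
    moreover have "expr_val (Sub (reg (r + 1)) (reg r)) s' \<noteq> 0"
      using s' i by (simp add: Inv_def)
    ultimately show ?thesis
      by blast
  qed
  define s1 where "s1 = put (r + 1) ?n (put r 0 s)"
  have init: "Inv 0 s1"
    by (simp add: Inv_def s1_def put_apply)
  have final: "expr_val (Sub (reg (r + 1)) (reg r)) s' = 0" if "Inv ?n s'" for s'
    using that by (simp add: Inv_def)
  note runs_While[of Inv 0 s1 ?n "Sub (reg (r + 1)) (reg r)" ?body "c_time U c + 20", OF init step final le0]
  then obtain s2 where s2: "runs (While (Sub (reg (r + 1)) (reg r)) ?body) s1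
      ((?n - 0) * (1 + expr_cost (Sub (reg (r + 1)) (reg r)) + (c_time U c + 20)) + 1 + expr_cost (Sub (reg (r + 1)) (reg r))) s2"
      "Inv ?n s2"
    by blast
  have "?n * (26 + c_time U c) \<le> U * (40 + c_time U c)"
    using below(4) by (intro mult_le_mono) simp_all
  moreover have "runs (c_comp (For x b c) r) s (?n * (26 + c_time U c) + 40) s2"
  proof -
    have s1: "runs (Put r (Lit 0) (Lit 0)) s 3 (put r 0 s)"
      "runs (Put (r + 1) (Lit 0) (reg b)) (put r 0 s) 4 s1"
      using runs_Put_reg[of r "Lit 0" s] runs_Put_reg[of "r + 1" "reg b" "put r 0 s"] below(2)
      by (simp_all add: s1_def put_apply)
    from runs_Seq[OF s1(1) runs_Seq[OF s1(2) s2(1)]] show ?thesis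
      unfolding c_comp.simps by (rule runs_mono) simp
  qed
  ultimately have "runs (c_comp (For x b c) r) s (c_time U (For x b c)) s2"
    by (auto elim!: runs_mono)
  then show ?case
    using s2(2) by (auto simp: Inv_def)
qed

text \<open>A syntactic criterion for bounded loops: all loop bounds are variables from
  \<open>Y\<close>, to which nothing is ever written, so that their initial values bound all
  loops.\<close>

primrec a_static :: "nat set \<Rightarrow> aexp \<Rightarrow> bool" where
  "a_static Y (N n) = True"
| "a_static Y (Rd b e) = a_static Y e"
| "a_static Y (Plus e f) = (a_static Y e \<and> a_static Y f)"
| "a_static Y (Minus e f) = (a_static Y e \<and> a_static Y f)"
| "a_static Y (Ite c e f) = (a_static Y c \<and> a_static Y e \<and> a_static Y f)"
| "a_static Y (Sum x b e) = (x \<notin> Y \<and> b \<in> Y \<and> a_static Y e)"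

primrec c_static :: "nat set \<Rightarrow> cmd \<Rightarrow> bool" where
  "c_static Y Nop = True"
| "c_static Y (Asg b i e) = (b \<notin> Y \<and> a_static Y i \<and> a_static Y e)"
| "c_static Y (Sq c d) = (c_static Y c \<and> c_static Y d)"
| "c_static Y (If e c d) = (a_static Y e \<and> c_static Y c \<and> c_static Y d)"
| "c_static Y (For x b c) = (x \<notin> Y \<and> b \<in> Y \<and> c_static Y c)"

lemma a_static_bounded:
  "a_static Y e \<Longrightarrow> (\<And>y. y \<in> Y \<Longrightarrow> s y 0 \<le> U) \<Longrightarrow> a_bounded U e s"
proof (induction e arbitrary: s)
  case (Sum x b e)
  have "a_bounded U e (put x i s)" for i
    using Sum.prems by (intro Sum.IH) (auto simp: put_apply)
  with Sum.prems show ?case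
    by simp
qed auto

lemma c_static_frame: "c_static Y c \<Longrightarrow> y \<in> Y \<Longrightarrow> exec c s y = s y"
proof (induction c arbitrary: s)
  case (For x b c)
  have "fold (\<lambda>i s. exec c (put x i s)) is s y = s y" for "is"
  proof (induction "is" arbitrary: s)
    case (Cons i "is")
    then show ?case
      using For.IH[of "put x i s"] For.prems by (auto simp: put_apply)
  qed simp
  then show ?case
    by simp
qed auto

lemma c_static_bounded:
  "c_static Y c \<Longrightarrow> (\<And>y. y \<in> Y \<Longrightarrow> s y 0 \<le> U) \<Longrightarrow> c_bounded U c s"
proof (induction c arbitrary: s)
  case (Asg b i e)
  then show ?case
    using a_static_bounded[of Y i s U] a_static_bounded[of Y e s U] by simp
next
  case (Sq c d)
  then show ?case
    using c_static_frame[of Y c _ s] by simp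
next
  case (If e c d)
  then show ?case
    using a_static_bounded[of Y e s U] by simp
next
  case (For x b c)
  have "fold (\<lambda>i s. exec c (put x i s)) is s y = s y" if "y \<in> Y" for "is" y s
  proof (induction "is" arbitrary: s)
    case (Cons i "is")
    then show ?case
      using c_static_frame[of Y c y] For.prems that by (auto simp: put_apply)
  qed simp
  then have "c_bounded U c (put x i (fold (\<lambda>i s. exec c (put x i s)) [0..<i] s))" for i
    using For.prems by (intro For.IH) (auto simp: put_apply)
  with For.prems show ?case
    by simp
qed simp

section \<open>Polynomial running time in the loop bound\<close>

definition poly_bounded :: "(nat \<Rightarrow> nat) \<Rightarrow> bool" where
  "poly_bounded f \<longleftrightarrow> (\<exists>A e. \<forall>U. f U \<le> A * (U + 1) ^ e)"

lemma poly_bounded_const: "poly_bounded (\<lambda>U. c)"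
  unfolding poly_bounded_def by (intro exI[of _ c] exI[of _ 0]) simp

lemma poly_bounded_add:
  assumes "poly_bounded f" and "poly_bounded g"
  shows "poly_bounded (\<lambda>U. f U + g U)"
proof -
  from assms obtain A e B d where f: "\<And>U. f U \<le> A * (U + 1) ^ e" and g: "\<And>U. g U \<le> B * (U + 1) ^ d"
    unfolding poly_bounded_def by blast
  have "f U + g U \<le> (A + B) * (U + 1) ^ (e + d)" for U
  proof -
    have "(U + 1) ^ e \<le> (U + 1) ^ (e + d)" "(U + 1) ^ d \<le> (U + 1) ^ (e + d)"
      by (rule power_increasing; simp)+
    then have "A * (U + 1) ^ e \<le> A * (U + 1) ^ (e + d)" "B * (U + 1) ^ d \<le> B * (U + 1) ^ (e + d)"
      using mult_left_mono by blast+
    with f[of U] g[of U] show ?thesis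
      unfolding add_mult_distrib by linarith
  qed
  then show ?thesis
    unfolding poly_bounded_def by blast
qed

lemma poly_bounded_mult_arg:
  assumes "poly_bounded f"
  shows "poly_bounded (\<lambda>U. U * f U)"
proof -
  from assms obtain A e where f: "\<And>U. f U \<le> A * (U + 1) ^ e"
    unfolding poly_bounded_def by blast
  have "U * f U \<le> A * (U + 1) ^ Suc e" for U
  proof -
    have "U * f U \<le> (U + 1) * (A * (U + 1) ^ e)"
      by (rule mult_le_mono) (use f in simp_all)
    also have "\<dots> = A * (U + 1) ^ Suc e"
      by (simp only: power_Suc mult_ac)
    finally show ?thesis .
  qed
  then show ?thesis
    unfolding poly_bounded_def by blast
qed

lemma poly_bounded_a_time: "poly_bounded (\<lambda>U. a_time U e)"
  by (induction e) (simp_all only: a_time.simps poly_bounded_add poly_bounded_const poly_bounded_mult_arg)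

lemma poly_bounded_c_time: "poly_bounded (\<lambda>U. c_time U c)"
  by (induction c) (simp_all only: c_time.simps poly_bounded_add poly_bounded_const
      poly_bounded_mult_arg poly_bounded_a_time)

section \<open>The search program: expressions\<close>

definition Less :: "aexp \<Rightarrow> aexp \<Rightarrow> aexp" where "Less a b = Ite (Minus b a) (N 1) (N 0)"
definition Equal :: "aexp \<Rightarrow> aexp \<Rightarrow> aexp" where "Equal a b = Ite (Plus (Minus a b) (Minus b a)) (N 0) (N 1)"
definition Neg :: "aexp \<Rightarrow> aexp" where "Neg a = Ite a (N 0) (N 1)"
definition Conj :: "aexp \<Rightarrow> aexp \<Rightarrow> aexp" where "Conj a b = Ite a (Ite b (N 1) (N 0)) (N 0)"
definition Disj :: "aexp \<Rightarrow> aexp \<Rightarrow> aexp" where "Disj a b = Ite a (N 1) (Ite b (N 1) (N 0))"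
text \<open>Quantifiers become sums, which are nonzero iff some summand is. In the same way,
  multiplication by a variable is a \<open>Sum\<close> whose summand does not mention the bound
  variable.\<close>

definition Exists :: "nat \<Rightarrow> nat \<Rightarrow> aexp \<Rightarrow> aexp" where "Exists x b e = Ite (Sum x b e) (N 1) (N 0)"
definition Forall :: "nat \<Rightarrow> nat \<Rightarrow> aexp \<Rightarrow> aexp" where "Forall x b e = Neg (Sum x b (Neg e))"
definition Count :: "nat \<Rightarrow> nat \<Rightarrow> aexp \<Rightarrow> aexp" where "Count x b e = Sum x b (Ite e (N 1) (N 0))"

primrec Times :: "nat \<Rightarrow> aexp \<Rightarrow> aexp" where
  "Times 0 e = N 0"
| "Times (Suc n) e = Plus e (Times n e)"

lemmas abbrev_defs = Less_def Equal_def Neg_def Conj_def Disj_def Exists_def Forall_def Count_def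

lemma aval_Less [simp]: "aval (Less a b) s = of_bool (aval a s < aval b s)"
  by (simp add: Less_def)

lemma aval_Equal [simp]: "aval (Equal a b) s = of_bool (aval a s = aval b s)"
  by (auto simp: Equal_def)

lemma aval_Neg [simp]: "aval (Neg a) s = of_bool (aval a s = 0)"
  by (simp add: Neg_def)

lemma aval_Conj [simp]: "aval (Conj a b) s = of_bool (aval a s \<noteq> 0 \<and> aval b s \<noteq> 0)"
  by (simp add: Conj_def)

lemma aval_Disj [simp]: "aval (Disj a b) s = of_bool (aval a s \<noteq> 0 \<or> aval b s \<noteq> 0)"
  by (simp add: Disj_def)

lemma aval_Exists [simp]: "aval (Exists x b e) s = of_bool (\<exists>i<s b 0. aval e (put x i s) \<noteq> 0)"
  by (auto simp: Exists_def)

lemma aval_Forall [simp]: "aval (Forall x b e) s = of_bool (\<forall>i<s b 0. aval e (put x i s) \<noteq> 0)"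
  by (auto simp: Forall_def)

lemma aval_Count [simp]: "aval (Count x b e) s = card {i. i < s b 0 \<and> aval e (put x i s) \<noteq> 0}"
proof -
  have "aval (Count x b e) s = (\<Sum>i<s b 0. if aval e (put x i s) \<noteq> 0 then 1 else 0)"
    by (simp add: Count_def cong: if_cong)
  also have "\<dots> = card ({..<s b 0} \<inter> {i. aval e (put x i s) \<noteq> 0})"
    by (simp add: sum.If_cases)
  finally show ?thesis
    by (simp add: Int_def)
qed

lemma aval_Times [simp]: "aval (Times n e) s = n * aval e s"
  by (induction n) simp_all

lemma aval_put_above:
  assumes "a_below r e" and "r \<le> x"
  shows "aval e (put x i s) = aval e s"
  by (rule aval_cong[OF assms(1)]) (use assms(2) in \<open>auto simp: put_apply\<close>)

lemma card_below_count:
  fixes i n :: nat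
  assumes "i \<le> n"
  shows "card {y. y < n \<and> y < i} = i"
proof -
  have "{y. y < n \<and> y < i} = {..<i}"
    using assms by auto
  then show ?thesis
    by simp
qed

text \<open>The element number \<open>i\<close>, counted from \<open>0\<close>, among those below \<open>n\<close> that satisfy \<open>p\<close>; it is \<open>0\<close> if
  there are not enough of them.\<close>

definition select :: "(nat \<Rightarrow> bool) \<Rightarrow> nat \<Rightarrow> nat \<Rightarrow> nat" where
  "select p n i = (\<Sum>y<n. if p y \<and> card {y'. y' < n \<and> y' < y \<and> p y'} = i then y else 0)"

lemma select_rank:
  assumes "p y" and "y < n"
  shows "select p n (card {y'. y' < n \<and> y' < y \<and> p y'}) = y"
    and "card {y'. y' < n \<and> y' < y \<and> p y'} < card {y'. y' < n \<and> p y'}"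
proof -
  have strict: "card {y'. y' < n \<and> y' < a \<and> p y'} < card {y'. y' < n \<and> y' < b \<and> p y'}"
    if "a < b" "p a" "a < n" for a b
  proof (rule psubset_card_mono)
    have "a \<in> {y'. y' < n \<and> y' < b \<and> p y'}" "a \<notin> {y'. y' < n \<and> y' < a \<and> p y'}"
      using that by auto
    then show "{y'. y' < n \<and> y' < a \<and> p y'} \<subset> {y'. y' < n \<and> y' < b \<and> p y'}"
      using that(1) by auto
  qed simp
  have "z = y" if "z < n" "p z" "card {y'. y' < n \<and> y' < z \<and> p y'} = card {y'. y' < n \<and> y' < y \<and> p y'}" for z
    using strict[of z y] strict[of y z] that assms by (metis linorder_less_linear nat_neq_iff)
  then have "select p n (card {y'. y' < n \<and> y' < y \<and> p y'}) = (\<Sum>z<n. if z = y then y else 0)"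
    unfolding select_def using assms by (intro sum.cong) auto
  also have "\<dots> = y"
    using assms by simp
  finally show "select p n (card {y'. y' < n \<and> y' < y \<and> p y'}) = y" .
  show "card {y'. y' < n \<and> y' < y \<and> p y'} < card {y'. y' < n \<and> p y'}"
    by (rule psubset_card_mono) (use assms in auto)
qed

lemma select_less:
  assumes "0 < n"
  shows "select p n i < n"
proof (cases "\<exists>y<n. p y \<and> card {y'. y' < n \<and> y' < y \<and> p y'} = i")
  case True
  then obtain y where "y < n" "p y" "card {y'. y' < n \<and> y' < y \<and> p y'} = i"
    by blast
  then show ?thesis
    using select_rank(1)[of p y n] by simp
next
  case False
  then have "select p n i = 0"
    by (auto simp: select_def)
  with assms show ?thesis
    by simp
qed

definition digit :: "nat \<Rightarrow> nat \<Rightarrow> nat \<Rightarrow> nat" where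
  "digit Q z i = z div Q ^ i mod Q"

text \<open>A single loop over all numbers below \<open>Q ^ D\<close> therefore replaces
  \<open>D\<close> nested loops over independent choices, which no fixed program could contain, as
  \<open>D\<close> depends on \<open>k\<close>.\<close>

lemma exists_digits:
  assumes "\<And>i. i < D \<Longrightarrow> g i < Q"
  shows "\<exists>z<Q ^ D. \<forall>i<D. digit Q z i = g i"
  using assms
proof (induction D arbitrary: g)
  case (Suc D)
  have "\<exists>z<Q ^ D. \<forall>i<D. digit Q z i = g (Suc i)"
    using Suc.prems by (intro Suc.IH) simp
  then obtain z where z: "z < Q ^ D" "\<And>i. i < D \<Longrightarrow> digit Q z i = g (Suc i)"
    by blast
  have g0: "g 0 < Q"
    using Suc.prems by simp
  let ?z = "z * Q + g 0"
  have "?z < Q ^ Suc D"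
    using block_less[OF z(1) g0] by (simp add: mult.commute)
  moreover have "digit Q ?z i = g i" if "i < Suc D" for i
  proof (cases i)
    case 0
    then show ?thesis
      using g0 by (simp add: digit_def)
  next
    case (Suc j)
    have "?z div Q ^ Suc j = ?z div Q div Q ^ j"
      by (simp add: div_mult2_eq)
    also have "?z div Q = z"
      using g0 by simp
    finally show ?thesis
      using z(2)[of j] Suc that by (simp add: digit_def)
  qed
  ultimately show ?case
    by blast
qed simp

text \<open>A number \<open>z < Q ^ D\<close> encodes a way to break up a state: its digits to the base \<open>Q\<close> contain, for
  each of the \<open>K\<close> pattern vertices, the \<open>W\<close> steps of a walk in the red graph, a digit that tells whether
  the vertex is present, and the label of its component. A step is given by the number of the
  next vertex among the red neighbours.

  Cell \<open>0\<close> of the following banks holds a parameter: \<open>1: m\<close>, \<open>2: n\<close>, \<open>3: off\<close> (the address of the pattern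
  in the input), \<open>4: k\<close>, \<open>5: K\<close>, \<open>6: L\<close>, \<open>7: d\<close>, \<open>8: Q\<close>, \<open>9: H\<close>, \<open>10: W\<close>. In a stage, \<open>11\<close> is its number, \<open>12\<close> the
  place of the merge, \<open>13\<close> the start of the walks, \<open>16\<close> the number \<open>z\<close>, \<open>17\<close> the walker, \<open>18\<close> a code, \<open>19\<close> a
  flag and \<open>28\<close> a label, while \<open>14\<close>, \<open>15\<close> and \<open>29\<close> count. The arrays are \<open>20\<close> and \<open>22\<close> for the partitions
  before and after the merge, \<open>21\<close> for the representatives of the classes before it, \<open>23\<close> for the
  decoded state, \<open>24\<close> for its labels, \<open>25\<close> for the state whose code is computed, \<open>26\<close> for the table
  and \<open>27\<close> for the powers of \<open>Q\<close>.\<close>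

locale search_program = line_graph L K E EP
  for L K :: nat and E EP :: "nat \<Rightarrow> nat \<Rightarrow> bool" +
  fixes inp :: "nat \<Rightarrow> nat" and m n off k d Q D W :: nat
  assumes E_def: "E x y \<longleftrightarrow> x < m \<and> m \<le> y \<and> y < L \<and> inp (2 + (n * x + (y - m))) \<noteq> 0"
    and EP_def: "EP p q \<longleftrightarrow> p < k \<and> k \<le> q \<and> q < K \<and> inp (off + (2 + (k * p + (q - k)))) \<noteq> 0"
    and L_pos: "2 \<le> L" and K_def: "K = 2 * k" and Q_ge: "2 * (d + 1) * 2 ^ d + K + 2 \<le> Q"
    and D_def: "D = K * (W + 2)" and W_def: "W = K * K"
begin

definition H :: nat where
  "H = Q ^ D"

definition env :: "store \<Rightarrow> bool" where
  "env s \<longleftrightarrow> s 0 = inp \<and> s 1 0 = m \<and> s 2 0 = n \<and> s 3 0 = off \<and> s 4 0 = k \<and> s 5 0 = K \<and>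
    s 6 0 = L \<and> s 7 0 = d \<and> s 8 0 = Q \<and> s 9 0 = H \<and> s 10 0 = W \<and> (\<forall>i\<le>D. s 27 i = Q ^ i)"

lemma envD:
  assumes "env s"
  shows "s 0 = inp" "s (Suc 0) 0 = m" "s 2 0 = n" "s 3 0 = off" "s 4 0 = k" "s 5 0 = K" "s 6 0 = L"
    "s 7 0 = d" "s 8 0 = Q" "s 9 0 = H" "s 10 0 = W"
  using assms by (simp_all add: env_def)

lemma env_cong:
  assumes "\<And>b. b \<le> 10 \<or> b = 27 \<Longrightarrow> s' b = s b"
  shows "env s' = env s"
  unfolding env_def using assms by simp

lemma env_put [simp]: "10 < x \<Longrightarrow> x \<noteq> 27 \<Longrightarrow> env (put x i s) = env s"
  by (rule env_cong) (auto simp: put_apply)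

text \<open>The variables bound inside an expression have larger numbers than those of its arguments.\<close>

definition eE :: "aexp \<Rightarrow> aexp \<Rightarrow> aexp" where
  "eE x y = Conj (Less x (V 1)) (Conj (Neg (Less y (V 1))) (Conj (Less y (V 6))
     (Rd 0 (Plus (N 2) (Plus (Sum 60 2 x) (Minus y (V 1)))))))"

definition eEP :: "aexp \<Rightarrow> aexp \<Rightarrow> aexp" where
  "eEP x y = Conj (Less x (V 4)) (Conj (Neg (Less y (V 4))) (Conj (Less y (V 5))
     (Rd 0 (Plus (V 3) (Plus (N 2) (Plus (Sum 60 4 x) (Minus y (V 4))))))))"

definition eAdj :: "aexp \<Rightarrow> aexp \<Rightarrow> aexp" where
  "eAdj x y = Disj (eE x y) (eE y x)"

definition eCell :: "nat \<Rightarrow> aexp \<Rightarrow> aexp \<Rightarrow> aexp" where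
  "eCell p i j = Exists 58 6 (Exists 59 6 (Conj (Equal (Rd p (V 58)) i)
     (Conj (Equal (Rd p (V 59)) j) (eAdj (V 58) (V 59)))))"

definition eSing :: "nat \<Rightarrow> aexp \<Rightarrow> aexp" where
  "eSing p u = Forall 57 6 (Disj (Neg (Equal (Rd p (V 57)) (Rd p u))) (Equal (V 57) u))"

definition eEqv :: "nat \<Rightarrow> aexp \<Rightarrow> aexp \<Rightarrow> aexp" where
  "eEqv p x y = Conj (Equal (Rd p x) (Rd p y))
     (Forall 56 6 (Disj (Neg (eSing p (V 56))) (Equal (eAdj x (V 56)) (eAdj y (V 56)))))"

text \<open>The least member of a class equals the number of lines that are smaller than all
  members, so it can be counted.\<close>

definition eCls :: "nat \<Rightarrow> aexp \<Rightarrow> aexp" where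
  "eCls p x = Count 54 6 (Forall 55 6 (Disj (Less (V 54) (V 55)) (Neg (eEqv p (V 55) x))))"

definition eRed :: "nat \<Rightarrow> aexp \<Rightarrow> aexp \<Rightarrow> aexp" where
  "eRed p x y = Disj (Equal (Rd p x) (Rd p y))
     (Conj (Neg (eSing p x)) (Conj (Neg (eSing p y)) (eCell p (Rd p x) (Rd p y))))"

definition eMergeable :: "nat \<Rightarrow> aexp \<Rightarrow> aexp" where
  "eMergeable p v = Conj (Less (Plus v (N 1)) (V 6)) (Conj (Neg (Equal (Rd p v) (Rd p (Plus v (N 1)))))
     (Neg (Less (V 7) (Count 53 6 (Disj (eCell p (Rd p v) (V 53)) (eCell p (Rd p (Plus v (N 1))) (V 53)))))))"

text \<open>Only the red neighbour of rank \<open>i\<close> contributes to the outer sum.\<close>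

definition eNbr :: "aexp \<Rightarrow> aexp \<Rightarrow> aexp" where
  "eNbr w i = Sum 51 6 (Ite (Conj (Conj (Equal (Rd 21 (V 51)) (V 51)) (eRed 22 w (V 51)))
     (Equal (Count 52 6 (Conj (Less (V 52) (V 51)) (Conj (Equal (Rd 21 (V 52)) (V 52)) (eRed 22 w (V 52))))) i))
     (V 51) (N 0))"

text \<open>The language has no division: \<open>eDiv p\<close> counts the \<open>a < H\<close> with \<open>Suc a * p \<le> z\<close>, where the inner sum is
  the product.\<close>

definition eDiv :: "aexp \<Rightarrow> aexp" where
  "eDiv p = Count 48 9 (Neg (Less (V 16) (Sum 47 9 (Ite (Less (V 48) (V 47)) (N 0) p))))"

text \<open>The remainder modulo \<open>Q\<close> as a difference: the quotient by
  \<open>Q ^ i\<close> minus \<open>Q\<close> times the quotient by \<open>Q ^ (i + 1)\<close>,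
  where the sum multiplies by \<open>Q\<close>.\<close>

definition eDig :: "aexp \<Rightarrow> aexp" where
  "eDig i = Minus (eDiv (Rd 27 i)) (Sum 46 8 (eDiv (Rd 27 (Plus i (N 1)))))"

definition eOk :: "aexp \<Rightarrow> aexp \<Rightarrow> aexp \<Rightarrow> aexp \<Rightarrow> aexp" where
  "eOk x y p q = Disj (Neg (Less p q)) (Conj (Less x y) (Equal (eE x y) (eEP p q)))"

lemmas e_defs = eE_def eEP_def eAdj_def eCell_def eSing_def eEqv_def eCls_def eRed_def eMergeable_def
  eNbr_def eDiv_def eDig_def eOk_def

lemma aval_eE [simp]:
  assumes "env s" "a_below 60 x" "a_below 60 y"
  shows "aval (eE x y) s = of_bool (E (aval x s) (aval y s))"
  using envD[OF assms(1)] aval_put_above[OF assms(2)]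
  by (auto simp: eE_def E_def not_less)

lemma aval_eEP [simp]:
  assumes "env s" "a_below 60 x" "a_below 60 y"
  shows "aval (eEP x y) s = of_bool (EP (aval x s) (aval y s))"
  using envD[OF assms(1)] aval_put_above[OF assms(2)]
  by (auto simp: eEP_def EP_def not_less)

lemma aval_eAdj [simp]:
  assumes "env s" "a_below 60 x" "a_below 60 y"
  shows "aval (eAdj x y) s = of_bool (adj (aval x s) (aval y s))"
  using assms by (simp add: eAdj_def adj_def)

lemma aval_eCell [simp]:
  assumes "env s" "a_below 58 i" "a_below 58 j" "p < 58"
  shows "aval (eCell p i j) s = of_bool (cell (s p) (aval i s) (aval j s))"
  using assms aval_put_above[OF assms(2)] aval_put_above[OF assms(3)]
  by (simp add: eCell_def cell_def put_apply envD)

lemma aval_eSing [simp]: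
  assumes "env s" "a_below 57 u" "p < 57"
  shows "aval (eSing p u) s = of_bool (sing (s p) (aval u s))"
  using assms aval_put_above[OF assms(2)]
  by (auto simp: eSing_def sing_def put_apply envD)

lemma aval_eEqv [simp]:
  assumes "env s" "a_below 56 x" "a_below 56 y" "p < 56"
  shows "aval (eEqv p x y) s = of_bool (eqv (s p) (aval x s) (aval y s))"
  using assms aval_put_above[OF assms(2)] aval_put_above[OF assms(3)]
    a_below_mono[OF assms(2), of 60] a_below_mono[OF assms(3), of 60]
  by (auto simp: eEqv_def eqv_def put_apply envD)

lemma aval_eCls [simp]:
  assumes "env s" "a_below 54 x" "p < 54" "aval x s < L"
  shows "aval (eCls p x) s = cls (s p) (aval x s)"
proof -
  have "aval (eCls p x) s = card {y. y < L \<and> (\<forall>y'<L. y < y' \<or> \<not> eqv (s p) y' (aval x s))}"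
    using assms aval_put_above[OF assms(2)] a_below_mono[OF assms(2), of 56]
    by (simp add: eCls_def put_apply envD)
  also have "{y. y < L \<and> (\<forall>y'<L. y < y' \<or> \<not> eqv (s p) y' (aval x s))} = {y. y < L \<and> y < cls (s p) (aval x s)}"
  proof -
    let ?c = "cls (s p) (aval x s)"
    have "(\<forall>y'<L. y < y' \<or> \<not> eqv (s p) y' (aval x s)) \<longleftrightarrow> y < ?c" for y
    proof
      assume "\<forall>y'<L. y < y' \<or> \<not> eqv (s p) y' (aval x s)"
      moreover have "?c < L"
        using cls_le[of "s p" "aval x s"] assms(4) by simp
      ultimately show "y < ?c"
        using eqv_cls by blast
    next
      assume "y < ?c"
      moreover have "?c \<le> y'" if "eqv (s p) y' (aval x s)" for y'
        using that unfolding cls_def by (rule Least_le)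
      ultimately show "\<forall>y'<L. y < y' \<or> \<not> eqv (s p) y' (aval x s)"
        by (meson less_le_trans)
    qed
    then show ?thesis
      by simp
  qed
  also have "card \<dots> = cls (s p) (aval x s)"
    using cls_le[of "s p" "aval x s"] assms(4) by (intro card_below_count) simp
  finally show ?thesis .
qed

lemma aval_eRed [simp]:
  assumes "env s" "a_below 57 x" "a_below 57 y" "p < 57"
  shows "aval (eRed p x y) s = of_bool (red (s p) (aval x s) (aval y s))"
  using assms a_below_mono[OF assms(2), of 58] a_below_mono[OF assms(3), of 58]
  by (auto simp: eRed_def red_def)

lemma aval_eMergeable [simp]:
  assumes "env s" "a_below 53 v" "p < 53"
  shows "aval (eMergeable p v) s = of_bool (mergeable d (s p) (aval v s))"
  using assms aval_put_above[OF assms(2)] a_below_mono[OF assms(2), of 58]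
  by (auto simp: eMergeable_def mergeable_def put_apply envD not_less)

definition nbr :: "(nat \<Rightarrow> nat) \<Rightarrow> (nat \<Rightarrow> nat) \<Rightarrow> nat \<Rightarrow> nat \<Rightarrow> nat" where
  "nbr C P2 w i = select (\<lambda>y. C y = y \<and> red P2 w y) L i"

lemma aval_eNbr [simp]:
  assumes "env s" "a_below 51 w" "a_below 51 i"
  shows "aval (eNbr w i) s = nbr (s 21) (s 22) (aval w s) (aval i s)"
  using assms aval_put_above[OF assms(2)] aval_put_above[OF assms(3)] a_below_mono[OF assms(2), of 57]
  by (simp add: eNbr_def nbr_def select_def put_apply envD conj_ac cong: if_cong)

lemma Q_pos: "0 < Q" "1 < Q" "K < Q"
  using Q_ge by simp_all

lemma aval_eDiv:
  assumes "env s" "a_below 47 p" "s 16 0 < H"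
  shows "aval (eDiv p) s = (if aval p s = 0 then H else s 16 0 div aval p s)"
proof -
  let ?z = "s 16 0" and ?p = "aval p s"
  have sum: "(\<Sum>b<H. if a < b then 0 else ?p) = Suc a * ?p" if "a < H" for a
  proof -
    have "(\<Sum>b<H. if a < b then 0 else ?p) = (\<Sum>b<H. if b \<le> a then ?p else 0)"
      by (rule sum.cong) auto
    also have "\<dots> = (\<Sum>b\<in>{..<H} \<inter> {b. b \<le> a}. ?p)"
      by (simp add: sum.If_cases)
    also have "{..<H} \<inter> {b. b \<le> a} = {..a}"
      using that by auto
    finally show ?thesis
      by simp
  qed
  have "aval (eDiv p) s = card {a. a < H \<and> (\<Sum>b<H. if a < b then 0 else ?p) \<le> ?z}"
    using assms aval_put_above[OF assms(2)] by (simp add: eDiv_def put_apply envD not_less not_le cong: if_cong)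
  also have "{a. a < H \<and> (\<Sum>b<H. if a < b then 0 else ?p) \<le> ?z} = {a. a < H \<and> Suc a * ?p \<le> ?z}"
    using sum by auto
  also have "card \<dots> = (if ?p = 0 then H else ?z div ?p)"
  proof (cases "?p = 0")
    case False
    have "Suc a * ?p \<le> ?z \<longleftrightarrow> a < ?z div ?p" for a
      using False less_eq_div_iff_mult_less_eq[of ?p "Suc a" ?z] by (simp add: Suc_le_eq)
    \<comment> \<open>The count is restricted to numbers below \<open>H\<close>, which loses nothing
      for quotients of a number below \<open>H\<close>.\<close>
    moreover have "?z div ?p \<le> H"
      using assms(3) by (meson div_le_dividend less_imp_le_nat order_trans)
    ultimately show ?thesis
      using False by (simp add: card_below_count)
  qed simp
  finally show ?thesis .
qed

lemma aval_eDig: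
  assumes "env s" "a_below 46 i" "s 16 0 < H" "aval i s < D"
  shows "aval (eDig i) s = digit Q (s 16 0) (aval i s)"
proof -
  let ?z = "s 16 0" and ?i = "aval i s"
  have pow: "s 27 j = Q ^ j" if "j \<le> D" for j
    using assms(1) that by (simp add: env_def)
  have "aval (eDig i) s = ?z div Q ^ ?i - Q * (?z div Q ^ Suc ?i)"
    using assms aval_put_above[OF assms(2)] a_below_mono[OF assms(2), of 47] Q_pos pow
    by (simp add: eDig_def aval_eDiv put_apply envD)
  also have "?z div Q ^ Suc ?i = ?z div Q ^ ?i div Q"
    by (simp only: power_Suc2 div_mult2_eq)
  finally show ?thesis
    by (simp add: digit_def minus_mult_div_eq_mod)
qed

lemma aval_eOk [simp]:
  assumes "env s" "a_below 60 x" "a_below 60 y" "a_below 60 p" "a_below 60 q"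
  shows "aval (eOk x y p q) s = of_bool (ok (aval x s) (aval y s) (aval p s) (aval q s))"
  using assms by (auto simp: eOk_def ok_def)

end

section \<open>The search program: commands\<close>

lemma For_inv:
  assumes "s b 0 = n" and "Inv 0 s" and "\<And>i s. i < n \<Longrightarrow> Inv i s \<Longrightarrow> Inv (Suc i) (exec c (put x i s))"
  shows "Inv n (exec (For x b c) s)"
proof -
  have "Inv i (fold (\<lambda>i s. exec c (put x i s)) [0..<i] s)" if "i \<le> n" for i
    using that assms(2,3) by (induction i) simp_all
  then show ?thesis
    using assms(1) by simp
qed

definition Fill :: "nat \<Rightarrow> nat \<Rightarrow> aexp \<Rightarrow> cmd" where
  "Fill a b e = For 14 b (Asg a (V 14) e)"

text \<open>The expression is evaluated while bank \<open>a\<close> is partly overwritten. Hence its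
  value is required to be the same in all stores that differ from \<open>s\<close> only there and in
  the counter.\<close>

lemma exec_Fill:
  assumes "s b 0 = n" and "a \<noteq> 14"
    and e: "\<forall>i<n. \<forall>t. (\<forall>c. c \<noteq> a \<longrightarrow> c \<noteq> 14 \<longrightarrow> t c = s c) \<longrightarrow> t 14 0 = i \<longrightarrow> aval e t = g i"
  shows "exec (Fill a b e) s a = (\<lambda>i. if i < n then g i else s a i)"
    and "\<And>c. c \<noteq> a \<Longrightarrow> c \<noteq> 14 \<Longrightarrow> exec (Fill a b e) s c = s c"
proof -
  define Inv where "Inv j t \<longleftrightarrow> t a = (\<lambda>i. if i < j then g i else s a i) \<and> (\<forall>c. c \<noteq> a \<longrightarrow> c \<noteq> 14 \<longrightarrow> t c = s c)" for j t
  have "Inv n (exec (Fill a b e) s)"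
    unfolding Fill_def
  proof (rule For_inv[where Inv = Inv])
    show "s b 0 = n"
      by (fact assms(1))
    show "Inv 0 s"
      by (simp add: Inv_def)
    show "Inv (Suc i) (exec (Asg a (V 14) e) (put 14 i t))" if i: "i < n" and t: "Inv i t" for i t
    proof -
      have "aval e (put 14 i t) = g i"
        using e i t by (simp add: Inv_def put_apply)
      then show ?thesis
        using t assms(2) by (auto simp: Inv_def put_apply fun_eq_iff)
    qed
  qed
  then show "exec (Fill a b e) s a = (\<lambda>i. if i < n then g i else s a i)"
    and "\<And>c. c \<noteq> a \<Longrightarrow> c \<noteq> 14 \<Longrightarrow> exec (Fill a b e) s c = s c"
    by (simp_all add: Inv_def)
qed

text \<open>The table is indexed by the numbers that have \<open>st\<close> as their leading digit and the entries of
  a state as the others.\<close>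

primrec code :: "nat \<Rightarrow> nat \<Rightarrow> (nat \<Rightarrow> nat) \<Rightarrow> nat \<Rightarrow> nat" where
  "code L st ds 0 = st"
| "code L st ds (Suc j) = code L st ds j * Suc L + ds j"

lemma code_cong: "(\<And>s. s < K \<Longrightarrow> ds s = ds' s) \<Longrightarrow> code L st ds K = code L st ds' K"
  by (induction K) simp_all

text \<open>Entries up to \<open>L\<close> are digits to the base \<open>Suc L\<close>. The stage is
  the leading digit and may be arbitrarily large, so the tables of different stages share one bank
  without collisions.\<close>

lemma code_inject:
  assumes "code L st ds K = code L st' ds' K" and "\<And>s. s < K \<Longrightarrow> ds s \<le> L" and "\<And>s. s < K \<Longrightarrow> ds' s \<le> L"
  shows "st = st' \<and> (\<forall>s<K. ds s = ds' s)"
  using assms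
proof (induction K)
  case (Suc K)
  let ?a = "code L st ds K" and ?b = "code L st' ds' K"
  have le: "ds K < Suc L" "ds' K < Suc L"
    using Suc.prems(2,3)[of K] by simp_all
  have "(?a * Suc L + ds K) div Suc L = (?b * Suc L + ds' K) div Suc L"
    "(?a * Suc L + ds K) mod Suc L = (?b * Suc L + ds' K) mod Suc L"
    using Suc.prems(1) by simp_all
  then have "?a = ?b" "ds K = ds' K"
    using le by (simp_all only: div_mult_self3 mod_mult_self3 mod_less div_less)
  with Suc show ?case
    by (auto simp: less_Suc_eq)
qed simp

context search_program
begin

text \<open>The places below all possible merges are counted, which yields the first merge, or
  \<open>L\<close> if there is none.\<close>

definition eFirst :: aexp where
  "eFirst = Count 44 6 (Forall 45 6 (Disj (Less (V 44) (V 45)) (Neg (eMergeable 20 (V 45)))))"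

text \<open>The inner sum is \<open>W\<close> times the number of the pattern vertex in bank
  \<open>14\<close>; adding this number twice gives the start of its \<open>W + 2\<close>
  digits.\<close>

definition eDigit :: "aexp \<Rightarrow> aexp" where
  "eDigit j = eDig (Plus (Plus (Sum 44 10 (V 14)) (Plus (V 14) (V 14))) j)"

definition cDecode :: cmd where
  "cDecode = For 14 5 (Sq (Asg 17 (N 0) (V 13)) (Sq (For 15 10 (Asg 17 (N 0) (eNbr (V 17) (eDigit (V 15)))))
     (Sq (Asg 23 (V 14) (Ite (eDigit (V 10)) (Plus (V 17) (N 1)) (N 0)))
         (Asg 24 (V 14) (eDigit (Plus (V 10) (N 1)))))))"

definition cCode :: "aexp \<Rightarrow> cmd" where
  "cCode e = Sq (Asg 18 (N 0) e) (For 14 5 (Asg 18 (N 0) (Plus (Plus (V 18) (Sum 44 6 (V 18))) (Rd 25 (V 14)))))"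

definition cBlock :: cmd where
  "cBlock = Sq (Fill 25 5 (Ite (Equal (Rd 24 (V 14)) (V 28)) (Rd 23 (V 14)) (N 0))) (Sq (cCode (V 11))
     (Asg 19 (N 0) (Conj (V 19) (Disj (Neg (Exists 45 5 (Rd 25 (V 45)))) (Rd 26 (V 18))))))"

definition eCross :: aexp where
  "eCross = Forall 44 5 (Forall 45 5 (Disj (Neg (Conj (Rd 23 (V 44)) (Conj (Rd 23 (V 45)) (Neg (Equal (Rd 24 (V 44)) (Rd 24 (V 45)))))))
      (Conj (Neg (eRed 20 (Minus (Rd 23 (V 44)) (N 1)) (Minus (Rd 23 (V 45)) (N 1))))
        (eOk (Minus (Rd 23 (V 44)) (N 1)) (Minus (Rd 23 (V 45)) (N 1)) (V 44) (V 45)))))"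

definition cTry :: cmd where
  "cTry = Sq cDecode (Sq (Asg 19 (N 0) eCross) (Sq (For 28 8 cBlock)
     (Sq (Fill 25 5 (Ite (Rd 23 (V 14)) (Plus (N 1) (eCls 22 (Minus (Rd 23 (V 14)) (N 1)))) (N 0)))
     (Sq (cCode (Plus (V 11) (N 1))) (If (V 19) (Asg 26 (V 18) (N 1)) Nop)))))"

text \<open>A stage in which no merge is possible repeats the partition and derives the states anew
  under the next stage number. So the number of stages can be fixed as \<open>L\<close>
  beforehand.\<close>

definition cStage :: cmd where
  "cStage = Sq (Asg 12 (N 0) eFirst) (Sq (Fill 22 6 (Ite (Less (V 12) (V 14)) (Minus (Rd 20 (V 14)) (N 1)) (Rd 20 (V 14))))
     (Sq (For 13 6 (For 16 9 cTry)) (Sq (Fill 20 6 (Rd 22 (V 14))) (Fill 21 6 (eCls 22 (V 14))))))"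

definition cInit :: cmd where
  "cInit = Sq (Fill 25 5 (Ite (Equal (V 14) (V 29)) (Plus (V 13) (N 1)) (N 0))) (Sq (cCode (N 0)) (Asg 26 (V 18) (N 1)))"

text \<open>The state looked up at the end is constantly \<open>1\<close>, the code of
  representative \<open>0\<close>. A nonzero label of the last line means that several parts are
  left.\<close>

definition cSearch :: cmd where
  "cSearch = Sq (Fill 20 6 (V 14)) (Sq (Fill 21 6 (V 14)) (Sq (Asg 11 (N 0) (N 0))
     (Sq (For 29 5 (For 13 6 cInit))
     (Sq (For 11 6 cStage) (Sq (Asg 11 (N 0) (V 6)) (Sq (Fill 25 5 (N 1)) (Sq (cCode (V 11))
        (Asg 0 (N 0) (Disj (Rd 20 (Minus (V 6) (N 1))) (Rd 26 (V 18)))))))))))"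

lemmas c_defs = eFirst_def eDigit_def cDecode_def cCode_def cBlock_def eCross_def cTry_def cStage_def
  cInit_def cSearch_def Fill_def

lemma cSearch_static: "c_static {1, 2, 4, 5, 6, 8, 9, 10} cSearch"
  by (simp add: c_defs e_defs abbrev_defs)

lemma cSearch_below: "c_below 61 cSearch"
  by (simp add: c_defs e_defs abbrev_defs)

lemma aval_eFirst:
  assumes "env s"
  shows "aval eFirst s = card {v. v < L \<and> (\<forall>w<L. v < w \<or> \<not> mergeable d (s 20) w)}"
  using assms by (simp add: eFirst_def put_apply envD)

lemma merge_position:
  "\<exists>v. card {v. v < L \<and> (\<forall>w<L. v < w \<or> \<not> mergeable d P w)} = v \<and>
     (mergeable d P v \<or> v = L \<and> (\<forall>w. \<not> mergeable d P w))"
proof (cases "\<exists>w. mergeable d P w")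
  case True
  define v where "v = (LEAST w. mergeable d P w)"
  have v: "mergeable d P v" "\<And>w. mergeable d P w \<Longrightarrow> v \<le> w"
    using True unfolding v_def by (auto intro: LeastI Least_le)
  then have "v < L"
    by (simp add: mergeable_def)
  then have "(\<forall>w<L. u < w \<or> \<not> mergeable d P w) \<longleftrightarrow> u < v" for u
    using v by (meson leD leI less_le_trans)
  then have "card {v. v < L \<and> (\<forall>w<L. v < w \<or> \<not> mergeable d P w)} = v"
    using \<open>v < L\<close> card_below_count[of v L] by simp
  with v(1) show ?thesis
    by blast
qed simp

lemma exec_cCode:
  assumes "env s" and "\<And>i. aval e s = st"
  shows "exec (cCode e) s 18 0 = code L st (s 25) K"
    and "\<And>c. c \<noteq> 14 \<Longrightarrow> c \<noteq> 18 \<Longrightarrow> exec (cCode e) s c = s c"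
proof -
  define Inv where "Inv j t \<longleftrightarrow> t 18 0 = code L st (s 25) j \<and> (\<forall>c. c \<noteq> 14 \<longrightarrow> c \<noteq> 18 \<longrightarrow> t c = s c)" for j t
  let ?s = "exec (Asg 18 (N 0) e) s"
  have "Inv K (exec (For 14 5 (Asg 18 (N 0) (Plus (Plus (V 18) (Sum 44 6 (V 18))) (Rd 25 (V 14))))) ?s)"
  proof (rule For_inv[where Inv = Inv])
    show "?s 5 0 = K" "Inv 0 ?s"
      using assms by (simp_all add: Inv_def envD)
    show "Inv (Suc i) (exec (Asg 18 (N 0) (Plus (Plus (V 18) (Sum 44 6 (V 18))) (Rd 25 (V 14)))) (put 14 i t))"
      if "Inv i t" for i t
      using that assms by (simp add: Inv_def put_apply envD)
  qed
  then show "exec (cCode e) s 18 0 = code L st (s 25) K"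
    and "\<And>c. c \<noteq> 14 \<Longrightarrow> c \<noteq> 18 \<Longrightarrow> exec (cCode e) s c = s c"
    by (simp_all add: cCode_def Inv_def del: exec.simps(5))
qed

text \<open>\<open>C\<close> stands for the representatives before the merge, \<open>P2\<close> for
  the labelling after it, and \<open>X\<close> for the start shared by the walks of all pattern
  vertices \<open>p\<close>.\<close>

primrec walk :: "(nat \<Rightarrow> nat) \<Rightarrow> (nat \<Rightarrow> nat) \<Rightarrow> nat \<Rightarrow> nat \<Rightarrow> nat \<Rightarrow> nat \<Rightarrow> nat" where
  "walk C P2 X z p 0 = X"
| "walk C P2 X z p (Suc j) = nbr C P2 (walk C P2 X z p j) (digit Q z (p * (W + 2) + j))"

definition dec_state :: "(nat \<Rightarrow> nat) \<Rightarrow> (nat \<Rightarrow> nat) \<Rightarrow> nat \<Rightarrow> nat \<Rightarrow> nat \<Rightarrow> nat" where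
  "dec_state C P2 X z p = (if digit Q z (p * (W + 2) + W) = 0 then 0 else Suc (walk C P2 X z p W))"

definition dec_label :: "nat \<Rightarrow> nat \<Rightarrow> nat" where
  "dec_label z p = digit Q z (p * (W + 2) + (W + 1))"

lemma digit_index: "p < K \<Longrightarrow> j < W + 2 \<Longrightarrow> p * (W + 2) + j < D"
  unfolding D_def by (rule block_less)

lemma aval_eDigit:
  assumes "env s" "a_below 44 j" "s 16 0 < H" "s 14 0 < K" "aval j s < W + 2"
  shows "aval (eDigit j) s = digit Q (s 16 0) (s 14 0 * (W + 2) + aval j s)"
proof -
  define e where "e = Plus (Plus (Sum 44 10 (V 14)) (Plus (V 14) (V 14))) j"
  have e: "aval e s = s 14 0 * (W + 2) + aval j s"
    using assms(1) by (simp add: e_def put_apply envD)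
  moreover have "s 14 0 * (W + 2) + aval j s < D"
    using assms by (intro digit_index)
  moreover have "a_below 46 e"
    using a_below_mono[OF assms(2), of 46] by (simp add: e_def)
  ultimately show ?thesis
    using aval_eDig[OF assms(1) _ assms(3), of e] unfolding eDigit_def e_def[symmetric] by metis
qed

text \<open>As \<open>select\<close> falls back on \<open>0\<close>, every number \<open>z\<close>
  decodes to lines, and meaningless ones need not be sorted out.\<close>

lemma walk_less: "X < L \<Longrightarrow> walk C P2 X z p j < L"
  using select_less[of L] L_pos by (cases j) (simp_all add: nbr_def)

lemma exec_cDecode:
  assumes s: "env s" "s 16 0 < H"
  shows "\<And>p. p < K \<Longrightarrow> exec cDecode s 23 p = dec_state (s 21) (s 22) (s 13 0) (s 16 0) p"
    and "\<And>p. p < K \<Longrightarrow> exec cDecode s 24 p = dec_label (s 16 0) p"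
    and "\<And>c. c \<notin> {14, 15, 17, 23, 24} \<Longrightarrow> exec cDecode s c = s c"
proof -
  let ?A = "{14, 15, 17, 23, 24} :: nat set"
  define Inv where "Inv j t \<longleftrightarrow> (\<forall>p<j. t 23 p = dec_state (s 21) (s 22) (s 13 0) (s 16 0) p \<and>
      t 24 p = dec_label (s 16 0) p) \<and> (\<forall>c. c \<notin> ?A \<longrightarrow> t c = s c)" for j t
  have *: "env t \<and> t 16 0 < H" if "\<forall>c. c \<notin> ?A \<longrightarrow> t c = s c" for t
  proof -
    have "env t = env s"
      by (rule env_cong) (use that in auto)
    with s that show ?thesis
      by simp
  qed
  have W: "s 10 0 = W"
    using s by (simp add: envD)
  have "Inv K (exec cDecode s)"
    unfolding cDecode_def
  proof (rule For_inv[where Inv = Inv])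
    show "s 5 0 = K" "Inv 0 s"
      using s by (simp_all add: Inv_def envD)
    fix p t assume p: "p < K" and t: "Inv p t"
    define t1 where "t1 = exec (Asg 17 (N 0) (V 13)) (put 14 p t)"
    define I where "I j u \<longleftrightarrow> u 17 0 = walk (s 21) (s 22) (s 13 0) (s 16 0) p j \<and>
       (\<forall>c. c \<noteq> 15 \<longrightarrow> c \<noteq> 17 \<longrightarrow> u c = t1 c)" for j u
    have t1: "\<forall>c. c \<notin> ?A \<longrightarrow> t1 c = s c" "t1 14 0 = p" "t1 23 = t 23" "t1 24 = t 24"
      using t by (auto simp: t1_def Inv_def put_apply)
    have "I W (exec (For 15 10 (Asg 17 (N 0) (eNbr (V 17) (eDigit (V 15))))) t1)"
    proof (rule For_inv[where Inv = I])
      show "t1 10 0 = W"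
        using t1(1) s by (simp add: envD)
      show "I 0 t1"
        using t by (simp add: I_def t1_def Inv_def put_apply)
      fix j u assume j: "j < W" and u: "I j u"
      define v where "v = put 15 j u"
      have v: "\<forall>c. c \<notin> ?A \<longrightarrow> v c = s c" "v 15 0 = j" "v 14 0 = p" "v 17 0 = walk (s 21) (s 22) (s 13 0) (s 16 0) p j"
        "\<forall>c. c \<noteq> 15 \<longrightarrow> c \<noteq> 17 \<longrightarrow> v c = t1 c"
        using u t1 by (auto simp: I_def v_def put_apply)
      note e = *[OF v(1)]
      have "aval (eDigit (V 15)) v = digit Q (s 16 0) (p * (W + 2) + j)"
        using e v p j by (subst aval_eDigit) auto
      moreover have "a_below 51 (eDigit (V 15))"
        by (simp add: eDigit_def eDig_def eDiv_def abbrev_defs)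
      ultimately have "aval (eNbr (V 17) (eDigit (V 15))) v = walk (s 21) (s 22) (s 13 0) (s 16 0) p (Suc j)"
        using e v by simp
      then have "I (Suc j) (exec (Asg 17 (N 0) (eNbr (V 17) (eDigit (V 15)))) v)"
        using v by (simp add: I_def)
      then show "I (Suc j) (exec (Asg 17 (N 0) (eNbr (V 17) (eDigit (V 15)))) (put 15 j u))"
        by (simp add: v_def)
    qed
    then obtain t2 where t2: "I W t2" "exec (For 15 10 (Asg 17 (N 0) (eNbr (V 17) (eDigit (V 15))))) t1 = t2"
      by blast
    have frame: "\<forall>c. c \<notin> ?A \<longrightarrow> t2 c = s c"
      using t2 t1 by (auto simp: I_def)
    note e2 = *[OF frame]
    have t2_eqs: "t2 10 0 = W" "t2 14 0 = p" "t2 16 0 = s 16 0" "t2 17 0 = walk (s 21) (s 22) (s 13 0) (s 16 0) p W"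
      using frame W t2(1) t1 by (simp_all add: I_def)
    have d1: "aval (eDigit (V 10)) t2 = digit Q (s 16 0) (p * (W + 2) + W)"
      using aval_eDigit[of t2 "V 10"] e2 t2_eqs p s by simp
    define t3 where "t3 = exec (Asg 23 (V 14) (Ite (eDigit (V 10)) (Plus (V 17) (N 1)) (N 0))) t2"
    have frame3: "\<forall>c. c \<notin> ?A \<longrightarrow> t3 c = s c"
      using frame by (auto simp: t3_def)
    note e3 = *[OF frame3]
    have t3_eqs: "t3 10 0 = W" "t3 14 0 = p" "t3 16 0 = s 16 0"
      "t3 23 = (t2 23)(p := dec_state (s 21) (s 22) (s 13 0) (s 16 0) p)" "t3 24 = t2 24"
      using frame3 W t2_eqs d1 by (simp_all add: t3_def dec_state_def)
    have d2: "aval (eDigit (Plus (V 10) (N 1))) t3 = dec_label (s 16 0) p"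
      using aval_eDigit[of t3 "Plus (V 10) (N 1)"] e3 t3_eqs p s by (simp add: dec_label_def)
    define t4 where "t4 = exec (Asg 24 (V 14) (eDigit (Plus (V 10) (N 1)))) t3"
    have t4: "t4 23 = (t 23)(p := dec_state (s 21) (s 22) (s 13 0) (s 16 0) p)"
      "t4 24 = (t 24)(p := dec_label (s 16 0) p)" "\<forall>c. c \<notin> ?A \<longrightarrow> t4 c = s c"
      using d2 t3_eqs frame3 t1 t2(1) by (simp_all add: t4_def I_def)
    have "Inv (Suc p) t4"
      using t t4 by (simp add: Inv_def less_Suc_eq)
    moreover have "t4 = exec (Sq (Asg 17 (N 0) (V 13)) (Sq (For 15 10 (Asg 17 (N 0) (eNbr (V 17) (eDigit (V 15)))))
      (Sq (Asg 23 (V 14) (Ite (eDigit (V 10)) (Plus (V 17) (N 1)) (N 0)))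
         (Asg 24 (V 14) (eDigit (Plus (V 10) (N 1))))))) (put 14 p t)"
      by (simp only: exec.simps(3) t1_def[symmetric] t2(2) t3_def[symmetric] t4_def[symmetric])
    ultimately show "Inv (Suc p) (exec (Sq (Asg 17 (N 0) (V 13)) (Sq (For 15 10 (Asg 17 (N 0) (eNbr (V 17) (eDigit (V 15)))))
      (Sq (Asg 23 (V 14) (Ite (eDigit (V 10)) (Plus (V 17) (N 1)) (N 0)))
         (Asg 24 (V 14) (eDigit (Plus (V 10) (N 1))))))) (put 14 p t))"
      by simp
  qed
  then show "\<And>p. p < K \<Longrightarrow> exec cDecode s 23 p = dec_state (s 21) (s 22) (s 13 0) (s 16 0) p"
    and "\<And>p. p < K \<Longrightarrow> exec cDecode s 24 p = dec_label (s 16 0) p"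
    and "\<And>c. c \<notin> ?A \<Longrightarrow> exec cDecode s c = s c"
    by (simp_all add: Inv_def)
qed

lemma present_cong: "(\<And>p. p < K \<Longrightarrow> ds p = ds' p) \<Longrightarrow> present ds = present ds'"
  by (auto simp: present_def)

lemma exec_cBlock:
  assumes s: "env s"
  shows "exec cBlock s 19 0 = of_bool (s 19 0 \<noteq> 0 \<and> (present (block (s 24) (s 28 0) (s 23)) \<longrightarrow>
      s 26 (code L (s 11 0) (block (s 24) (s 28 0) (s 23)) K) \<noteq> 0))"
    and "\<And>c. c \<notin> {14, 18, 19, 25} \<Longrightarrow> exec cBlock s c = s c"
proof -
  let ?b = "block (s 24) (s 28 0) (s 23)"
  define s1 where "s1 = exec (Fill 25 5 (Ite (Equal (Rd 24 (V 14)) (V 28)) (Rd 23 (V 14)) (N 0))) s"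
  define s2 where "s2 = exec (cCode (V 11)) s1"
  have *: "\<forall>i<K. \<forall>t. (\<forall>c. c \<noteq> 25 \<longrightarrow> c \<noteq> 14 \<longrightarrow> t c = s c) \<longrightarrow> t 14 0 = i \<longrightarrow>
      aval (Ite (Equal (Rd 24 (V 14)) (V 28)) (Rd 23 (V 14)) (N 0)) t = ?b i"
    by (simp add: block_def)
  have K: "s 5 0 = K"
    using s by (simp add: envD)
  have s1: "s1 25 = (\<lambda>i. if i < K then ?b i else s 25 i)" "\<And>c. c \<noteq> 25 \<Longrightarrow> c \<noteq> 14 \<Longrightarrow> s1 c = s c"
    unfolding s1_def using exec_Fill[OF K _ *] by simp_all
  have "env s1"
    using s env_cong[of s1 s] s1(2) by force
  have s2: "s2 18 0 = code L (s 11 0) (s1 25) K" "\<And>c. c \<noteq> 14 \<Longrightarrow> c \<noteq> 18 \<Longrightarrow> s2 c = s1 c"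
    unfolding s2_def using exec_cCode[OF \<open>env s1\<close>, of "V 11" "s 11 0"] s1(2) by simp_all
  have c: "code L (s 11 0) (s1 25) K = code L (s 11 0) ?b K"
    by (rule code_cong) (simp add: s1)
  have p: "(\<exists>i<K. 0 < s1 25 i) \<longleftrightarrow> present ?b"
    by (auto simp: s1 present_def)
  have K2: "s2 5 0 = K"
    using s2 s1 K by simp
  have eq: "exec cBlock s = exec (Asg 19 (N 0) (Conj (V 19) (Disj (Neg (Exists 45 5 (Rd 25 (V 45)))) (Rd 26 (V 18))))) s2"
    by (simp only: cBlock_def exec.simps(3) s1_def s2_def)
  show "exec cBlock s 19 0 = of_bool (s 19 0 \<noteq> 0 \<and> (present ?b \<longrightarrow> s 26 (code L (s 11 0) ?b K) \<noteq> 0))"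
    unfolding eq using s2 s1(2) c p K2 by (auto simp: put_apply)
  show "exec cBlock s c = s c" if "c \<notin> {14, 18, 19, 25}" for c
    unfolding eq using s2 s1(2) that by simp
qed

lemma exec_blocks:
  assumes s: "env s"
  shows "exec (For 28 8 cBlock) s 19 0 \<noteq> 0 \<longleftrightarrow> s 19 0 \<noteq> 0 \<and> (\<forall>l<Q. present (block (s 24) l (s 23)) \<longrightarrow>
      s 26 (code L (s 11 0) (block (s 24) l (s 23)) K) \<noteq> 0)"
    and "\<And>c. c \<notin> {14, 18, 19, 25, 28} \<Longrightarrow> exec (For 28 8 cBlock) s c = s c"
proof -
  define Inv where "Inv j t \<longleftrightarrow> (t 19 0 \<noteq> 0 \<longleftrightarrow> s 19 0 \<noteq> 0 \<and> (\<forall>l<j. present (block (s 24) l (s 23)) \<longrightarrow>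
      s 26 (code L (s 11 0) (block (s 24) l (s 23)) K) \<noteq> 0)) \<and> (\<forall>c. c \<notin> {14, 18, 19, 25, 28} \<longrightarrow> t c = s c)" for j t
  have "Inv Q (exec (For 28 8 cBlock) s)"
  proof (rule For_inv[where Inv = Inv])
    show "s 8 0 = Q" "Inv 0 s"
      using s by (simp_all add: Inv_def envD)
    fix l t assume l: "l < Q" and t: "Inv l t"
    define u where "u = put 28 l t"
    have u: "u 28 0 = l" "u 19 = t 19" "\<And>c. c \<notin> {14, 18, 19, 25, 28} \<Longrightarrow> u c = s c"
      using t by (auto simp: u_def put_apply Inv_def)
    have "env u = env s"
      by (rule env_cong) (use u(3) in auto)
    with s have "env u"
      by simp
    note b = exec_cBlock[OF this]
    have "Inv (Suc l) (exec cBlock u)"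
      using t b u by (auto simp: Inv_def less_Suc_eq)
    then show "Inv (Suc l) (exec cBlock (put 28 l t))"
      by (simp add: u_def)
  qed
  then show "exec (For 28 8 cBlock) s 19 0 \<noteq> 0 \<longleftrightarrow> s 19 0 \<noteq> 0 \<and> (\<forall>l<Q. present (block (s 24) l (s 23)) \<longrightarrow>
      s 26 (code L (s 11 0) (block (s 24) l (s 23)) K) \<noteq> 0)"
    and "\<And>c. c \<notin> {14, 18, 19, 25, 28} \<Longrightarrow> exec (For 28 8 cBlock) s c = s c"
    unfolding Inv_def by blast+
qed

lemma aval_eCross:
  assumes "env s"
  shows "aval eCross s = of_bool (\<forall>p<K. \<forall>q<K. s 23 p \<noteq> 0 \<and> s 23 q \<noteq> 0 \<and> s 24 p \<noteq> s 24 q \<longrightarrow>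
     \<not> red (s 20) (s 23 p - 1) (s 23 q - 1) \<and> ok (s 23 p - 1) (s 23 q - 1) p q)"
  using assms by (auto simp: eCross_def put_apply envD)

lemma splits_cong:
  assumes "\<And>p. p < K \<Longrightarrow> lab p = lab' p" "\<And>p. p < K \<Longrightarrow> ds p = ds' p"
    and T: "\<And>f g. (\<And>p. p < K \<Longrightarrow> f p = g p) \<Longrightarrow> T f = T g"
  shows "splits P T q lab ds = splits P T q lab' ds'"
proof -
  have b: "block lab l ds p = block lab' l ds' p" if "p < K" for l p
    using assms that by (simp add: block_def)
  have "present (block lab l ds) = present (block lab' l ds')" "T (block lab l ds) = T (block lab' l ds')" for l
    by (rule present_cong T, simp add: b)+
  then show ?thesis
    unfolding splits_def using assms(1,2) by simp
qed

lemma exec_cTry: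
  assumes s: "env s" "s 16 0 < H" "s 13 0 < L"
  defines "ds \<equiv> dec_state (s 21) (s 22) (s 13 0) (s 16 0)"
  shows "exec cTry s 26 = (if splits (s 20) (\<lambda>ds. s 26 (code L (s 11 0) ds K) \<noteq> 0) Q (dec_label (s 16 0)) ds
      then (s 26)(code L (Suc (s 11 0)) (push (s 22) ds) K := 1) else s 26)"
    and "\<And>c. c \<notin> {14, 15, 17, 18, 19, 23, 24, 25, 26, 28} \<Longrightarrow> exec cTry s c = s c"
proof -
  let ?A = "{14, 15, 17, 18, 19, 23, 24, 25, 28} :: nat set"
  let ?e = "Ite (Rd 23 (V 14)) (Plus (N 1) (eCls 22 (Minus (Rd 23 (V 14)) (N 1)))) (N 0)"
  have env: "env t" if "\<And>c. c \<notin> ?A \<Longrightarrow> t c = s c" for t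
  proof -
    have "env t = env s"
      by (rule env_cong) (use that in auto)
    with s show ?thesis
      by simp
  qed
  define s1 where "s1 = exec cDecode s"
  have s1: "\<And>p. p < K \<Longrightarrow> s1 23 p = ds p" "\<And>p. p < K \<Longrightarrow> s1 24 p = dec_label (s 16 0) p"
    "\<And>c. c \<notin> {14, 15, 17, 23, 24} \<Longrightarrow> s1 c = s c"
    using exec_cDecode[OF s(1,2)] by (simp_all add: s1_def ds_def)
  have e1: "env s1"
    using s1(3) by (intro env) simp
  define s2 where "s2 = exec (Asg 19 (N 0) eCross) s1"
  have s2: "s2 19 0 = aval eCross s1" "\<And>c. c \<noteq> 19 \<Longrightarrow> s2 c = s1 c"
    by (simp_all add: s2_def)
  have e2: "env s2"
    using s1(3) s2(2) by (intro env) simp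
  define s3 where "s3 = exec (For 28 8 cBlock) s2"
  have s3: "s3 19 0 \<noteq> 0 \<longleftrightarrow> s2 19 0 \<noteq> 0 \<and> (\<forall>l<Q. present (block (s2 24) l (s2 23)) \<longrightarrow>
      s2 26 (code L (s2 11 0) (block (s2 24) l (s2 23)) K) \<noteq> 0)"
    "\<And>c. c \<notin> {14, 18, 19, 25, 28} \<Longrightarrow> s3 c = s2 c"
    unfolding s3_def by (fact exec_blocks[OF e2])+
  have e3: "env s3"
    using s1(3) s2(2) s3(2) by (intro env) simp
  have *: "\<forall>i<K. \<forall>t. (\<forall>c. c \<noteq> 25 \<longrightarrow> c \<noteq> 14 \<longrightarrow> t c = s3 c) \<longrightarrow> t 14 0 = i \<longrightarrow> aval ?e t = push (s 22) ds i"
  proof (intro allI impI)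
    fix i t assume i: "i < K" and t: "\<forall>c. c \<noteq> 25 \<longrightarrow> c \<noteq> 14 \<longrightarrow> t c = s3 c" "t 14 0 = i"
    have "env t"
      using s1(3) s2(2) s3(2) t(1) by (intro env) simp
    moreover have "t 23 i = ds i" "t 22 = s 22"
      using s1 s2(2) s3(2) t i by simp_all
    \<comment> \<open>The class is computed correctly for lines only. For an absent vertex,
      \<open>0 - 1 = 0\<close> is a line, too.\<close>
    moreover have "ds i - 1 < L"
      using walk_less[OF s(3)] L_pos by (simp add: ds_def dec_state_def)
    ultimately show "aval ?e t = push (s 22) ds i"
      using t(2) by (simp add: push_def)
  qed
  define s4 where "s4 = exec (Fill 25 5 ?e) s3"
  have K: "s3 5 0 = K"
    using e3 by (simp add: envD)
  have s4: "s4 25 = (\<lambda>i. if i < K then push (s 22) ds i else s3 25 i)" "\<And>c. c \<noteq> 25 \<Longrightarrow> c \<noteq> 14 \<Longrightarrow> s4 c = s3 c"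
    unfolding s4_def using exec_Fill[OF K _ *] by simp_all
  have e4: "env s4"
    using s1(3) s2(2) s3(2) s4(2) by (intro env) simp
  define s5 where "s5 = exec (cCode (Plus (V 11) (N 1))) s4"
  have "s4 11 = s 11"
    using s1(3) s2(2) s3(2) s4(2) by simp
  then have s5: "s5 18 0 = code L (Suc (s 11 0)) (s4 25) K" "\<And>c. c \<noteq> 14 \<Longrightarrow> c \<noteq> 18 \<Longrightarrow> s5 c = s4 c"
    unfolding s5_def using exec_cCode[OF e4, of "Plus (V 11) (N 1)" "Suc (s 11 0)"] by simp_all
  have code: "code L (Suc (s 11 0)) (s4 25) K = code L (Suc (s 11 0)) (push (s 22) ds) K"
    by (rule code_cong) (simp add: s4)
  have flag: "s5 19 0 \<noteq> 0 \<longleftrightarrow> splits (s 20) (\<lambda>ds. s 26 (code L (s 11 0) ds K) \<noteq> 0) Q (dec_label (s 16 0)) ds"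
  proof -
    have eqs: "s5 19 = s3 19" "s2 24 = s1 24" "s2 23 = s1 23" "s2 26 = s 26" "s2 11 = s 11" "s1 20 = s 20"
      using s1(3) s2(2) s3(2) s4(2) s5(2) by simp_all
    let ?T = "\<lambda>ds. s 26 (code L (s 11 0) ds K) \<noteq> 0"
    have "s5 19 0 \<noteq> 0 \<longleftrightarrow> splits (s 20) ?T Q (s1 24) (s1 23)"
      unfolding eqs(1) s3(1) s2(1) aval_eCross[OF e1] eqs(2-) splits_def of_bool_eq_0_iff by blast
    also have "\<dots> = splits (s 20) ?T Q (dec_label (s 16 0)) ds"
    proof (rule splits_cong)
      show "?T f = ?T g" if "\<And>p. p < K \<Longrightarrow> f p = g p" for f g
        using code_cong[of K f g L "s 11 0"] that by simp
    qed (simp_all add: s1)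
    finally show ?thesis .
  qed
  have eq: "exec cTry s = exec (If (V 19) (Asg 26 (V 18) (N 1)) Nop) s5"
    by (simp only: cTry_def exec.simps(3) s1_def s2_def s3_def s4_def s5_def)
  have "s5 26 = s 26"
    using s1(3) s2(2) s3(2) s4(2) s5(2) by simp
  then show "exec cTry s 26 = (if splits (s 20) (\<lambda>ds. s 26 (code L (s 11 0) ds K) \<noteq> 0) Q (dec_label (s 16 0)) ds
      then (s 26)(code L (Suc (s 11 0)) (push (s 22) ds) K := 1) else s 26)"
    unfolding eq using s5(1) flag code by simp
  show "exec cTry s c = s c" if "c \<notin> {14, 15, 17, 18, 19, 23, 24, 25, 26, 28}" for c
    unfolding eq using s1(3) s2(2) s3(2) s4(2) s5(2) that by simp
qed

section \<open>Soundness and completeness of the table\<close>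

lemma feasible_cong: "(\<And>p. p < K \<Longrightarrow> ds p = ds' p) \<Longrightarrow> feasible P ds = feasible P ds'"
  by (simp add: feasible_def)

text \<open>Connectedness is demanded in completeness only: feasible states that are not connected
  may be entered as well and do no harm.\<close>

definition sound_at :: "nat \<Rightarrow> (nat \<Rightarrow> nat) \<Rightarrow> (nat \<Rightarrow> nat) \<Rightarrow> bool" where
  "sound_at st P T \<longleftrightarrow> (\<forall>ds. (\<forall>p<K. ds p \<le> L) \<and> T (code L st ds K) \<noteq> 0 \<longrightarrow> feasible P ds)"

definition complete_at :: "nat \<Rightarrow> (nat \<Rightarrow> nat) \<Rightarrow> (nat \<Rightarrow> nat) \<Rightarrow> bool" where
  "complete_at st P T \<longleftrightarrow> (\<forall>ds. (\<forall>p<K. ds p \<le> L) \<and> present ds \<and> red_connected P ds \<and> feasible P ds \<longrightarrow>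
     T (code L st ds K) \<noteq> 0)"

text \<open>Ensures that an entry found under the next stage number was derived in the current
  stage.\<close>

definition empty_above :: "nat \<Rightarrow> (nat \<Rightarrow> nat) \<Rightarrow> bool" where
  "empty_above st T \<longleftrightarrow> (\<forall>st' ds. st < st' \<and> (\<forall>p<K. ds p \<le> L) \<longrightarrow> T (code L st' ds K) = 0)"

lemma splits_mono:
  assumes "splits P T q lab ds" and "\<And>l. T (block lab l ds) \<Longrightarrow> present (block lab l ds) \<Longrightarrow> T' (block lab l ds)"
  shows "splits P T' q lab ds"
  using assms unfolding splits_def by blast

lemma dec_state_le: "X < L \<Longrightarrow> dec_state C P2 X z p \<le> L"
  using walk_less[of X C P2 z p W] by (simp add: dec_state_def)

lemma push_le:
  assumes "ds p \<le> L"
  shows "push P2 ds p \<le> L"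
  using cls_le[of P2 "ds p - 1"] assms by (auto simp: push_def)

lemma block_le: "ds p \<le> L \<Longrightarrow> block lab l ds p \<le> L"
  by (simp add: block_def)

definition derived :: "nat \<Rightarrow> (nat \<Rightarrow> nat) \<Rightarrow> (nat \<Rightarrow> nat) \<Rightarrow> (nat \<Rightarrow> nat) \<Rightarrow> (nat \<Rightarrow> nat) \<Rightarrow> nat \<Rightarrow> nat \<Rightarrow> nat \<Rightarrow> bool" where
  "derived st P C P2 T X z c \<longleftrightarrow>
     splits P (\<lambda>ds. T (code L st ds K) \<noteq> 0) Q (dec_label z) (dec_state C P2 X z) \<and>
     c = code L (Suc st) (push P2 (dec_state C P2 X z)) K"

text \<open>By injectivity of codes a new entry belongs to one derived state. The pieces of this
  state are feasible, and glueing and coarsening preserve feasibility.\<close>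

lemma sound_step:
  assumes P: "interval_partition P" and co: "coarser P P2" and so: "sound_at st P T"
    and em: "empty_above st T"
    and T': "\<And>c. T' c \<noteq> 0 \<longleftrightarrow> T c \<noteq> 0 \<or> (\<exists>X<L. \<exists>z<H. derived st P C P2 T X z c)"
  shows "sound_at (Suc st) P2 T'"
  unfolding sound_at_def
proof (intro allI impI, elim conjE)
  fix ds assume ds: "\<forall>p<K. ds p \<le> L" "T' (code L (Suc st) ds K) \<noteq> 0"
  moreover have "T (code L (Suc st) ds K) = 0"
    using em ds(1) by (simp add: empty_above_def)
  ultimately obtain X z where X: "X < L" and der: "derived st P C P2 T X z (code L (Suc st) ds K)"
    using T' by blast
  define ds1 where "ds1 = dec_state C P2 X z"
  have le: "ds1 p \<le> L" for p
    unfolding ds1_def by (rule dec_state_le[OF X])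
  have sp: "splits P (\<lambda>ds. T (code L st ds K) \<noteq> 0) Q (dec_label z) ds1"
    and c: "code L (Suc st) ds K = code L (Suc st) (push P2 ds1) K"
    using der by (simp_all add: derived_def ds1_def)
  have "splits P (\<lambda>ds. (\<forall>p<K. ds p \<le> L) \<and> T (code L st ds K) \<noteq> 0) Q (dec_label z) ds1"
    by (rule splits_mono[OF sp]) (simp add: block_le le)
  then have "feasible P ds1"
  proof (rule feasible_glue[OF P, rotated])
    show "dec_label z p < Q" for p
      using Q_pos by (simp add: dec_label_def digit_def)
    show "feasible P ds" if "(\<forall>p<K. ds p \<le> L) \<and> T (code L st ds K) \<noteq> 0" for ds
      using so that unfolding sound_at_def by blast
  qed
  then have "feasible P2 (push P2 ds1)"
    by (rule feasible_push[OF co])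
  moreover have "\<forall>p<K. ds p = push P2 ds1 p"
    using code_inject[OF c] ds(1) push_le le by blast
  ultimately show "feasible P2 ds"
    using feasible_cong[of ds "push P2 ds1"] by simp
qed

text \<open>Every step of a walk is given by the rank of the next vertex among the red neighbours,
  which is below \<open>Q\<close>; labels are below \<open>K\<close> and hence are digits,
  too.\<close>

lemma walk_exists:
  assumes good: "good_partition d P" "good_partition d P2" and C: "\<And>x. x < L \<Longrightarrow> C x = cls P x"
    and near: "\<And>y. y < L \<Longrightarrow> P y = P2 y \<or> P y = Suc (P2 y)"
    and lab: "\<And>p. p < K \<Longrightarrow> lab p < K"
    and w: "\<And>p. p < K \<Longrightarrow> ds p \<noteq> 0 \<Longrightarrow> red_walk P P2 W (w p) \<and> w p 0 = X \<and> Suc (w p W) = ds p"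
  shows "\<exists>z<H. \<forall>p<K. dec_label z p = lab p \<and> dec_state C P2 X z p = ds p"
proof -
  define pr where "pr x y \<longleftrightarrow> C y = y \<and> red P2 x y" for x y
  define rank where "rank x y = card {y'. y' < L \<and> y' < y \<and> pr x y'}" for x y
  \<comment> \<open>Absent vertices get the digits \<open>0\<close> for their steps; their walks are
    decoded, but the presence digit discards the result.\<close>
  define g where "g p j = (if j < W then (if ds p = 0 then 0 else rank (w p j) (w p (Suc j)))
     else if j = W then (if ds p = 0 then 0 else 1) else lab p)" for p j
  have step: "nbr C P2 (w p j) (rank (w p j) (w p (Suc j))) = w p (Suc j)"
    "rank (w p j) (w p (Suc j)) < Q" if p: "p < K" "ds p \<noteq> 0" "j < W" for p j
  proof -
    let ?x = "w p j" and ?y = "w p (Suc j)"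
    have xy: "?x < L" "?y < L" "cls P ?y = ?y" "red P2 ?x ?y"
      using w[OF p(1,2)] p(3) by (simp_all add: red_walk_def)
    then have y: "pr ?x ?y"
      using C by (simp add: pr_def)
    note r = select_rank[where p = "pr (w p j)", OF y xy(2)]
    show "nbr C P2 ?x (rank ?x ?y) = ?y"
      unfolding nbr_def rank_def using r(1) unfolding pr_def .
    have "rank ?x ?y < card {y'. y' < L \<and> pr ?x y'}"
      unfolding rank_def by (rule r(2))
    also have "{y'. y' < L \<and> pr ?x y'} = red_nbrs P P2 ?x"
      using C by (auto simp: pr_def red_nbrs_def)
    also have "card \<dots> \<le> 2 * (d + 1) * 2 ^ d"
      by (rule card_red_nbrs[OF good xy(1) near])
    finally show "rank ?x ?y < Q"
      using Q_ge by linarith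
  qed
  have "g p j < Q" if "p < K" for p j
    using step(2)[of p j] that Q_pos lab[OF that] by (auto simp: g_def)
  moreover have "i div (W + 2) < K" if "i < D" for i
    using that by (simp add: D_def less_mult_imp_div_less)
  ultimately have "\<exists>z<Q ^ D. \<forall>i<D. digit Q z i = g (i div (W + 2)) (i mod (W + 2))"
    by (intro exists_digits) blast
  then obtain z where z: "z < H" "\<And>i. i < D \<Longrightarrow> digit Q z i = g (i div (W + 2)) (i mod (W + 2))"
    unfolding H_def by blast
  have dig: "digit Q z (p * (W + 2) + j) = g p j" if "p < K" "j < W + 2" for p j
  proof -
    have "(p * (W + 2) + j) div (W + 2) = p" "(p * (W + 2) + j) mod (W + 2) = j"
      using that(2) by (simp_all only: div_mult_self3 mod_mult_self3 mod_less div_less)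
    then show ?thesis
      using z(2)[OF digit_index[OF that]] by simp
  qed
  have "walk C P2 X z p j = w p j" if p: "p < K" "ds p \<noteq> 0" and "j \<le> W" for p j
    using \<open>j \<le> W\<close>
  proof (induction j)
    case 0
    then show ?case
      using w[OF p] by simp
  next
    case (Suc j)
    have "walk C P2 X z p (Suc j) = nbr C P2 (w p j) (g p j)"
      using Suc dig[OF p(1), of j] by simp
    also have "\<dots> = w p (Suc j)"
      using step(1)[OF p, of j] Suc.prems p(2) by (simp add: g_def)
    finally show ?case .
  qed
  then have "dec_state C P2 X z p = ds p" if "p < K" for p
    using dig[OF that, of W] w[OF that] that by (simp add: dec_state_def g_def)
  moreover have "dec_label z p = lab p" if "p < K" for p
    using dig[OF that, of "W + 1"] by (simp add: dec_label_def g_def)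
  ultimately show ?thesis
    using z(1) by blast
qed

text \<open>Splitting produces pieces that are in the table by assumption, and the walks produce a
  number \<open>z\<close> under which the program tries exactly this way of breaking up the
  state.\<close>

lemma complete_step:
  assumes good: "good_partition d P" "good_partition d P2" and C: "\<And>x. x < L \<Longrightarrow> C x = cls P x"
    and near: "\<And>y. y < L \<Longrightarrow> P y = P2 y \<or> P y = Suc (P2 y)" and co: "coarser P P2"
    and com: "complete_at st P T"
    and T': "\<And>c. T' c \<noteq> 0 \<longleftrightarrow> T c \<noteq> 0 \<or> (\<exists>X<L. \<exists>z<H. derived st P C P2 T X z c)"
  shows "complete_at (Suc st) P2 T'"
  unfolding complete_at_def
proof (intro allI impI, elim conjE)
  fix ds2 assume ds2: "\<forall>p<K. ds2 p \<le> L" "present ds2" "red_connected P2 ds2" "feasible P2 ds2"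
  have P: "interval_partition P" and KQ: "K \<le> Q"
    using good(1) Q_pos by (simp_all add: good_partition_def)
  from feasible_split[OF P co ds2(4,3,2) KQ] obtain ds lab X where
    lab: "\<forall>p<K. lab p < K" and push: "\<forall>p<K. push P2 ds p = ds2 p" and le: "\<forall>p<K. ds p \<le> L" and
    sp: "splits P (\<lambda>ds. feasible P ds \<and> red_connected P ds) Q lab ds" and X: "X < L" and
    walks: "\<forall>p<K. ds p \<noteq> 0 \<longrightarrow> (\<exists>w. red_walk P P2 W w \<and> w 0 = X \<and> Suc (w W) = ds p)"
    unfolding W_def by blast
  obtain w where w: "\<And>p. p < K \<Longrightarrow> ds p \<noteq> 0 \<Longrightarrow> red_walk P P2 W (w p) \<and> w p 0 = X \<and> Suc (w p W) = ds p"
    using walks by metis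
  obtain z where z: "z < H" "\<And>p. p < K \<Longrightarrow> dec_label z p = lab p \<and> dec_state C P2 X z p = ds p"
    using walk_exists[OF good C near, of lab ds w X] lab w by blast
  have "splits P (\<lambda>ds. T (code L st ds K) \<noteq> 0) Q lab ds"
  proof (rule splits_mono[OF sp])
    fix l assume *: "feasible P (block lab l ds) \<and> red_connected P (block lab l ds)" "present (block lab l ds)"
    have "\<forall>p<K. block lab l ds p \<le> L"
      using le block_le by blast
    with * com show "T (code L st (block lab l ds) K) \<noteq> 0"
      unfolding complete_at_def by blast
  qed
  also have "splits P (\<lambda>ds. T (code L st ds K) \<noteq> 0) Q lab ds =
      splits P (\<lambda>ds. T (code L st ds K) \<noteq> 0) Q (dec_label z) (dec_state C P2 X z)"
  proof (rule splits_cong)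
    show "(T (code L st f K) \<noteq> 0) = (T (code L st g K) \<noteq> 0)" if "\<And>p. p < K \<Longrightarrow> f p = g p" for f g
      using code_cong[of K f g L st] that by simp
  qed (simp_all add: z)
  finally have "splits P (\<lambda>ds. T (code L st ds K) \<noteq> 0) Q (dec_label z) (dec_state C P2 X z)" .
  moreover have "code L (Suc st) ds2 K = code L (Suc st) (push P2 (dec_state C P2 X z)) K"
    by (rule code_cong) (use push z(2) in \<open>auto simp: push_def\<close>)
  ultimately have "derived st P C P2 T X z (code L (Suc st) ds2 K)"
    by (simp add: derived_def)
  then show "T' (code L (Suc st) ds2 K) \<noteq> 0"
    using T' X z(1) by blast
qed

lemma empty_step:
  assumes em: "empty_above st T"
    and T': "\<And>c. T' c \<noteq> 0 \<longleftrightarrow> T c \<noteq> 0 \<or> (\<exists>X<L. \<exists>z<H. derived st P C P2 T X z c)"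
  shows "empty_above (Suc st) T'"
  unfolding empty_above_def
proof (intro allI impI, elim conjE)
  fix st' ds assume st': "Suc st < st'" and ds: "\<forall>p<K. ds p \<le> L"
  have "\<not> derived st P C P2 T X z (code L st' ds K)" if "X < L" for X z
  proof
    assume "derived st P C P2 T X z (code L st' ds K)"
    then have "code L st' ds K = code L (Suc st) (push P2 (dec_state C P2 X z)) K"
      by (simp add: derived_def)
    from code_inject[OF this] ds push_le dec_state_le[OF that] have "st' = Suc st"
      by blast
    with st' show False
      by simp
  qed
  moreover have "T (code L st' ds K) = 0"
    using em st' ds by (simp add: empty_above_def)
  ultimately show "T' (code L st' ds K) = 0"
    using T' by blast
qed

text \<open>\<open>derived\<close> refers to the table at the beginning of the stage, although the
  program reads the current one.\<close>

definition tried :: "store \<Rightarrow> (nat \<times> nat) set \<Rightarrow> store \<Rightarrow> bool" where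
  "tried s A t \<longleftrightarrow> (\<forall>c. t 26 c \<noteq> 0 \<longleftrightarrow> s 26 c \<noteq> 0 \<or>
      (\<exists>(X, z)\<in>A. derived (s 11 0) (s 20) (s 21) (s 22) (s 26) X z c)) \<and>
    (\<forall>b. b \<notin> {13, 14, 15, 16, 17, 18, 19, 23, 24, 25, 26, 28} \<longrightarrow> t b = s b)"

text \<open>Entries made in this stage have the leading digit \<open>Suc (s 11 0)\<close>, whereas
  the tests read entries with the leading digit \<open>s 11 0\<close>. So former attempts do not
  influence this one.\<close>

lemma tried_cTry:
  assumes s: "env s" and t: "tried s A t" and A: "A \<subseteq> {..<L} \<times> UNIV"
    and X: "t 13 0 = X" "X < L" and z: "t 16 0 = z" "z < H"
  shows "tried s (insert (X, z) A) (exec cTry t)"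
proof -
  have fr: "t b = s b" if "b \<notin> {13, 14, 15, 16, 17, 18, 19, 23, 24, 25, 26, 28}" for b
    using t that unfolding tried_def by blast
  have "env t = env s"
    by (rule env_cong) (use fr in auto)
  with s have env: "env t"
    by simp
  let ?st = "s 11 0" and ?ds = "dec_state (s 21) (s 22) X z"
  have same: "t 26 (code L ?st ds K) \<noteq> 0 \<longleftrightarrow> s 26 (code L ?st ds K) \<noteq> 0" if ds: "\<forall>p<K. ds p \<le> L" for ds
  proof -
    have "\<not> derived ?st (s 20) (s 21) (s 22) (s 26) Y w (code L ?st ds K)" if "(Y, w) \<in> A" for Y w
    proof
      assume "derived ?st (s 20) (s 21) (s 22) (s 26) Y w (code L ?st ds K)"
      then have c: "code L ?st ds K = code L (Suc ?st) (push (s 22) (dec_state (s 21) (s 22) Y w)) K"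
        by (simp add: derived_def)
      have "Y < L"
        using A that by blast
      then have "?st = Suc ?st"
        using code_inject[OF c] ds push_le dec_state_le by blast
      then show False
        by simp
    qed
    then show ?thesis
      using t unfolding tried_def by blast
  qed
  have bl: "\<forall>p<K. block lab l ?ds p \<le> L" for lab l
    using block_le dec_state_le[OF X(2)] by blast
  have sp: "splits (s 20) (\<lambda>ds. t 26 (code L ?st ds K) \<noteq> 0) Q (dec_label z) ?ds \<longleftrightarrow>
      splits (s 20) (\<lambda>ds. s 26 (code L ?st ds K) \<noteq> 0) Q (dec_label z) ?ds"
    unfolding splits_def using same[OF bl] by simp
  have eqs: "t 11 = s 11" "t 20 = s 20" "t 21 = s 21" "t 22 = s 22"
    by (simp_all add: fr)
  have "t 16 0 < H" "t 13 0 < L"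
    using X z by simp_all
  note e = exec_cTry[OF env this, unfolded eqs X(1) z(1)]
  have "exec cTry t 26 c \<noteq> 0 \<longleftrightarrow> t 26 c \<noteq> 0 \<or> derived ?st (s 20) (s 21) (s 22) (s 26) X z c" for c
    unfolding e(1) sp by (auto simp: derived_def)
  moreover have "exec cTry t b = s b" if "b \<notin> {13, 14, 15, 16, 17, 18, 19, 23, 24, 25, 26, 28}" for b
    using e(2)[of b] fr[OF that] that by simp
  ultimately show ?thesis
    using t unfolding tried_def by auto
qed

lemma exec_tries:
  assumes s: "env s"
  shows "tried s ({..<L} \<times> {..<H}) (exec (For 13 6 (For 16 9 cTry)) s)"
proof -
  have L: "s 6 0 = L"
    using s by (simp add: envD)
  have put: "tried s A (put x i t)" if "tried s A t" "x = 13 \<or> x = 16" for A x i t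
    using that by (auto simp: tried_def put_apply)
  show ?thesis
  proof (rule For_inv[where Inv = "\<lambda>i t. tried s ({..<i} \<times> {..<H}) t"])
    show "s 6 0 = L"
      by (fact L)
    show "tried s ({..<0} \<times> {..<H}) s"
      by (simp add: tried_def)
    fix X t assume X: "X < L" and t: "tried s ({..<X} \<times> {..<H}) t"
    define u where "u = put 13 X t"
    define Inv where "Inv j v \<longleftrightarrow> tried s ({..<X} \<times> {..<H} \<union> {X} \<times> {..<j}) v \<and> v 13 0 = X" for j v
    have u: "tried s ({..<X} \<times> {..<H}) u" "u 13 0 = X"
      using put[OF t] by (simp_all add: u_def put_apply)
    have "Inv H (exec (For 16 9 cTry) u)"
    proof (rule For_inv[where Inv = Inv])
      have "u 9 = s 9"
        using u(1) by (simp add: tried_def)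
      then show "u 9 0 = H"
        using s by (simp add: envD)
      show "Inv 0 u"
        using u by (simp add: Inv_def)
      fix z v assume z: "z < H" and v: "Inv z v"
      define w where "w = put 16 z v"
      have w: "tried s ({..<X} \<times> {..<H} \<union> {X} \<times> {..<z}) w" "w 13 0 = X" "w 16 0 = z"
        using v put by (auto simp: w_def Inv_def put_apply)
      have "tried s (insert (X, z) ({..<X} \<times> {..<H} \<union> {X} \<times> {..<z})) (exec cTry w)"
        by (rule tried_cTry[OF s w(1) _ w(2) X w(3) z]) (use X in auto)
      also have "insert (X, z) ({..<X} \<times> {..<H} \<union> {X} \<times> {..<z}) = {..<X} \<times> {..<H} \<union> {X} \<times> {..<Suc z}"
        by auto
      finally have "tried s ({..<X} \<times> {..<H} \<union> {X} \<times> {..<Suc z}) (exec cTry w)" .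
      moreover have "exec cTry w 13 = w 13"
      proof -
        have "env w = env s"
          by (rule env_cong) (use w(1) in \<open>auto simp: tried_def\<close>)
        then show ?thesis
          using exec_cTry(2)[of w 13] s w X z by simp
      qed
      ultimately have "Inv (Suc z) (exec cTry w)"
        using w by (simp add: Inv_def)
      then show "Inv (Suc z) (exec cTry (put 16 z v))"
        by (simp add: w_def)
    qed
    moreover have "{..<X} \<times> {..<H} \<union> {X} \<times> {..<H} = {..<Suc X} \<times> {..<H}"
      by auto
    ultimately show "tried s ({..<Suc X} \<times> {..<H}) (exec (For 16 9 cTry) (put 13 X t))"
      by (simp add: Inv_def u_def)
  qed
qed

text \<open>The last conjunct is a measure: every merge lowers the label of the last line, which is
  \<open>L - 1\<close> at the start. The first alternative persists, as idle stages do not change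
  the partition.\<close>

definition stage_inv :: "nat \<Rightarrow> store \<Rightarrow> bool" where
  "stage_inv st s \<longleftrightarrow> env s \<and> good_partition d (s 20) \<and> (\<forall>x<L. s 21 x = cls (s 20) x) \<and>
     sound_at st (s 20) (s 26) \<and> complete_at st (s 20) (s 26) \<and> empty_above st (s 26) \<and>
     ((\<forall>v. \<not> mergeable d (s 20) v) \<or> s 20 (L - 1) + st \<le> L - 1)"

lemma mergeable_cong:
  assumes "\<And>x. x < L \<Longrightarrow> P x = P' x"
  shows "mergeable d P v = mergeable d P' v"
proof -
  have "cell P i j = cell P' i j" for i j
    by (simp add: cell_def assms cong: conj_cong)
  then show ?thesis
    unfolding mergeable_def using assms[of v] assms[of "Suc v"] by (cases "Suc v < L") simp_all
qed

lemma merged_partition: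
  assumes good: "good_partition d P" and v: "mergeable d P v \<or> v = L \<and> (\<forall>w. \<not> mergeable d P w)"
    and P2: "\<forall>x<L. P2 x = merge P v x"
  shows "good_partition d P2" and "coarser P P2" and "\<And>y. y < L \<Longrightarrow> P y = P2 y \<or> P y = Suc (P2 y)"
    and "(\<forall>w. \<not> mergeable d P w) \<or> P (L - 1) + st \<le> L - 1 \<Longrightarrow>
      (\<forall>w. \<not> mergeable d P2 w) \<or> P2 (L - 1) + Suc st \<le> L - 1"
proof -
  have L: "0 < L" "L - 1 < L"
    using L_pos by simp_all
  have "good_partition d P2 \<and> coarser P P2 \<and> (\<forall>y<L. P y = P2 y \<or> P y = Suc (P2 y)) \<and>
    ((\<forall>w. \<not> mergeable d P w) \<or> P (L - 1) + st \<le> L - 1 \<longrightarrow>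
      (\<forall>w. \<not> mergeable d P2 w) \<or> P2 (L - 1) + Suc st \<le> L - 1)"
    using v
  proof
    assume v: "mergeable d P v"
    have g: "good_partition d (merge P v)"
      by (rule good_partition_merge[OF good v])
    have eq: "merge P v x = P2 x" if "x < L" for x
      using P2 that by simp
    have "coarser P P2"
      using coarser_merge[OF good v] eq unfolding coarser_def by metis
    moreover have "P2 (L - 1) = P (L - 1) - 1" "0 < P (L - 1)"
      using merge_last[OF good v] P2 L(2) by simp_all
    ultimately show ?thesis
      using good_partition_cong(1)[OF g eq L(1)] merge_near[OF good v] eq v by auto
  next
    assume v: "v = L \<and> (\<forall>w. \<not> mergeable d P w)"
    then have eq: "P x = P2 x" if "x < L" for x
      using P2 that merge_none[OF that, of v P] by simp
    show ?thesis
      using good_partition_cong[OF good eq L(1)] eq v mergeable_cong[OF eq] by auto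
  qed
  then show "good_partition d P2" and "coarser P P2" and "\<And>y. y < L \<Longrightarrow> P y = P2 y \<or> P y = Suc (P2 y)"
    and "(\<forall>w. \<not> mergeable d P w) \<or> P (L - 1) + st \<le> L - 1 \<Longrightarrow>
      (\<forall>w. \<not> mergeable d P2 w) \<or> P2 (L - 1) + Suc st \<le> L - 1"
    by blast+
qed

lemma state_cong:
  assumes P: "\<forall>x<L. P x = P' x" and "x < L"
  shows "cls P x = cls P' x" and "y < L \<Longrightarrow> red P x y = red P' x y"
proof -
  have s: "sing P u = sing P' u" if "u < L" for u
    using P that by (auto simp: sing_def)
  have e: "eqv P z x = eqv P' z x" if "z < L" for z
    using assms that s by (auto simp: eqv_def)
  show "cls P x = cls P' x"
  proof (rule antisym)
    have "cls P x < L" "cls P' x < L"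
      using cls_le[of P x] cls_le[of P' x] assms(2) by simp_all
    then show "cls P x \<le> cls P' x" "cls P' x \<le> cls P x"
      using e eqv_cls[of P x] eqv_cls[of P' x] unfolding cls_def by (metis Least_le)+
  qed
  have "cell P i j = cell P' i j" for i j
    by (simp add: cell_def P cong: conj_cong)
  then show "red P x y = red P' x y" if "y < L"
    using assms s that by (simp add: red_def)
qed

text \<open>For connectedness, \<open>red\<close> is evaluated at the entries minus one; the bound
  \<open>ds p \<le> L\<close> makes these lines, on which the labellings agree.\<close>

lemma table_cong:
  assumes P: "\<forall>x<L. P x = P' x"
  shows "sound_at st P T = sound_at st P' T" and "complete_at st P T = complete_at st P' T"
proof -
  have f: "feasible P ds = feasible P' ds" for ds
    unfolding feasible_def using state_cong(1)[OF P] by (metis (no_types, opaque_lifting))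
  have r: "red_connected P ds = red_connected P' ds" if "\<forall>p<K. ds p \<le> L" for ds
  proof -
    have "red P (ds a - 1) (ds b - 1) = red P' (ds a - 1) (ds b - 1)"
      if ab: "a < K" "b < K" "ds a \<noteq> 0" "ds b \<noteq> 0" for a b
    proof -
      have "ds a \<le> L" "ds b \<le> L"
        using \<open>\<forall>p<K. ds p \<le> L\<close> ab by blast+
      with ab have "ds a - 1 < L" "ds b - 1 < L"
        by simp_all
      then show ?thesis
        by (rule state_cong(2)[OF P])
    qed
    then have "red_rel P ds = red_rel P' ds"
      unfolding red_rel_def by blast
    then show ?thesis
      by (simp add: red_connected_def)
  qed
  show "sound_at st P T = sound_at st P' T" "complete_at st P T = complete_at st P' T"
    unfolding sound_at_def complete_at_def using f r by metis+
qed

lemma exec_cStage: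
  assumes s: "stage_inv (s 11 0) s"
  shows "stage_inv (Suc (s 11 0)) (exec cStage s)"
proof -
  have s: "env s" "good_partition d (s 20)" "\<And>x. x < L \<Longrightarrow> s 21 x = cls (s 20) x" "sound_at (s 11 0) (s 20) (s 26)"
    "complete_at (s 11 0) (s 20) (s 26)" "empty_above (s 11 0) (s 26)"
    "(\<forall>v. \<not> mergeable d (s 20) v) \<or> s 20 (L - 1) + s 11 0 \<le> L - 1"
    using assms by (simp_all add: stage_inv_def)
  have env: "env t" if "\<And>c. c \<le> 10 \<or> c = 27 \<Longrightarrow> t c = s c" for t
    using env_cong[of t s] that s(1) by blast
  obtain v where v: "aval eFirst s = v" "mergeable d (s 20) v \<or> v = L \<and> (\<forall>w. \<not> mergeable d (s 20) w)"
    using merge_position[of "s 20"] aval_eFirst[OF s(1)] by auto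
  define s1 where "s1 = exec (Asg 12 (N 0) eFirst) s"
  have s1: "s1 12 0 = v" "\<And>c. c \<noteq> 12 \<Longrightarrow> s1 c = s c"
    by (simp_all add: s1_def v(1))
  define s2 where "s2 = exec (Fill 22 6 (Ite (Less (V 12) (V 14)) (Minus (Rd 20 (V 14)) (N 1)) (Rd 20 (V 14)))) s1"
  have L1: "s1 6 0 = L"
    using s1(2) s(1) by (simp add: envD)
  have *: "\<forall>i<L. \<forall>t. (\<forall>c. c \<noteq> 22 \<longrightarrow> c \<noteq> 14 \<longrightarrow> t c = s1 c) \<longrightarrow> t 14 0 = i \<longrightarrow>
      aval (Ite (Less (V 12) (V 14)) (Minus (Rd 20 (V 14)) (N 1)) (Rd 20 (V 14))) t = merge (s 20) v i"
    by (simp add: merge_def s1)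
  have s2: "s2 22 = (\<lambda>i. if i < L then merge (s 20) v i else s1 22 i)" "\<And>c. c \<noteq> 22 \<Longrightarrow> c \<noteq> 14 \<Longrightarrow> s2 c = s1 c"
    unfolding s2_def using exec_Fill[OF L1 _ *] by simp_all
  have e2: "env s2"
    by (rule env) (auto simp: s2(2) s1(2))
  define s3 where "s3 = exec (For 13 6 (For 16 9 cTry)) s2"
  have tr: "tried s2 ({..<L} \<times> {..<H}) s3"
    unfolding s3_def by (rule exec_tries[OF e2])
  then have s3: "\<And>b. b \<notin> {13, 14, 15, 16, 17, 18, 19, 23, 24, 25, 26, 28} \<Longrightarrow> s3 b = s2 b"
    unfolding tried_def by blast
  have e3: "env s3"
    by (rule env) (auto simp: s3 s2(2) s1(2))
  have eqs: "s2 11 = s 11" "s2 20 = s 20" "s2 21 = s 21" "s2 26 = s 26"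
    by (simp_all add: s2(2) s1(2))
  have T: "s3 26 c \<noteq> 0 \<longleftrightarrow> s 26 c \<noteq> 0 \<or> (\<exists>X<L. \<exists>z<H. derived (s 11 0) (s 20) (s 21) (s2 22) (s 26) X z c)" for c
    using tr unfolding tried_def eqs by auto
  have P2: "\<forall>x<L. s2 22 x = merge (s 20) v x"
    by (simp add: s2(1))
  note m = merged_partition[OF s(2) v(2) P2]
  have ip: "interval_partition (s 20)"
    using s(2) by (simp add: good_partition_def)
  have inv: "sound_at (Suc (s 11 0)) (s2 22) (s3 26)" "empty_above (Suc (s 11 0)) (s3 26)"
    by (rule sound_step[OF ip m(2) s(4,6) T] empty_step[OF s(6) T])+
  have com: "complete_at (Suc (s 11 0)) (s2 22) (s3 26)"
    by (rule complete_step[OF s(2) m(1) _ _ m(2) s(5) T]) (use s(3) m(3) in blast)+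
  define s4 where "s4 = exec (Fill 20 6 (Rd 22 (V 14))) s3"
  have L3: "s3 6 0 = L"
    using e3 by (simp add: envD)
  have *: "\<forall>i<L. \<forall>t. (\<forall>c. c \<noteq> 20 \<longrightarrow> c \<noteq> 14 \<longrightarrow> t c = s3 c) \<longrightarrow> t 14 0 = i \<longrightarrow> aval (Rd 22 (V 14)) t = s2 22 i"
    by (simp add: s3)
  have s4: "s4 20 = (\<lambda>i. if i < L then s2 22 i else s3 20 i)" "\<And>c. c \<noteq> 20 \<Longrightarrow> c \<noteq> 14 \<Longrightarrow> s4 c = s3 c"
    unfolding s4_def using exec_Fill[OF L3 _ *] by simp_all
  have e4: "env s4"
    by (rule env) (auto simp: s4(2) s3 s2(2) s1(2))
  define s5 where "s5 = exec (Fill 21 6 (eCls 22 (V 14))) s4"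
  have L4: "s4 6 0 = L"
    using e4 by (simp add: envD)
  have *: "\<forall>i<L. \<forall>t. (\<forall>c. c \<noteq> 21 \<longrightarrow> c \<noteq> 14 \<longrightarrow> t c = s4 c) \<longrightarrow> t 14 0 = i \<longrightarrow> aval (eCls 22 (V 14)) t = cls (s2 22) i"
  proof (intro allI impI)
    fix i t assume i: "i < L" and t: "\<forall>c. c \<noteq> 21 \<longrightarrow> c \<noteq> 14 \<longrightarrow> t c = s4 c" "t 14 0 = i"
    have "env t"
      by (rule env) (use t(1) in \<open>auto simp: s4(2) s3 s2(2) s1(2)\<close>)
    moreover have "t 22 = s2 22"
      using t(1) s4(2) s3 by simp
    ultimately show "aval (eCls 22 (V 14)) t = cls (s2 22) i"
      using i t(2) by simp
  qed
  have s5: "s5 21 = (\<lambda>i. if i < L then cls (s2 22) i else s4 21 i)" "\<And>c. c \<noteq> 21 \<Longrightarrow> c \<noteq> 14 \<Longrightarrow> s5 c = s4 c"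
    unfolding s5_def using exec_Fill[OF L4 _ *] by simp_all
  have e5: "env s5"
    by (rule env) (auto simp: s5(2) s4(2) s3 s2(2) s1(2))
  have P: "\<forall>x<L. s2 22 x = s5 20 x"
    using s5(2) s4(1) by simp
  have T5: "s5 26 = s3 26"
    using s5(2) s4(2) by simp
  have L: "0 < L" "L - 1 < L"
    using L_pos by simp_all
  have "s5 21 x = cls (s5 20) x" if "x < L" for x
    using that s5(1) state_cong(1)[OF P] by simp
  moreover have "good_partition d (s5 20)"
    by (rule good_partition_cong(1)[OF m(1) P[rule_format] L(1)])
  moreover have "(\<forall>w. \<not> mergeable d (s5 20) w) \<or> s5 20 (L - 1) + Suc (s 11 0) \<le> L - 1"
    using m(4)[OF s(7)] mergeable_cong[OF P[rule_format]] P L(2) by simp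
  ultimately have "stage_inv (Suc (s 11 0)) s5"
    unfolding stage_inv_def T5 using e5 inv com table_cong[OF P] by blast
  moreover have "exec cStage s = s5"
    by (simp only: cStage_def exec.simps(3) s1_def s2_def s3_def s4_def s5_def)
  ultimately show ?thesis
    by simp
qed

section \<open>The initial table\<close>

abbreviation single :: "nat \<Rightarrow> nat \<Rightarrow> nat \<Rightarrow> nat" where
  "single p x \<equiv> (\<lambda>_. 0)(p := Suc x)"

definition initialised :: "store \<Rightarrow> (nat \<times> nat) set \<Rightarrow> store \<Rightarrow> bool" where
  "initialised s A t \<longleftrightarrow> (\<forall>c. t 26 c \<noteq> 0 \<longleftrightarrow> s 26 c \<noteq> 0 \<or> (\<exists>(p, x)\<in>A. c = code L 0 (single p x) K)) \<and>
    (\<forall>b. b \<notin> {13, 14, 18, 25, 26, 29} \<longrightarrow> t b = s b)"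

lemma initialised_cInit:
  assumes s: "env s" and t: "initialised s A t" and p: "t 29 0 = p" and x: "t 13 0 = x"
  shows "initialised s (insert (p, x) A) (exec cInit t)"
    and "exec cInit t 29 = t 29"
proof -
  have fr: "t b = s b" if "b \<notin> {13, 14, 18, 25, 26, 29}" for b
    using t that unfolding initialised_def by blast
  define t1 where "t1 = exec (Fill 25 5 (Ite (Equal (V 14) (V 29)) (Plus (V 13) (N 1)) (N 0))) t"
  have K: "t 5 0 = K"
    using s by (simp add: fr envD)
  have *: "\<forall>i<K. \<forall>u. (\<forall>c. c \<noteq> 25 \<longrightarrow> c \<noteq> 14 \<longrightarrow> u c = t c) \<longrightarrow> u 14 0 = i \<longrightarrow>
      aval (Ite (Equal (V 14) (V 29)) (Plus (V 13) (N 1)) (N 0)) u = single p x i"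
    using p x by simp
  have t1: "t1 25 = (\<lambda>i. if i < K then single p x i else t 25 i)" "\<And>c. c \<noteq> 25 \<Longrightarrow> c \<noteq> 14 \<Longrightarrow> t1 c = t c"
    unfolding t1_def using exec_Fill[OF K _ *] by simp_all
  have "env t1 = env s"
    by (rule env_cong) (auto simp: t1(2) fr)
  with s have e1: "env t1"
    by simp
  define t2 where "t2 = exec (cCode (N 0)) t1"
  have t2: "t2 18 0 = code L 0 (t1 25) K" "\<And>c. c \<noteq> 14 \<Longrightarrow> c \<noteq> 18 \<Longrightarrow> t2 c = t1 c"
    unfolding t2_def using exec_cCode[OF e1, of "N 0" 0] by simp_all
  have c: "code L 0 (t1 25) K = code L 0 (single p x) K"
    by (rule code_cong) (simp add: t1)
  have eq: "exec cInit t = exec (Asg 26 (V 18) (N 1)) t2"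
    by (simp only: cInit_def exec.simps(3) t1_def t2_def)
  have "t2 26 = t 26"
    by (simp add: t2(2) t1(2))
  then have e26: "exec cInit t 26 = (t 26)(code L 0 (single p x) K := 1)"
    by (simp add: eq t2(1) c)
  have "exec cInit t 26 c' \<noteq> 0 \<longleftrightarrow> s 26 c' \<noteq> 0 \<or> (\<exists>(p, x)\<in>insert (p, x) A. c' = code L 0 (single p x) K)" for c'
  proof -
    have "exec cInit t 26 c' \<noteq> 0 \<longleftrightarrow> t 26 c' \<noteq> 0 \<or> c' = code L 0 (single p x) K"
      by (simp only: e26) simp
    also have "\<dots> \<longleftrightarrow> s 26 c' \<noteq> 0 \<or> (\<exists>(p, x)\<in>insert (p, x) A. c' = code L 0 (single p x) K)"
      using t unfolding initialised_def by auto
    finally show ?thesis .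
  qed
  moreover have "exec cInit t b = s b" if "b \<notin> {13, 14, 18, 25, 26, 29}" for b
    using that by (simp add: eq t2(2) t1(2) fr)
  ultimately show "initialised s (insert (p, x) A) (exec cInit t)"
    unfolding initialised_def by blast
  show "exec cInit t 29 = t 29"
    by (simp add: eq t2(2) t1(2))
qed

lemma exec_initialise:
  assumes s: "env s"
  shows "initialised s ({..<K} \<times> {..<L}) (exec (For 29 5 (For 13 6 cInit)) s)"
proof (rule For_inv[where Inv = "\<lambda>i t. initialised s ({..<i} \<times> {..<L}) t"])
  have put: "initialised s A (put x i t)" if "initialised s A t" "x = 13 \<or> x = 29" for A x i t
    using that by (auto simp: initialised_def put_apply)
  show "s 5 0 = K" "initialised s ({..<0} \<times> {..<L}) s"
    using s by (simp_all add: envD initialised_def)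
  fix p t assume t: "initialised s ({..<p} \<times> {..<L}) t"
  define u where "u = put 29 p t"
  define Inv where "Inv j v \<longleftrightarrow> initialised s ({..<p} \<times> {..<L} \<union> {p} \<times> {..<j}) v \<and> v 29 0 = p" for j v
  have u: "initialised s ({..<p} \<times> {..<L}) u" "u 29 0 = p"
    using put[OF t] by (simp_all add: u_def put_apply)
  have "Inv L (exec (For 13 6 cInit) u)"
  proof (rule For_inv[where Inv = Inv])
    have "u 6 = s 6"
      using u(1) by (simp add: initialised_def)
    then show "u 6 0 = L"
      using s by (simp add: envD)
    show "Inv 0 u"
      using u by (simp add: Inv_def)
    fix x v assume v: "Inv x v"
    define w where "w = put 13 x v"
    have w: "initialised s ({..<p} \<times> {..<L} \<union> {p} \<times> {..<x}) w" "w 29 0 = p" "w 13 0 = x"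
      using v put by (auto simp: w_def Inv_def put_apply)
    note i = initialised_cInit[OF s w]
    have "insert (p, x) ({..<p} \<times> {..<L} \<union> {p} \<times> {..<x}) = {..<p} \<times> {..<L} \<union> {p} \<times> {..<Suc x}"
      by auto
    with i w(2) have "Inv (Suc x) (exec cInit w)"
      by (simp add: Inv_def)
    then show "Inv (Suc x) (exec cInit (put 13 x v))"
      by (simp add: w_def)
  qed
  moreover have "{..<p} \<times> {..<L} \<union> {p} \<times> {..<L} = {..<Suc p} \<times> {..<L}"
    by auto
  ultimately show "initialised s ({..<Suc p} \<times> {..<L}) (exec (For 13 6 cInit) (put 29 p t))"
    by (simp add: Inv_def u_def)
qed

text \<open>For single lines, connected feasible states contain exactly one pattern vertex, which
  may be placed on any line; these are the states entered at the start.\<close>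

lemma initial_table:
  assumes T: "\<And>c. T c \<noteq> 0 \<longleftrightarrow> (\<exists>p<K. \<exists>x<L. c = code L 0 (single p x) K)"
  shows "sound_at 0 (\<lambda>x. x) T" and "complete_at 0 (\<lambda>x. x) T" and "empty_above 0 T"
proof -
  have inj: "st = 0 \<and> (\<forall>q<K. ds q = single p x q)"
    if "code L st ds K = code L 0 (single p x) K" "\<forall>p<K. ds p \<le> L" "x < L" for st ds p x
    by (rule code_inject[OF that(1)]) (use that(2,3) in auto)
  show "sound_at 0 (\<lambda>x. x) T"
    unfolding sound_at_def
  proof (intro allI impI, elim conjE)
    fix ds assume ds: "\<forall>p<K. ds p \<le> L" "T (code L 0 ds K) \<noteq> 0"
    then obtain p x where px: "p < K" "x < L" "code L 0 ds K = code L 0 (single p x) K"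
      using T by blast
    show "feasible (\<lambda>x. x) ds"
      using inj[OF px(3) ds(1) px(2)] feasible_single[OF px(2), of p] feasible_cong[of ds "single p x"] by blast
  qed
  show "complete_at 0 (\<lambda>x. x) T"
    unfolding complete_at_def
  proof (intro allI impI, elim conjE)
    fix ds assume "present ds" "red_connected (\<lambda>x. x) ds" "feasible (\<lambda>x. x) ds"
    then obtain p x where px: "p < K" "x < L" "\<forall>q<K. ds q = single p x q"
      using feasible_id_single by blast
    then have "code L 0 ds K = code L 0 (single p x) K"
      by (intro code_cong) blast
    with px T show "T (code L 0 ds K) \<noteq> 0"
      by blast
  qed
  show "empty_above 0 T"
    unfolding empty_above_def
  proof (intro allI impI, elim conjE)
    fix st :: nat and ds :: "nat \<Rightarrow> nat" assume st: "0 < st" and ds: "\<forall>p<K. ds p \<le> L"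
    show "T (code L st ds K) = 0"
    proof (rule ccontr)
      assume "T (code L st ds K) \<noteq> 0"
      then obtain p x where "x < L" "code L st ds K = code L 0 (single p x) K"
        using T by blast
      with inj ds st show False
        by blast
    qed
  qed
qed

section \<open>Correctness of the search\<close>

definition embedding :: "(nat \<Rightarrow> nat) \<Rightarrow> bool" where
  "embedding f \<longleftrightarrow> (\<forall>p<K. f p < L \<and> (\<forall>q<K. ok (f p) (f q) p q))"

text \<open>The hypothesis \<open>stuck\<close> isolates what the Marcus--Tardos theorem and the
  greedy selection contribute; the rest is the correctness of the dynamic programming.\<close>

lemma exec_cSearch:
  assumes s: "env s" and T0: "s 26 = (\<lambda>_. 0)" and k: "0 < k"
    and stuck: "\<And>P. good_partition d P \<Longrightarrow> \<forall>v. \<not> mergeable d P v \<Longrightarrow> 0 < P (L - 1) \<Longrightarrow> \<exists>f. embedding f"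
  shows "exec cSearch s 0 0 = of_bool (\<exists>f. embedding f)"
proof -
  have env: "env t" if "\<And>c. c \<le> 10 \<or> c = 27 \<Longrightarrow> t c = s c" for t
    using env_cong[of t s] that s by blast
  have L: "0 < L" "L - 1 < L"
    using L_pos by simp_all
  define s1 where "s1 = exec (Fill 20 6 (V 14)) s"
  have L0: "s 6 0 = L"
    using s by (simp add: envD)
  have *: "\<forall>i<L. \<forall>t. (\<forall>c. c \<noteq> 20 \<longrightarrow> c \<noteq> 14 \<longrightarrow> t c = s c) \<longrightarrow> t 14 0 = i \<longrightarrow> aval (V 14) t = i"
    by simp
  have s1: "s1 20 = (\<lambda>i. if i < L then i else s 20 i)" "\<And>c. c \<noteq> 20 \<Longrightarrow> c \<noteq> 14 \<Longrightarrow> s1 c = s c"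
    unfolding s1_def using exec_Fill[OF L0 _ *] by simp_all
  define s2 where "s2 = exec (Fill 21 6 (V 14)) s1"
  have L1: "s1 6 0 = L"
    using L0 by (simp add: s1(2))
  have *: "\<forall>i<L. \<forall>t. (\<forall>c. c \<noteq> 21 \<longrightarrow> c \<noteq> 14 \<longrightarrow> t c = s1 c) \<longrightarrow> t 14 0 = i \<longrightarrow> aval (V 14) t = i"
    by simp
  have s2: "s2 21 = (\<lambda>i. if i < L then i else s1 21 i)" "\<And>c. c \<noteq> 21 \<Longrightarrow> c \<noteq> 14 \<Longrightarrow> s2 c = s1 c"
    unfolding s2_def using exec_Fill[OF L1 _ *] by simp_all
  define s3 where "s3 = exec (Asg 11 (N 0) (N 0)) s2"
  have s3: "\<And>c. c \<noteq> 11 \<Longrightarrow> s3 c = s2 c"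
    by (simp add: s3_def)
  have e3: "env s3"
    by (rule env) (auto simp: s3 s2(2) s1(2))
  define s4 where "s4 = exec (For 29 5 (For 13 6 cInit)) s3"
  have "initialised s3 ({..<K} \<times> {..<L}) s4"
    unfolding s4_def by (rule exec_initialise[OF e3])
  moreover have "s3 26 = (\<lambda>_. 0)"
    by (simp add: s3 s2(2) s1(2) T0)
  ultimately have T4: "s4 26 c \<noteq> 0 \<longleftrightarrow> (\<exists>p<K. \<exists>x<L. c = code L 0 (single p x) K)"
    and s4: "b \<notin> {13, 14, 18, 25, 26, 29} \<Longrightarrow> s4 b = s3 b" for c b
    unfolding initialised_def by auto
  have e4: "env s4"
    by (rule env) (auto simp: s4 s3 s2(2) s1(2))
  have id: "\<forall>x<L. x = s4 20 x"
    by (simp add: s4 s3 s2(2) s1(1))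
  note tab = table_cong[OF id, symmetric]
  have "s4 21 x = cls (s4 20) x" if "x < L" for x
    using that state_cong(1)[OF id that] by (simp add: cls_id s4 s3 s2(1))
  moreover have "good_partition d (s4 20)"
    by (rule good_partition_cong(1)[OF good_partition_id id[rule_format] L(1)])
  moreover have "s4 20 (L - 1) + 0 \<le> L - 1"
    using id L(2) by fastforce
  ultimately have inv0: "stage_inv 0 s4"
    unfolding stage_inv_def tab using e4 initial_table[OF T4] by blast
  define s5 where "s5 = exec (For 11 6 cStage) s4"
  have inv: "stage_inv L s5"
    unfolding s5_def
  proof (rule For_inv[where Inv = stage_inv])
    show "s4 6 0 = L"
      using e4 by (simp add: envD)
    show "stage_inv 0 s4"
      by (fact inv0)
    fix i t assume t: "stage_inv i t"
    have "stage_inv i (put 11 i t)"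
      using t by (simp add: stage_inv_def put_apply)
    then show "stage_inv (Suc i) (exec cStage (put 11 i t))"
      using exec_cStage[of "put 11 i t"] by (simp add: put_apply)
  qed
  have e5: "env s5"
    using inv by (simp add: stage_inv_def)
  \<comment> \<open>After \<open>L\<close> stages the alternative
    \<open>s5 20 (L - 1) + L \<le> L - 1\<close> is impossible.\<close>
  have P: "good_partition d (s5 20)" "\<forall>v. \<not> mergeable d (s5 20) v"
    using inv L by (auto simp: stage_inv_def)
  define s6 where "s6 = exec (Asg 11 (N 0) (V 6)) s5"
  have s6: "s6 11 0 = L" "\<And>c. c \<noteq> 11 \<Longrightarrow> s6 c = s5 c"
    using e5 by (simp_all add: s6_def envD)
  define s7 where "s7 = exec (Fill 25 5 (N 1)) s6"
  have K6: "s6 5 0 = K"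
    using e5 by (simp add: s6(2) envD)
  have *: "\<forall>i<K. \<forall>t. (\<forall>c. c \<noteq> 25 \<longrightarrow> c \<noteq> 14 \<longrightarrow> t c = s6 c) \<longrightarrow> t 14 0 = i \<longrightarrow> aval (N 1) t = 1"
    by simp
  have s7: "s7 25 = (\<lambda>i. if i < K then 1 else s6 25 i)" "\<And>c. c \<noteq> 25 \<Longrightarrow> c \<noteq> 14 \<Longrightarrow> s7 c = s6 c"
    unfolding s7_def using exec_Fill[OF K6 _ *] by simp_all
  have "env s7 = env s5"
    by (rule env_cong) (auto simp: s7(2) s6(2))
  with e5 have e7: "env s7"
    by simp
  define s8 where "s8 = exec (cCode (V 11)) s7"
  have s8: "s8 18 0 = code L L (s7 25) K" "\<And>c. c \<noteq> 14 \<Longrightarrow> c \<noteq> 18 \<Longrightarrow> s8 c = s7 c"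
    unfolding s8_def using exec_cCode[OF e7, of "V 11" L] by (simp_all add: s7(2) s6(1))
  let ?one = "\<lambda>q. if q < K then 1 else 0"
  have c: "code L L (s7 25) K = code L L ?one K"
    by (rule code_cong) (simp add: s7(1))
  have "exec cSearch s = exec (Asg 0 (N 0) (Disj (Rd 20 (Minus (V 6) (N 1))) (Rd 26 (V 18)))) s8"
    by (simp only: cSearch_def exec.simps(3) s1_def s2_def s3_def s4_def s5_def s6_def s7_def s8_def)
  then have res: "exec cSearch s 0 0 = of_bool (s5 20 (L - 1) \<noteq> 0 \<or> s5 26 (code L L ?one K) \<noteq> 0)"
    using s8(1) c envD(7)[OF e5] by (simp add: s8(2) s7(2) s6(2))
  show ?thesis
  proof (cases "s5 20 (L - 1) = 0")
    case True
    have "s5 20 x = 0" if "x < L" for x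
    proof -
      have "x \<le> L - 1"
        using that by simp
      then show ?thesis
        using part_mono[OF P(1) _ L(2), of x] True by simp
    qed
    then have one: "feasible (s5 20) ?one \<longleftrightarrow> (\<exists>f. embedding f)" "red_connected (s5 20) ?one"
      using feasible_one_part[of "s5 20"] L_pos unfolding embedding_def by blast+
    have "0 < K"
      using k by (simp add: K_def)
    have "feasible (s5 20) ?one \<longleftrightarrow> s5 26 (code L L ?one K) \<noteq> 0"
    proof -
      have one_le: "\<forall>p<K. ?one p \<le> L" and pr: "present ?one"
        using L \<open>0 < K\<close> by (auto simp: present_def)
      have so: "sound_at L (s5 20) (s5 26)" and com: "complete_at L (s5 20) (s5 26)"
        using inv by (simp_all add: stage_inv_def)
      show ?thesis
        using so[unfolded sound_at_def, THEN spec[of _ ?one]] com[unfolded complete_at_def, THEN spec[of _ ?one]]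
          one_le pr one(2) by argo
    qed
    then show ?thesis
      using res one(1) True by simp
  next
    case False
    with stuck[OF P] have "\<exists>f. embedding f"
      by simp
    with res False show ?thesis
      by simp
  qed
qed

end

section \<open>Parameters, input and running time\<close>

lemma exec_double:
  assumes "x \<noteq> 36" and "s b 0 = n"
  shows "exec (For 36 b (Asg x (N 0) (Plus (V x) (V x)))) s x 0 = 2 ^ n * s x 0"
    and "\<And>c. c \<noteq> x \<Longrightarrow> c \<noteq> 36 \<Longrightarrow> exec (For 36 b (Asg x (N 0) (Plus (V x) (V x)))) s c = s c"
proof -
  let ?Inv = "\<lambda>i t. t x 0 = 2 ^ i * s x 0 \<and> (\<forall>c. c \<noteq> x \<longrightarrow> c \<noteq> 36 \<longrightarrow> t c = s c)"
  have "?Inv n (exec (For 36 b (Asg x (N 0) (Plus (V x) (V x)))) s)"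
    by (rule For_inv[where Inv = ?Inv]) (use assms in \<open>simp_all add: put_apply\<close>)
  then show "exec (For 36 b (Asg x (N 0) (Plus (V x) (V x)))) s x 0 = 2 ^ n * s x 0"
    and "\<And>c. c \<noteq> x \<Longrightarrow> c \<noteq> 36 \<Longrightarrow> exec (For 36 b (Asg x (N 0) (Plus (V x) (V x)))) s c = s c"
    by simp_all
qed

definition cGreedy :: "nat \<Rightarrow> cmd" where
  "cGreedy T = For 36 4 (Asg 30 (N 0) (Plus (Times T (V 30)) (Times T (Plus (V 36) (N 1)))))"

lemma exec_cGreedy:
  assumes "s 4 0 = k" and "s 30 0 = 0"
  shows "exec (cGreedy T) s 30 0 = greedy_size T k"
    and "\<And>c. c \<noteq> 30 \<Longrightarrow> c \<noteq> 36 \<Longrightarrow> exec (cGreedy T) s c = s c"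
proof -
  let ?Inv = "\<lambda>i t. t 30 0 = greedy_size T i \<and> (\<forall>c. c \<noteq> 30 \<longrightarrow> c \<noteq> 36 \<longrightarrow> t c = s c)"
  have "?Inv k (exec (cGreedy T) s)"
    unfolding cGreedy_def by (rule For_inv[where Inv = ?Inv]) (use assms in \<open>simp_all add: put_apply\<close>)
  then show "exec (cGreedy T) s 30 0 = greedy_size T k"
    and "\<And>c. c \<noteq> 30 \<Longrightarrow> c \<noteq> 36 \<Longrightarrow> exec (cGreedy T) s c = s c"
    by simp_all
qed

definition cPowers :: cmd where
  "cPowers = For 36 35 (Asg 27 (Plus (V 36) (N 1)) (Sum 50 8 (Rd 27 (V 36))))"

lemma exec_cPowers:
  assumes "s 35 0 = D" and "s 8 0 = Q" and "s 27 0 = 1"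
  shows "\<forall>i\<le>D. exec cPowers s 27 i = Q ^ i"
    and "\<And>c. c \<noteq> 27 \<Longrightarrow> c \<noteq> 36 \<Longrightarrow> exec cPowers s c = s c"
proof -
  let ?Inv = "\<lambda>j t. (\<forall>i\<le>j. t 27 i = Q ^ i) \<and> (\<forall>c. c \<noteq> 27 \<longrightarrow> c \<noteq> 36 \<longrightarrow> t c = s c)"
  have "?Inv D (exec cPowers s)"
    unfolding cPowers_def
    by (rule For_inv[where Inv = ?Inv]) (use assms in \<open>auto simp: put_apply le_Suc_eq\<close>)
  then show "\<forall>i\<le>D. exec cPowers s 27 i = Q ^ i"
    and "\<And>c. c \<noteq> 27 \<Longrightarrow> c \<noteq> 36 \<Longrightarrow> exec cPowers s c = s c"
    by simp_all
qed

text \<open>The size of the inflated permutation.\<close>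

definition param_r :: "nat \<Rightarrow> nat \<Rightarrow> nat" where
  "param_r T k = k * greedy_size T k"

definition param_q :: "nat \<Rightarrow> nat \<Rightarrow> nat" where
  "param_q T k = 4 * (param_r T k)\<^sup>2"

definition param_d :: "nat \<Rightarrow> nat \<Rightarrow> nat" where
  "param_d T k = 8 * mt_const (param_r T k)"

text \<open>Exceeds the bound on the number of red neighbours and the number \<open>2 * k\<close> of
  labels, so that ranks and labels are digits.\<close>

definition param_Q :: "nat \<Rightarrow> nat \<Rightarrow> nat" where
  "param_Q T k = 2 * (param_d T k + 1) * 2 ^ param_d T k + 2 * k + 2"

definition param_W :: "nat \<Rightarrow> nat" where
  "param_W k = 2 * k * (2 * k)"

definition param_D :: "nat \<Rightarrow> nat" where
  "param_D k = 2 * k * (param_W k + 2)"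

text \<open>A common bound for all parameters that occur as loop bounds; a sum is easier to compute
  than a maximum.\<close>

definition param_bound :: "nat \<Rightarrow> nat \<Rightarrow> nat" where
  "param_bound T k = k + (param_r T k + (param_q T k + (param_q T k * param_r T k + (param_d T k + (2 * k +
     (param_W k + (param_D k + (param_Q T k + param_Q T k ^ param_D k))))))))"

text \<open>Cell \<open>0\<close> of the banks \<open>30\<close> to \<open>37\<close> holds \<open>greedy_size T k\<close>, \<open>r\<close>, \<open>q\<close>, \<open>2 ^ q\<close>, \<open>2 ^ d\<close>, \<open>D\<close>, a counter and \<open>q * r\<close>.\<close>

definition cParam :: "nat \<Rightarrow> cmd" where
  "cParam T = Sq (Asg 30 (N 0) (N 0)) (Sq (cGreedy T) (Sq (Asg 31 (N 0) (Sum 50 4 (V 30)))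
    (Sq (Asg 32 (N 0) (Times 4 (Sum 50 31 (V 31)))) (Sq (Asg 33 (N 0) (N 1))
    (Sq (For 36 32 (Asg 33 (N 0) (Plus (V 33) (V 33)))) (Sq (Asg 37 (N 0) (Sum 50 31 (V 32)))
    (Sq (Asg 7 (N 0) (Times 64 (Sum 50 37 (V 33)))) (Sq (Asg 34 (N 0) (N 1))
    (Sq (For 36 7 (Asg 34 (N 0) (Plus (V 34) (V 34)))) (Sq (Asg 5 (N 0) (Plus (V 4) (V 4)))
    (Sq (Asg 8 (N 0) (Plus (Times 2 (Plus (Sum 50 7 (V 34)) (V 34))) (Plus (V 5) (N 2))))
    (Sq (Asg 10 (N 0) (Sum 50 5 (V 5))) (Sq (Asg 35 (N 0) (Sum 50 5 (Plus (V 10) (N 2))))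
    (Sq (Asg 27 (N 0) (N 1)) (Sq cPowers (Asg 9 (N 0) (Rd 27 (V 35))))))))))))))))))"

lemma a_below_Times: "a_below r e \<Longrightarrow> a_below r (Times n e)"
  by (induction n) simp_all

lemma a_static_Times: "a_static Y e \<Longrightarrow> a_static Y (Times n e)"
  by (induction n) simp_all

lemma cParam_below: "c_below 61 (cParam T)"
  by (simp add: cParam_def cGreedy_def cPowers_def a_below_Times)

lemma exec_cParam:
  assumes k: "s 4 0 = k"
  shows "exec (cParam T) s 31 0 = param_r T k" and "exec (cParam T) s 32 0 = param_q T k"
    and "exec (cParam T) s 37 0 = param_q T k * param_r T k" and "exec (cParam T) s 7 0 = param_d T k"
    and "exec (cParam T) s 5 0 = 2 * k" and "exec (cParam T) s 10 0 = param_W k"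
    and "exec (cParam T) s 35 0 = param_D k" and "exec (cParam T) s 8 0 = param_Q T k"
    and "exec (cParam T) s 9 0 = param_Q T k ^ param_D k"
    and "\<forall>i\<le>param_D k. exec (cParam T) s 27 i = param_Q T k ^ i"
    and "\<And>c. c \<notin> {5, 7, 8, 9, 10, 27, 30, 31, 32, 33, 34, 35, 36, 37} \<Longrightarrow> exec (cParam T) s c = s c"
    and "param_bound T k \<le> U \<Longrightarrow> c_bounded U (cParam T) s"
proof -
  define s1 where "s1 = exec (Asg 30 (N 0) (N 0)) s"
  have s1: "s1 30 0 = 0" "\<And>c. c \<noteq> 30 \<Longrightarrow> s1 c = s c"
    by (simp_all add: s1_def)
  define s2 where "s2 = exec (cGreedy T) s1"
  have s2: "s2 30 0 = greedy_size T k" "\<And>c. c \<noteq> 30 \<Longrightarrow> c \<noteq> 36 \<Longrightarrow> s2 c = s1 c"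
    unfolding s2_def using exec_cGreedy[where s = s1 and k = k and T = T] s1 k by simp_all
  define s3 where "s3 = exec (Asg 31 (N 0) (Sum 50 4 (V 30))) s2"
  have s3: "s3 31 0 = param_r T k" "\<And>c. c \<noteq> 31 \<Longrightarrow> s3 c = s2 c"
    using s1(2) s2 k by (simp_all add: s3_def put_apply param_r_def)
  define s4 where "s4 = exec (Asg 32 (N 0) (Times 4 (Sum 50 31 (V 31)))) s3"
  have s4: "s4 32 0 = param_q T k" "\<And>c. c \<noteq> 32 \<Longrightarrow> s4 c = s3 c"
    using s3 by (simp_all add: s4_def put_apply param_q_def power2_eq_square)
  define s5 where "s5 = exec (Asg 33 (N 0) (N 1)) s4"
  have s5: "s5 33 0 = 1" "\<And>c. c \<noteq> 33 \<Longrightarrow> s5 c = s4 c"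
    by (simp_all add: s5_def)
  define s6 where "s6 = exec (For 36 32 (Asg 33 (N 0) (Plus (V 33) (V 33)))) s5"
  have s6: "s6 33 0 = 2 ^ param_q T k" "\<And>c. c \<noteq> 33 \<Longrightarrow> c \<noteq> 36 \<Longrightarrow> s6 c = s5 c"
    unfolding s6_def using exec_double[of 33 s5 32 "param_q T k"] s5 s4 by (simp_all del: exec.simps)
  define s7 where "s7 = exec (Asg 37 (N 0) (Sum 50 31 (V 32))) s6"
  have s7: "s7 37 0 = param_q T k * param_r T k" "\<And>c. c \<noteq> 37 \<Longrightarrow> s7 c = s6 c"
    using s3 s4 s5(2) s6(2) by (simp_all add: s7_def put_apply)
  \<comment> \<open>\<open>8 * mt_const r\<close> is \<open>64 * (q * r) * 2 ^ q\<close>, and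
    \<open>q * r\<close> was prepared as a loop bound.\<close>
  define s8 where "s8 = exec (Asg 7 (N 0) (Times 64 (Sum 50 37 (V 33)))) s7"
  have s8: "s8 7 0 = param_d T k" "\<And>c. c \<noteq> 7 \<Longrightarrow> s8 c = s7 c"
    using s6(1) s7 by (simp_all add: s8_def put_apply param_d_def mt_const_def param_q_def)
  define s9 where "s9 = exec (Asg 34 (N 0) (N 1)) s8"
  have s9: "s9 34 0 = 1" "\<And>c. c \<noteq> 34 \<Longrightarrow> s9 c = s8 c"
    by (simp_all add: s9_def)
  define s10 where "s10 = exec (For 36 7 (Asg 34 (N 0) (Plus (V 34) (V 34)))) s9"
  have s10: "s10 34 0 = 2 ^ param_d T k" "\<And>c. c \<noteq> 34 \<Longrightarrow> c \<noteq> 36 \<Longrightarrow> s10 c = s9 c"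
    unfolding s10_def using exec_double[of 34 s9 7 "param_d T k"] s9 s8 by (simp_all del: exec.simps)
  note fr1 = s1(2) s2(2) s3(2) s4(2) s5(2) s6(2) s7(2) s8(2) s9(2) s10(2)
  define s11 where "s11 = exec (Asg 5 (N 0) (Plus (V 4) (V 4))) s10"
  have s11: "s11 5 0 = 2 * k" "\<And>c. c \<noteq> 5 \<Longrightarrow> s11 c = s10 c"
    using k by (simp_all add: s11_def fr1)
  define s12 where "s12 = exec (Asg 8 (N 0) (Plus (Times 2 (Plus (Sum 50 7 (V 34)) (V 34))) (Plus (V 5) (N 2)))) s11"
  have s12: "s12 8 0 = param_Q T k" "\<And>c. c \<noteq> 8 \<Longrightarrow> s12 c = s11 c"
    using s11 s10 s9(2) s8(1) by (simp_all add: s12_def put_apply param_Q_def)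
  define s13 where "s13 = exec (Asg 10 (N 0) (Sum 50 5 (V 5))) s12"
  have s13: "s13 10 0 = param_W k" "\<And>c. c \<noteq> 10 \<Longrightarrow> s13 c = s12 c"
    using s11(1) s12(2) by (simp_all add: s13_def put_apply param_W_def)
  define s14 where "s14 = exec (Asg 35 (N 0) (Sum 50 5 (Plus (V 10) (N 2)))) s13"
  have s14: "s14 35 0 = param_D k" "\<And>c. c \<noteq> 35 \<Longrightarrow> s14 c = s13 c"
    using s11(1) s12(2) s13 by (simp_all add: s14_def put_apply param_D_def)
  define s15 where "s15 = exec (Asg 27 (N 0) (N 1)) s14"
  have s15: "s15 27 0 = 1" "\<And>c. c \<noteq> 27 \<Longrightarrow> s15 c = s14 c"
    by (simp_all add: s15_def)
  define s16 where "s16 = exec cPowers s15"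
  have s16: "\<forall>i\<le>param_D k. s16 27 i = param_Q T k ^ i" "\<And>c. c \<noteq> 27 \<Longrightarrow> c \<noteq> 36 \<Longrightarrow> s16 c = s15 c"
    unfolding s16_def using exec_cPowers[of s15 "param_D k" "param_Q T k"] s15 s14 s13(2) s12(1) by simp_all
  define s17 where "s17 = exec (Asg 9 (N 0) (Rd 27 (V 35))) s16"
  have s17: "s17 9 0 = param_Q T k ^ param_D k" "\<And>c. c \<noteq> 9 \<Longrightarrow> s17 c = s16 c"
    using s16 s14(1) s15(2) by (simp_all add: s17_def)
  note fr2 = s11(2) s12(2) s13(2) s14(2) s15(2) s16(2) s17(2)
  have eq: "exec (cParam T) s = s17"
    by (simp only: cParam_def exec.simps(3) s1_def s2_def s3_def s4_def s5_def s6_def s7_def s8_def s9_def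
        s10_def s11_def s12_def s13_def s14_def s15_def s16_def s17_def)
  show "exec (cParam T) s 31 0 = param_r T k" "exec (cParam T) s 32 0 = param_q T k"
    "exec (cParam T) s 37 0 = param_q T k * param_r T k" "exec (cParam T) s 7 0 = param_d T k"
    "exec (cParam T) s 5 0 = 2 * k" "exec (cParam T) s 10 0 = param_W k"
    "exec (cParam T) s 35 0 = param_D k" "exec (cParam T) s 8 0 = param_Q T k"
    "exec (cParam T) s 9 0 = param_Q T k ^ param_D k"
    "\<forall>i\<le>param_D k. exec (cParam T) s 27 i = param_Q T k ^ i"
    unfolding eq by (simp_all add: fr1 fr2 s3(1) s4(1) s7(1) s8(1) s11(1) s12(1) s13(1) s14(1) s16(1) s17(1))
  show "exec (cParam T) s c = s c" if "c \<notin> {5, 7, 8, 9, 10, 27, 30, 31, 32, 33, 34, 35, 36, 37}" for c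
    unfolding eq using that by (simp add: fr1 fr2)
  \<comment> \<open>Most loop bounds are computed on the way, so each command is checked in the
    store in which it starts.\<close>
  show "c_bounded U (cParam T) s" if U: "param_bound T k \<le> U"
  proof -
    have le: "k \<le> U" "param_r T k \<le> U" "param_q T k \<le> U" "param_q T k * param_r T k \<le> U" "param_d T k \<le> U"
      "2 * k \<le> U" "param_D k \<le> U" "param_Q T k \<le> U"
      using U unfolding param_bound_def by linarith+
    have "c_bounded U (cGreedy T) s1"
      by (rule c_static_bounded[of "{4}"]) (use le(1) k s1(2) in \<open>auto simp: cGreedy_def a_static_Times\<close>)
    moreover have "c_bounded U (Asg 31 (N 0) (Sum 50 4 (V 30))) s2"
      using le(1) k by (simp add: fr1)
    moreover have "c_bounded U (Asg 32 (N 0) (Times 4 (Sum 50 31 (V 31)))) s3"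
      by (rule c_static_bounded[of "{31}"]) (use le(2) s3 in \<open>auto simp: a_static_Times\<close>)
    moreover have "c_bounded U (For 36 32 (Asg 33 (N 0) (Plus (V 33) (V 33)))) s5"
      by (rule c_static_bounded[of "{32}"]) (use le(3) s4 s5 in auto)
    moreover have "c_bounded U (Asg 37 (N 0) (Sum 50 31 (V 32))) s6"
      using le(2) s3(1) by (simp add: s6(2) s5(2) s4(2))
    moreover have "c_bounded U (Asg 7 (N 0) (Times 64 (Sum 50 37 (V 33)))) s7"
      by (rule c_static_bounded[of "{37}"]) (use le(4) s7 in \<open>auto simp: a_static_Times\<close>)
    moreover have "c_bounded U (For 36 7 (Asg 34 (N 0) (Plus (V 34) (V 34)))) s9"
      by (rule c_static_bounded[of "{7}"]) (use le(5) s9 s8 in auto)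
    moreover have "c_bounded U (Asg 8 (N 0) (Plus (Times 2 (Plus (Sum 50 7 (V 34)) (V 34))) (Plus (V 5) (N 2)))) s11"
      by (rule c_static_bounded[of "{7}"]) (use le(5) s8(1) in \<open>auto simp: a_static_Times s11(2) s10(2) s9(2)\<close>)
    moreover have "c_bounded U (Asg 10 (N 0) (Sum 50 5 (V 5))) s12" "c_bounded U (Asg 35 (N 0) (Sum 50 5 (Plus (V 10) (N 2)))) s13"
      using le(6) s11(1) by (simp_all add: s12(2) s13(2))
    moreover have "c_bounded U cPowers s15"
      by (rule c_static_bounded[of "{8, 35}"])
        (use le(7,8) s14 s12(1) s13(2) s15 in \<open>auto simp: cPowers_def\<close>)
    moreover have "c_bounded U (Asg b (N i) (N j)) u" "c_bounded U (Asg b (N i) (Plus (V x) (V y))) u"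
      "c_bounded U (Asg 9 (N 0) (Rd 27 (V 35))) u" for b i j x y u
      by simp_all
    ultimately show ?thesis
      unfolding cParam_def c_bounded.simps(3) s1_def[symmetric] s2_def[symmetric] s3_def[symmetric] s4_def[symmetric]
        s5_def[symmetric] s6_def[symmetric] s7_def[symmetric] s8_def[symmetric] s9_def[symmetric] s10_def[symmetric]
        s11_def[symmetric] s12_def[symmetric] s13_def[symmetric] s14_def[symmetric] s15_def[symmetric] s16_def[symmetric]
      by blast
  qed
qed

section \<open>Computability of the time bound\<close>

lemma computable_cmd:
  assumes below: "c_below r c" "0 < r" and bounded: "\<And>n. \<exists>U. c_bounded U c (load [n])"
    and h: "\<And>n. exec c (load [n]) 0 0 = h n"
  shows "computable h"
  unfolding computable_def
proof (intro exI[of _ "c_comp c r"] allI)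
  fix n
  obtain U where "c_bounded U c (load [n])"
    using bounded by blast
  from c_comp_correct[OF below(1) this] obtain s where
    "runs (c_comp c r) (load [n]) (c_time U c) s" "\<forall>b<r. s b = exec c (load [n]) b"
    by blast
  then show "\<exists>T s. run (c_comp c r) (load [n]) T s \<and> s 0 0 = h n"
    using h below(2) unfolding runs_def by metis
qed

primrec cPower :: "nat \<Rightarrow> cmd" where
  "cPower 0 = Nop"
| "cPower (Suc e) = Sq (cPower e) (Asg 39 (N 0) (Sum 50 38 (V 39)))"

lemma cPower_static: "c_static {38} (cPower e)"
  by (induction e) simp_all

lemma cPower_below: "c_below 61 (cPower e)"
  by (induction e) simp_all

lemma exec_cPower: "exec (cPower e) s 39 0 = s 38 0 ^ e * s 39 0"
proof (induction e)
  case (Suc e)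
  have "exec (cPower e) s 38 = s 38"
    by (rule c_static_frame[OF cPower_static]) simp
  with Suc show ?case
    by (simp add: put_apply)
qed simp

definition cTimeBound :: "nat \<Rightarrow> nat \<Rightarrow> nat \<Rightarrow> cmd" where
  "cTimeBound T A e = Sq (Asg 4 (N 0) (Rd 0 (N 0))) (Sq (cParam T) (Sq (Asg 38 (N 0) (Plus (V 4) (Plus (V 31)
     (Plus (V 32) (Plus (V 37) (Plus (V 7) (Plus (V 5) (Plus (V 10) (Plus (V 35) (Plus (V 8) (Plus (V 9) (N 2))))))))))))
     (Sq (Asg 39 (N 0) (N A)) (Sq (cPower e) (Asg 0 (N 0) (V 39))))))"

text \<open>The parameter program of the search itself is used, followed by \<open>e\<close>
  multiplications.\<close>

lemma computable_time_bound: "computable (\<lambda>k. A * (param_bound T k + 2) ^ e)"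
proof (rule computable_cmd)
  show "c_below 61 (cTimeBound T A e)"
    by (simp add: cTimeBound_def cParam_below cPower_below)
  fix k
  define s1 where "s1 = exec (Asg 4 (N 0) (Rd 0 (N 0))) (load [k])"
  have k: "s1 4 0 = k"
    by (simp add: s1_def load_def)
  note p = exec_cParam[where s = s1 and k = k and T = T, OF k]
  define s2 where "s2 = exec (cParam T) s1"
  define s3 where "s3 = exec (Asg 38 (N 0) (Plus (V 4) (Plus (V 31)
     (Plus (V 32) (Plus (V 37) (Plus (V 7) (Plus (V 5) (Plus (V 10) (Plus (V 35) (Plus (V 8) (Plus (V 9) (N 2)))))))))))) s2"
  have s3: "s3 38 0 = param_bound T k + 2"
    using p(1-9) p(11)[of 4] k by (simp add: s3_def s2_def param_bound_def)
  define s4 where "s4 = exec (Asg 39 (N 0) (N A)) s3"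
  have s4: "s4 38 0 = param_bound T k + 2" "s4 39 0 = A"
    using s3 by (simp_all add: s4_def)
  have "exec (cTimeBound T A e) (load [k]) = exec (Asg 0 (N 0) (V 39)) (exec (cPower e) s4)"
    by (simp only: cTimeBound_def exec.simps(3) s1_def s2_def s3_def s4_def)
  then show "exec (cTimeBound T A e) (load [k]) 0 0 = A * (param_bound T k + 2) ^ e"
    using exec_cPower[of e s4] s4 by simp
  let ?U = "param_bound T k + 2"
  have "c_bounded ?U (cParam T) s1"
    by (rule p(12)) simp
  moreover have "c_bounded ?U (cPower e) s4"
    by (rule c_static_bounded[OF cPower_static]) (simp add: s4)
  moreover have "c_bounded ?U (Asg 4 (N 0) (Rd 0 (N 0))) t" "c_bounded ?U (Asg 39 (N 0) (N A)) t"
    "c_bounded ?U (Asg 0 (N 0) (V 39)) t"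
    "c_bounded ?U (Asg 38 (N 0) (Plus (V 4) (Plus (V 31) (Plus (V 32) (Plus (V 37) (Plus (V 7) (Plus (V 5)
       (Plus (V 10) (Plus (V 35) (Plus (V 8) (Plus (V 9) (N 2)))))))))))) t" for t
    by simp_all
  ultimately have "c_bounded ?U (cTimeBound T A e) (load [k])"
    unfolding cTimeBound_def c_bounded.simps(3) s1_def[symmetric] s2_def[symmetric] s3_def[symmetric] s4_def[symmetric]
    by blast
  then show "\<exists>U. c_bounded U (cTimeBound T A e) (load [k])"
    by blast
qed simp

section \<open>The search on an input word\<close>

definition word_E :: "(nat \<Rightarrow> nat) \<Rightarrow> nat \<Rightarrow> nat \<Rightarrow> nat \<Rightarrow> nat \<Rightarrow> bool" where
  "word_E inp m n x y \<longleftrightarrow> x < m \<and> m \<le> y \<and> y < m + n \<and> inp (2 + (n * x + (y - m))) \<noteq> 0"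

definition word_EP :: "(nat \<Rightarrow> nat) \<Rightarrow> nat \<Rightarrow> nat \<Rightarrow> nat \<Rightarrow> nat \<Rightarrow> bool" where
  "word_EP inp off k p q \<longleftrightarrow> p < k \<and> k \<le> q \<and> q < 2 * k \<and> inp (off + (2 + (k * p + (q - k)))) \<noteq> 0"

lemma search_program_word:
  assumes "0 < m" "0 < n"
  shows "search_program (m + n) (2 * k) (word_E inp m n) (word_EP inp off k) inp m n off k
    (param_d T k) (param_Q T k) (param_D k) (param_W k)"
  by unfold_locales (use assms in \<open>auto simp: word_E_def word_EP_def param_Q_def param_D_def param_W_def\<close>)

text \<open>If \<open>m\<close> or \<open>n\<close> is \<open>0\<close>, the other one is not bounded by the size of the matrix, so that no loop may
  run up to it.\<close>

definition cMain :: "nat \<Rightarrow> cmd" where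
  "cMain T = Sq (Asg 1 (N 0) (Rd 0 (N 0))) (Sq (Asg 2 (N 0) (Rd 0 (N 1)))
     (Sq (If (Conj (V 1) (V 2)) (Asg 3 (N 0) (Plus (N 2) (Sum 50 1 (V 2)))) (Asg 3 (N 0) (N 2)))
     (Sq (Asg 4 (N 0) (Rd 0 (V 3))) (If (Conj (V 4) (Conj (V 1) (V 2)))
        (Sq (Asg 6 (N 0) (Plus (V 1) (V 2))) (Sq (cParam T) search_program.cSearch))
        (Asg 0 (N 0) (Equal (V 4) (N 0)))))))"

text \<open>The command does not depend on the parameters of the locale, so any instance yields
  these facts; a \<open>1 \<times> 1\<close> matrix with the empty pattern is used.\<close>

lemma cSearch_facts:
  "c_static {1, 2, 4, 5, 6, 8, 9, 10} search_program.cSearch" "c_below 61 search_program.cSearch"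
proof -
  interpret search_program "1 + 1" "2 * 0" "word_E (\<lambda>_. 0) 1 1" "word_EP (\<lambda>_. 0) 0 0" "\<lambda>_. 0" 1 1 0 0
    "param_d 0 0" "param_Q 0 0" "param_D 0" "param_W 0"
    by (rule search_program_word) simp_all
  show "c_static {1, 2, 4, 5, 6, 8, 9, 10} search_program.cSearch" "c_below 61 search_program.cSearch"
    by (fact cSearch_static cSearch_below)+
qed

lemma cMain_below: "c_below 61 (cMain T)"
  by (simp add: cMain_def cParam_below cSearch_facts abbrev_defs)

lemma exec_cMain_trivial:
  assumes s: "s 0 0 = m" "s 0 1 = n" "s 0 (2 + m * n) = k" and triv: "k = 0 \<or> m = 0 \<or> n = 0"
    and U: "m * n + 2 \<le> U"
  shows "exec (cMain T) s 0 0 = of_bool (k = 0)" and "c_bounded U (cMain T) s"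
proof -
  define s1 where "s1 = exec (Asg 2 (N 0) (Rd 0 (N 1))) (exec (Asg 1 (N 0) (Rd 0 (N 0))) s)"
  have s1: "s1 1 0 = m" "s1 2 0 = n" "s1 0 = s 0"
    using s by (simp_all add: s1_def)
  define s2 where "s2 = exec (If (Conj (V 1) (V 2)) (Asg 3 (N 0) (Plus (N 2) (Sum 50 1 (V 2)))) (Asg 3 (N 0) (N 2))) s1"
  have s2: "s2 3 0 = 2 + m * n" "\<And>c. c \<noteq> 3 \<Longrightarrow> s2 c = s1 c"
    using s1 by (auto simp: s2_def put_apply)
  define s3 where "s3 = exec (Asg 4 (N 0) (Rd 0 (V 3))) s2"
  have s3: "s3 4 0 = k" "\<And>c. c \<noteq> 4 \<Longrightarrow> s3 c = s2 c"
    using s s2 s1 by (simp_all add: s3_def)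
  have cond: "aval (Conj (V 4) (Conj (V 1) (V 2))) s3 = 0"
    using s3 s2(2) s1 triv by auto
  have "exec (cMain T) s = exec (Asg 0 (N 0) (Equal (V 4) (N 0))) s3"
    unfolding cMain_def exec.simps(3) s1_def[symmetric] s2_def[symmetric] s3_def[symmetric]
    by (subst exec.simps(4)) (simp only: cond if_False simp_thms)
  then show "exec (cMain T) s 0 0 = of_bool (k = 0)"
    using s3(1) by simp
  \<comment> \<open>The loop for the product is entered only if both dimensions are nonzero, and
    then \<open>m \<le> m * n\<close>.\<close>
  have "n = 0 \<or> m \<le> U"
    using U by (cases n) auto
  then have "c_bounded U (If (Conj (V 1) (V 2)) (Asg 3 (N 0) (Plus (N 2) (Sum 50 1 (V 2)))) (Asg 3 (N 0) (N 2))) s1"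
    using s1 by (auto simp: Conj_def)
  moreover have "c_bounded U (If (Conj (V 4) (Conj (V 1) (V 2)))
        (Sq (Asg 6 (N 0) (Plus (V 1) (V 2))) (Sq (cParam T) search_program.cSearch))
        (Asg 0 (N 0) (Equal (V 4) (N 0)))) s3"
    by (subst c_bounded.simps(4)) (simp only: cond if_False simp_thms, simp add: abbrev_defs)
  moreover have "c_bounded U (Asg 1 (N 0) (Rd 0 (N 0))) t" "c_bounded U (Asg 2 (N 0) (Rd 0 (N 1))) t"
    "c_bounded U (Asg 4 (N 0) (Rd 0 (V 3))) t" for t
    by simp_all
  ultimately show "c_bounded U (cMain T) s"
    unfolding cMain_def c_bounded.simps(3) exec.simps(3) s1_def[symmetric] s2_def[symmetric] s3_def[symmetric]
    by (simp only: s1_def[symmetric] s2_def[symmetric] s3_def[symmetric] simp_thms)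
qed

lemma exec_cMain:
  assumes s: "s 0 0 = m" "s 0 1 = n" "s 0 (2 + m * n) = k" "s 26 = (\<lambda>_. 0)" and pos: "0 < k" "0 < m" "0 < n"
    and stuck: "\<And>P. line_graph.good_partition (m + n) (word_E (s 0) m n) (param_d T k) P \<Longrightarrow>
      \<forall>v. \<not> line_graph.mergeable (m + n) (word_E (s 0) m n) (param_d T k) P v \<Longrightarrow> 0 < P (m + n - 1) \<Longrightarrow>
      \<exists>f. search_program.embedding (m + n) (2 * k) (word_E (s 0) m n) (word_EP (s 0) (2 + m * n) k) f"
    and U: "m * n + 2 + param_bound T k \<le> U"
  shows "exec (cMain T) s 0 0 =
      of_bool (\<exists>f. search_program.embedding (m + n) (2 * k) (word_E (s 0) m n) (word_EP (s 0) (2 + m * n) k) f)"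
    and "c_bounded U (cMain T) s"
proof -
  interpret search_program "m + n" "2 * k" "word_E (s 0) m n" "word_EP (s 0) (2 + m * n) k" "s 0" m n "2 + m * n" k
    "param_d T k" "param_Q T k" "param_D k" "param_W k"
    by (rule search_program_word[OF pos(2,3)])
  define s1 where "s1 = exec (Asg 2 (N 0) (Rd 0 (N 1))) (exec (Asg 1 (N 0) (Rd 0 (N 0))) s)"
  have s1: "s1 1 0 = m" "s1 2 0 = n" "\<And>c. c \<notin> {1, 2} \<Longrightarrow> s1 c = s c"
    using s by (simp_all add: s1_def)
  define s2 where "s2 = exec (If (Conj (V 1) (V 2)) (Asg 3 (N 0) (Plus (N 2) (Sum 50 1 (V 2)))) (Asg 3 (N 0) (N 2))) s1"
  have s2: "s2 3 0 = 2 + m * n" "\<And>c. c \<noteq> 3 \<Longrightarrow> s2 c = s1 c"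
    using s1 pos by (auto simp: s2_def put_apply)
  define s3 where "s3 = exec (Asg 4 (N 0) (Rd 0 (V 3))) s2"
  have s3: "s3 4 0 = k" "\<And>c. c \<noteq> 4 \<Longrightarrow> s3 c = s2 c"
    using s s2 s1 by (simp_all add: s3_def)
  have cond: "aval (Conj (V 4) (Conj (V 1) (V 2))) s3 = 1"
    using s3 s2(2) s1 pos by simp
  define s4 where "s4 = exec (Asg 6 (N 0) (Plus (V 1) (V 2))) s3"
  have s4: "s4 6 0 = m + n" "\<And>c. c \<noteq> 6 \<Longrightarrow> s4 c = s3 c"
    using s3(2) s2(2) s1 by (simp_all add: s4_def)
  have k4: "s4 4 0 = k"
    by (simp add: s4(2) s3(1))
  note p = exec_cParam[where s = s4 and k = k and T = T, OF k4]
  define s5 where "s5 = exec (cParam T) s4"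
  note s5 = p(1-11)[folded s5_def]
  have c5: "s5 1 0 = m" "s5 2 0 = n" "s5 3 0 = 2 + m * n" "s5 4 0 = k" "s5 6 0 = m + n"
    "s5 0 = s 0" "s5 26 = s 26"
    using s1 s2 s3 s4 s5(11) by simp_all
  have env: "env s5"
    unfolding env_def H_def using c5 s5(4-10) by simp
  have eq: "exec (cMain T) s = exec search_program.cSearch s5"
    unfolding cMain_def exec.simps(3) s1_def[symmetric] s2_def[symmetric] s3_def[symmetric]
    by (subst exec.simps(4)) (simp only: cond if_True simp_thms one_neq_zero exec.simps(3) s4_def[symmetric] s5_def[symmetric] not_False_eq_True)
  show "exec (cMain T) s 0 0 =
      of_bool (\<exists>f. search_program.embedding (m + n) (2 * k) (word_E (s 0) m n) (word_EP (s 0) (2 + m * n) k) f)"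
    unfolding eq using exec_cSearch[OF env _ pos(1)] c5(7) s(4) stuck by simp
  \<comment> \<open>The number of lines is at most the number of entries plus one, as
    \<open>(m - 1) * (n - 1)\<close> is not negative. So loops over the lines respect the size of
    the matrix.\<close>
  have mn: "m + n \<le> m * n + 1" "m \<le> m * n" "n \<le> m * n"
  proof -
    have "(m - 1) * (n - 1) + (m + n) = m * n + 1"
      using pos by (cases m; cases n) simp_all
    then show "m + n \<le> m * n + 1"
      by linarith
  qed (use pos in simp_all)
  have le: "k \<le> U" "2 * k \<le> U" "param_W k \<le> U" "param_Q T k \<le> U" "param_Q T k ^ param_D k \<le> U" "param_bound T k \<le> U"
    using U unfolding param_bound_def by linarith+
  have offset: "c_bounded U (If (Conj (V 1) (V 2)) (Asg 3 (N 0) (Plus (N 2) (Sum 50 1 (V 2)))) (Asg 3 (N 0) (N 2))) s1"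
    using s1 U mn by (simp add: Conj_def)
  have "c_bounded U (cParam T) s4"
    by (rule p(12)) (rule le(6))
  moreover have "c_bounded U search_program.cSearch s5"
    by (rule c_static_bounded[OF cSearch_facts(1)]) (use mn U le c5 s5(5,6,8,9) in auto)
  moreover have "c_bounded U (Asg 6 (N 0) (Plus (V 1) (V 2))) s3" "a_bounded U (Conj (V 4) (Conj (V 1) (V 2))) s3"
    by (simp_all add: Conj_def)
  ultimately have "c_bounded U (If (Conj (V 4) (Conj (V 1) (V 2)))
        (Sq (Asg 6 (N 0) (Plus (V 1) (V 2))) (Sq (cParam T) search_program.cSearch))
        (Asg 0 (N 0) (Equal (V 4) (N 0)))) s3"
    by (simp only: c_bounded.simps(3,4) cond s4_def[symmetric] s5_def[symmetric] simp_thms if_True one_neq_zero)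
  moreover have "c_bounded U (Asg 1 (N 0) (Rd 0 (N 0))) t" "c_bounded U (Asg 2 (N 0) (Rd 0 (N 1))) t"
    "c_bounded U (Asg 4 (N 0) (Rd 0 (V 3))) t" for t
    by simp_all
  ultimately show "c_bounded U (cMain T) s"
    using offset
    unfolding cMain_def c_bounded.simps(3) exec.simps(3) s1_def[symmetric] s2_def[symmetric] s3_def[symmetric]
    by (simp only: s1_def[symmetric] s2_def[symmetric] s3_def[symmetric] simp_thms)
qed

section \<open>Submatrices as embeddings\<close>

lemma pick_strict_mono_image:
  assumes f: "strict_mono_on {..<r} f" and i: "i < r"
  shows "pick (f ` {..<r}) i = f i"
proof -
  have "{a \<in> f ` {..<r}. a < f i} = f ` {..<i}"
    using f i by (auto simp: strict_mono_on_less image_iff)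
  moreover have "inj_on f {..<i}"
    using strict_mono_on_imp_inj_on[OF f] i by (auto intro: inj_on_subset)
  ultimately have "card {a \<in> f ` {..<r}. a < f i} = i"
    by (simp add: card_image)
  then show ?thesis
    using pick_card_in_set[of "f i" "f ` {..<r}"] i by simp
qed

text \<open>\<open>pick\<close> enumerates an index set increasingly; conversely, the images of two
  increasing maps serve as index sets.\<close>

lemma is_submatrix_iff:
  "is_submatrix A M \<longleftrightarrow> (\<exists>f g. strict_mono_on {..<dim_row A} f \<and> strict_mono_on {..<dim_col A} g \<and>
     (\<forall>i<dim_row A. f i < dim_row M) \<and> (\<forall>j<dim_col A. g j < dim_col M) \<and>
     (\<forall>i<dim_row A. \<forall>j<dim_col A. A $$ (i, j) = M $$ (f i, g j)))" (is "_ \<longleftrightarrow> ?R")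
proof
  assume "is_submatrix A M"
  then obtain I J where A: "A = submatrix M I J"
    by (auto simp: is_submatrix_def)
  have mono: "strict_mono_on {..<card {a. a < l \<and> a \<in> S}} (pick S)" for l and S :: "nat set"
  proof (rule strict_mono_onI)
    fix a b assume ab: "a \<in> {..<card {a. a < l \<and> a \<in> S}}" "b \<in> {..<card {a. a < l \<and> a \<in> S}}" "a < b"
    then have "pick {a. a < l \<and> a \<in> S} a < pick {a. a < l \<and> a \<in> S} b"
      by (intro pick_mono_le) simp_all
    then show "pick S a < pick S b"
      using ab pick_reduce_set[of a l S] pick_reduce_set[of b l S] by simp
  qed
  show ?R
  proof (rule exI[of _ "pick I"], rule exI[of _ "pick J"], intro conjI allI impI)
    show "strict_mono_on {..<dim_row A} (pick I)" "strict_mono_on {..<dim_col A} (pick J)"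
      unfolding A dim_submatrix by (rule mono)+
    show "pick I i < dim_row M" if "i < dim_row A" for i
      using that unfolding A dim_submatrix by (rule pick_le)
    show "pick J j < dim_col M" if "j < dim_col A" for j
      using that unfolding A dim_submatrix by (rule pick_le)
    show "A $$ (i, j) = M $$ (pick I i, pick J j)" if "i < dim_row A" "j < dim_col A" for i j
      using that unfolding A dim_submatrix by (rule submatrix_index)
  qed
next
  assume ?R
  then obtain f g where f: "strict_mono_on {..<dim_row A} f" "\<forall>i<dim_row A. f i < dim_row M"
    and g: "strict_mono_on {..<dim_col A} g" "\<forall>j<dim_col A. g j < dim_col M"
    and eq: "\<forall>i<dim_row A. \<forall>j<dim_col A. A $$ (i, j) = M $$ (f i, g j)"
    by blast
  have card: "card {a. a < l \<and> a \<in> h ` {..<r}} = r" if "strict_mono_on {..<r} h" "\<forall>i<r. h i < l" for h :: "nat \<Rightarrow> nat" and r l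
  proof -
    have "{a. a < l \<and> a \<in> h ` {..<r}} = h ` {..<r}"
      using that(2) by auto
    then show ?thesis
      using strict_mono_on_imp_inj_on[OF that(1)] by (simp add: card_image)
  qed
  have "A = submatrix M (f ` {..<dim_row A}) (g ` {..<dim_col A})"
    by (rule eq_matI) (simp_all add: dim_submatrix submatrix_index card[OF f] card[OF g]
        pick_strict_mono_image[OF f(1)] pick_strict_mono_image[OF g(1)] eq)
  then show "is_submatrix A M"
    unfolding is_submatrix_def by blast
qed

lemma zero_one_entry: "zero_one_mat M \<Longrightarrow> i < dim_row M \<Longrightarrow> j < dim_col M \<Longrightarrow> M $$ (i, j) = of_bool (M $$ (i, j) \<noteq> 0)"
  by (force simp: zero_one_mat_def elements_mat_def)

lemma permutation_matrix_bij:
  assumes P: "permutation_matrix k P"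
  obtains \<sigma> where "bij_betw \<sigma> {..<k} {..<k}"
    and "\<And>i j. i < k \<Longrightarrow> j < k \<Longrightarrow> P $$ (i, j) \<noteq> 0 \<longleftrightarrow> \<sigma> i = j"
proof -
  have dim: "dim_row P = k" "dim_col P = k" and z: "zero_one_mat P"
    and rows: "\<forall>i<k. \<exists>!j. j < k \<and> P $$ (i, j) = 1" and cols: "\<forall>j<k. \<exists>!i. i < k \<and> P $$ (i, j) = 1"
    using P by (auto simp: permutation_matrix_def)
  have nz: "P $$ (i, j) \<noteq> 0 \<longleftrightarrow> P $$ (i, j) = 1" if "i < k" "j < k" for i j
    using zero_one_entry[OF z, of i j] dim that by (auto split: if_splits)
  obtain \<sigma> where \<sigma>: "\<forall>i<k. \<sigma> i < k \<and> P $$ (i, \<sigma> i) = 1"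
    using rows by metis
  have iff: "P $$ (i, j) \<noteq> 0 \<longleftrightarrow> \<sigma> i = j" if "i < k" "j < k" for i j
    using nz[OF that] \<sigma> rows that by blast
  have "inj_on \<sigma> {..<k}"
    by (rule inj_onI) (use \<sigma> cols in \<open>metis lessThan_iff\<close>)
  moreover have "\<sigma> ` {..<k} \<subseteq> {..<k}"
    using \<sigma> by auto
  ultimately have "bij_betw \<sigma> {..<k} {..<k}"
    by (simp add: bij_betw_def endo_inj_surj)
  with iff show ?thesis
    using that by blast
qed

lemma greedy_size_pos: "0 < T \<Longrightarrow> 0 < k \<Longrightarrow> 0 < greedy_size T k"
  by (cases k) simp_all

context
  fixes M P :: "nat mat" and m n k :: nat and E EP :: "nat \<Rightarrow> nat \<Rightarrow> bool"
  assumes M: "dim_row M = m" "dim_col M = n" "zero_one_mat M" and P: "permutation_matrix k P"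
    and E: "\<And>x y. E x y \<longleftrightarrow> x < m \<and> m \<le> y \<and> y < m + n \<and> M $$ (x, y - m) \<noteq> 0"
    and EP: "\<And>p q. EP p q \<longleftrightarrow> p < k \<and> k \<le> q \<and> q < 2 * k \<and> P $$ (p, q - k) \<noteq> 0"
begin

lemma P_facts: "dim_row P = k" "dim_col P = k" "zero_one_mat P"
  using P by (auto simp: permutation_matrix_def)

text \<open>Every row and every column of \<open>P\<close> contains a one, and \<open>E\<close>
  leads from rows to columns. This alone forces \<open>f\<close> to choose rows and \<open>g\<close>
  to choose columns.\<close>

lemma submatrixI:
  assumes f: "strict_mono_on {..<k} f" and g: "strict_mono_on {..<k} g"
    and eq: "\<And>i j. i < k \<Longrightarrow> j < k \<Longrightarrow> E (f i) (g j) \<longleftrightarrow> P $$ (i, j) \<noteq> 0"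
  shows "is_submatrix P M"
proof -
  obtain \<sigma> where \<sigma>: "bij_betw \<sigma> {..<k} {..<k}" "\<And>i j. i < k \<Longrightarrow> j < k \<Longrightarrow> P $$ (i, j) \<noteq> 0 \<longleftrightarrow> \<sigma> i = j"
    using permutation_matrix_bij[OF P] by blast
  have fm: "f i < m" if "i < k" for i
  proof -
    have "\<sigma> i < k"
      using \<sigma>(1) that by (auto simp: bij_betw_def)
    then have "E (f i) (g (\<sigma> i))"
      using eq \<sigma>(2) that by simp
    then show ?thesis
      by (simp add: E)
  qed
  have gm: "m \<le> g j \<and> g j < m + n" if "j < k" for j
  proof -
    have "j \<in> \<sigma> ` {..<k}"
      using \<sigma>(1) that by (simp add: bij_betw_def)
    then obtain i where "i < k" "\<sigma> i = j"
      by auto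
    then have "E (f i) (g j)"
      using eq \<sigma>(2) that by simp
    then show ?thesis
      by (simp add: E)
  qed
  have "strict_mono_on {..<k} (\<lambda>j. g j - m)"
    using g gm by (auto simp: strict_mono_on_def diff_less_mono)
  moreover have "P $$ (i, j) = M $$ (f i, g j - m)" if ij: "i < k" "j < k" for i j
  proof -
    have gj: "m \<le> g j" "g j < m + n" "g j - m < n"
      using gm[OF ij(2)] by linarith+
    then have "M $$ (f i, g j - m) \<noteq> 0 \<longleftrightarrow> P $$ (i, j) \<noteq> 0"
      using eq[OF ij] fm[OF ij(1)] by (simp add: E)
    then show ?thesis
      using zero_one_entry[OF M(3), of "f i" "g j - m"] zero_one_entry[OF P_facts(3), of i j] ij M P_facts fm[OF ij(1)] gj
      by simp
  qed
  moreover have "g j - m < n" if "j < k" for j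
    using gm[OF that] by linarith
  ultimately show ?thesis
    unfolding is_submatrix_iff P_facts M using f fm by blast
qed

text \<open>Pattern vertices below \<open>k\<close> are the rows of \<open>P\<close>, the others its
  columns. Two rows or two columns are never joined, neither in the pattern nor in the matrix, so
  only the order matters for them.\<close>

lemma embedding_iff_submatrix:
  "(\<exists>F. \<forall>p<2 * k. F p < m + n \<and> (\<forall>q<2 * k. p < q \<longrightarrow> F p < F q \<and> (E (F p) (F q) \<longleftrightarrow> EP p q))) \<longleftrightarrow>
    is_submatrix P M"
proof
  assume "\<exists>F. \<forall>p<2 * k. F p < m + n \<and> (\<forall>q<2 * k. p < q \<longrightarrow> F p < F q \<and> (E (F p) (F q) \<longleftrightarrow> EP p q))"
  then obtain F where F: "\<And>p q. p < 2 * k \<Longrightarrow> q < 2 * k \<Longrightarrow> p < q \<Longrightarrow> F p < F q \<and> (E (F p) (F q) \<longleftrightarrow> EP p q)"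
    by blast
  show "is_submatrix P M"
  proof (rule submatrixI)
    show "strict_mono_on {..<k} F" "strict_mono_on {..<k} (\<lambda>j. F (k + j))"
      using F by (auto simp: strict_mono_on_def)
    show "E (F i) (F (k + j)) \<longleftrightarrow> P $$ (i, j) \<noteq> 0" if "i < k" "j < k" for i j
      using F[of i "k + j"] that by (simp add: EP)
  qed
next
  assume "is_submatrix P M"
  then obtain f g where f: "strict_mono_on {..<k} f" "\<forall>i<k. f i < m"
    and g: "strict_mono_on {..<k} g" "\<forall>j<k. g j < n"
    and eq: "\<forall>i<k. \<forall>j<k. P $$ (i, j) = M $$ (f i, g j)"
    unfolding is_submatrix_iff P_facts M by blast
  define F where "F p = (if p < k then f p else m + g (p - k))" for p
  have "F p < m + n \<and> (\<forall>q<2 * k. p < q \<longrightarrow> F p < F q \<and> (E (F p) (F q) \<longleftrightarrow> EP p q))" if p: "p < 2 * k" for p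
  proof (intro conjI allI impI)
    show "F p < m + n"
      using f(2) g(2) p by (simp add: F_def trans_less_add1)
    fix q assume q: "q < 2 * k" "p < q"
    consider "q < k" | "p < k" "k \<le> q" | "k \<le> p" "k \<le> q"
      using q by linarith
    then have "F p < F q \<and> (E (F p) (F q) \<longleftrightarrow> EP p q)"
    proof cases
      case 1
      then show ?thesis
        using f q by (auto simp: F_def E EP strict_mono_on_def dest: leD)
    next
      case 2
      then have "f p < m" "q - k < k" "g (q - k) < n"
        using f(2) g(2) q by simp_all
      then show ?thesis
        using 2 q eq by (simp add: F_def E EP)
    next
      case 3
      then have "p - k < k" "q - k < k" "p - k < q - k"
        using q by linarith+
      then have "g (p - k) < g (q - k)"
        using g(1) by (auto simp: strict_mono_on_def)
      then show ?thesis
        using 3 q by (simp add: F_def E EP)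
    qed
    then show "F p < F q" "E (F p) (F q) \<longleftrightarrow> EP p q"
      by blast+
  qed
  then show "\<exists>F. \<forall>p<2 * k. F p < m + n \<and> (\<forall>q<2 * k. p < q \<longrightarrow> F p < F q \<and> (E (F p) (F q) \<longleftrightarrow> EP p q))"
    by blast
qed

text \<open>As \<open>t\<close> is positive, every line of the biclique has an edge in it; hence
  \<open>X\<close> consists of rows and \<open>Y\<close> of columns.\<close>

lemma biclique_free_matrix:
  assumes t: "0 < t" and no: "\<not> is_submatrix (all_ones_mat t) M"
  shows "biclique_free t E"
  unfolding biclique_free_def
proof
  assume "\<exists>X Y. card X = t \<and> card Y = t \<and> (\<forall>x\<in>X. \<forall>y\<in>Y. E x y)"
  then obtain X Y where XY: "card X = t" "card Y = t" "\<And>x y. x \<in> X \<Longrightarrow> y \<in> Y \<Longrightarrow> E x y"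
    by blast
  then have fin: "finite X" "finite Y"
    using t card_ge_0_finite by metis+
  obtain f where f: "strict_mono_on {..<t} f" "\<And>a. a < t \<Longrightarrow> f a \<in> X"
    using strict_mono_choice[OF fin(1), of t] XY(1) by blast
  obtain g where g: "strict_mono_on {..<t} g" "\<And>a. a < t \<Longrightarrow> g a \<in> Y"
    using strict_mono_choice[OF fin(2), of t] XY(2) by blast
  have e: "E (f i) (g j)" if "i < t" "j < t" for i j
    using XY(3) f(2) g(2) that by blast
  have fm: "f i < m" if "i < t" for i
    using e[OF that t] by (simp add: E)
  have gm: "m \<le> g j \<and> g j < m + n" if "j < t" for j
    using e[OF t that] by (simp add: E)
  have gn: "g j - m < n" if "j < t" for j
    using gm[OF that] by linarith
  have "strict_mono_on {..<t} (\<lambda>j. g j - m)"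
    using g(1) gm by (auto simp: strict_mono_on_def diff_less_mono)
  moreover have "all_ones_mat t $$ (i, j) = M $$ (f i, g j - m)" if "i < t" "j < t" for i j
    using zero_one_entry[OF M(3), of "f i" "g j - m"] e[OF that] fm gn that M by (simp add: E all_ones_mat_def)
  moreover have "dim_row (all_ones_mat t) = t" "dim_col (all_ones_mat t) = t"
    by (simp_all add: all_ones_mat_def)
  ultimately have "is_submatrix (all_ones_mat t) M"
    unfolding is_submatrix_iff M using f(1) fm gn
    by (intro exI[of _ f] exI[of _ "\<lambda>j. g j - m"] conjI) simp_all
  with no show False
    by contradiction
qed

text \<open>\<open>param_d\<close> is the degree bound belonging to the size of the inflation, so
  the quotient yields the inflation of \<open>\<sigma>\<close> as a pattern, and the greedy
  selection thins it out to \<open>\<sigma>\<close>.\<close>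

lemma stuck_submatrix:
  assumes t: "0 < t" and no: "\<not> is_submatrix (all_ones_mat t) M" and k: "0 < k"
    and lg: "line_graph E" and good: "line_graph.good_partition (m + n) E (param_d (two_colour_bound t) k) Q"
    and stuck: "\<forall>v. \<not> line_graph.mergeable (m + n) E (param_d (two_colour_bound t) k) Q v" and parts: "0 < Q (m + n - 1)"
  shows "is_submatrix P M"
proof -
  obtain \<sigma> where \<sigma>: "bij_betw \<sigma> {..<k} {..<k}" "\<And>i j. i < k \<Longrightarrow> j < k \<Longrightarrow> P $$ (i, j) \<noteq> 0 \<longleftrightarrow> \<sigma> i = j"
    using permutation_matrix_bij[OF P] by blast
  let ?N = "greedy_size (two_colour_bound t) k"
  have "0 < ?N"
    using k by (intro greedy_size_pos) (simp_all add: two_colour_bound_def)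
  with k have r: "0 < k * ?N"
    by simp
  have "contains_perm (k * ?N) (inflate ?N \<sigma>) {(x, y). E x y}"
    by (rule line_graph.stuck_contains_perm[OF lg good _ parts bij_betw_inflate[OF \<sigma>(1)] r])
      (use stuck in \<open>simp_all add: param_d_def param_r_def\<close>)
  from induced_perm_of_contains_perm[OF biclique_free_matrix[OF t no] \<sigma>(1) refl this]
  obtain f g where fg: "strict_mono_on {..<k} f" "strict_mono_on {..<k} g"
    "\<forall>i<k. \<forall>j<k. E (f i) (g j) \<longleftrightarrow> \<sigma> i = j"
    by blast
  show ?thesis
    by (rule submatrixI[OF fg(1,2)]) (use fg(3) \<sigma>(2) in simp)
qed

end

section \<open>The input word\<close>

lemma length_concat_rows: "length (concat (map (\<lambda>i. map (f i) [0..<n]) [0..<m])) = m * n"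
  by (induction m) simp_all

lemma nth_concat_rows:
  "x < m \<Longrightarrow> y < n \<Longrightarrow> concat (map (\<lambda>i. map (f i) [0..<n]) [0..<m]) ! (n * x + y) = f x y"
proof (induction m)
  case (Suc m)
  show ?case
  proof (cases "x = m")
    case True
    then show ?thesis
      using Suc.prems by (simp add: nth_append length_concat_rows mult.commute)
  next
    case False
    then have x: "x < m"
      using Suc.prems by simp
    have "n * x + y < n * m"
      using block_less[OF x Suc.prems(2)] by (simp add: mult.commute)
    then show ?thesis
      using Suc.IH[OF x Suc.prems(2)] by (simp add: nth_append length_concat_rows mult.commute)
  qed
qed simp

lemma length_encode_mat: "length (encode_mat M) = 2 + dim_row M * dim_col M"
  by (simp add: encode_mat_def mat_to_list_def length_concat_rows)

lemma encode_mat_nth: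
  "x < dim_row M \<Longrightarrow> y < dim_col M \<Longrightarrow> encode_mat M ! (2 + (dim_col M * x + y)) = M $$ (x, y)"
  by (simp add: encode_mat_def mat_to_list_def nth_concat_rows)

lemma encode_mat_index: "x < dim_row M \<Longrightarrow> y < dim_col M \<Longrightarrow> 2 + (dim_col M * x + y) < length (encode_mat M)"
  using block_less[of x "dim_row M" y "dim_col M"] by (simp add: length_encode_mat mult.commute)

context
  fixes M P :: "nat mat" and inp :: "nat \<Rightarrow> nat"
  assumes inp: "inp = load (encode_mat M @ encode_mat P) 0"
begin

lemma inp_dims:
  "inp 0 = dim_row M" "inp 1 = dim_col M" "inp (2 + dim_row M * dim_col M) = dim_row P"
proof -
  have [simp]: "encode_mat A ! 0 = dim_row A" "encode_mat A ! Suc 0 = dim_col A" for A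
    by (simp_all add: encode_mat_def)
  show "inp 0 = dim_row M" "inp 1 = dim_col M" "inp (2 + dim_row M * dim_col M) = dim_row P"
    by (simp_all add: inp load_def length_encode_mat nth_append)
qed

lemma word_E_encode: "word_E inp (dim_row M) (dim_col M) x y \<longleftrightarrow>
    x < dim_row M \<and> dim_row M \<le> y \<and> y < dim_row M + dim_col M \<and> M $$ (x, y - dim_row M) \<noteq> 0"
proof -
  have "inp (2 + (dim_col M * x + (y - dim_row M))) = M $$ (x, y - dim_row M)"
    if "x < dim_row M" "dim_row M \<le> y" "y < dim_row M + dim_col M"
  proof -
    have y: "y - dim_row M < dim_col M"
      using that by linarith
    show ?thesis
      using encode_mat_nth[OF that(1) y] encode_mat_index[OF that(1) y] by (simp add: inp load_def nth_append)
  qed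
  then show ?thesis
    by (auto simp: word_E_def)
qed

lemma word_EP_encode:
  assumes "dim_row P = k" "dim_col P = k"
  shows "word_EP inp (2 + dim_row M * dim_col M) k p q \<longleftrightarrow> p < k \<and> k \<le> q \<and> q < 2 * k \<and> P $$ (p, q - k) \<noteq> 0"
proof -
  have "inp (2 + dim_row M * dim_col M + (2 + (k * p + (q - k)))) = P $$ (p, q - k)"
    if "p < k" "k \<le> q" "q < 2 * k"
  proof -
    have pq: "p < dim_row P" "q - k < dim_col P"
      using that assms by linarith+
    show ?thesis
      using encode_mat_nth[OF pq] encode_mat_index[OF pq] assms length_encode_mat[of M]
      by (simp add: inp load_def nth_append)
  qed
  then show ?thesis
    by (auto simp: word_EP_def)
qed

end

lemma embedding_word:
  assumes "0 < m" "0 < n"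
  shows "search_program.embedding (m + n) (2 * k) (word_E inp m n) (word_EP inp off k) F \<longleftrightarrow>
    (\<forall>p<2 * k. F p < m + n \<and> (\<forall>q<2 * k. p < q \<longrightarrow> F p < F q \<and>
       (word_E inp m n (F p) (F q) \<longleftrightarrow> word_EP inp off k p q)))"
proof -
  interpret search_program "m + n" "2 * k" "word_E inp m n" "word_EP inp off k" inp m n off k
    "param_d 0 k" "param_Q 0 k" "param_D k" "param_W k"
    by (rule search_program_word[OF assms])
  show ?thesis
    by (simp add: embedding_def ok_def)
qed

lemma line_graph_word_E: "line_graph (word_E inp m n)"
  by unfold_locales (auto simp: word_E_def)

lemma exec_cMain_decides:
  assumes t: "0 < t" and M: "zero_one_mat M" "\<not> is_submatrix (all_ones_mat t) M" and P: "permutation_matrix k P"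
    and U: "U = mat_size M + param_bound (two_colour_bound t) k"
  defines "s \<equiv> load (encode_mat M @ encode_mat P)"
  shows "exec (cMain (two_colour_bound t)) s 0 0 = of_bool (is_submatrix P M)"
    and "c_bounded U (cMain (two_colour_bound t)) s"
proof -
  let ?m = "dim_row M" and ?n = "dim_col M" and ?T = "two_colour_bound t"
  have inp: "s 0 = load (encode_mat M @ encode_mat P) 0"
    by (simp add: s_def)
  have dim: "dim_row P = k" "dim_col P = k"
    using P by (auto simp: permutation_matrix_def)
  note dims = inp_dims[OF inp, unfolded dim]
  have size: "mat_size M = ?m * ?n + 2"
    by (simp add: mat_size_def length_encode_mat)
  have "exec (cMain ?T) s 0 0 = of_bool (is_submatrix P M) \<and> c_bounded U (cMain ?T) s"
  proof (cases "k = 0 \<or> ?m = 0 \<or> ?n = 0")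
    case True
    \<comment> \<open>The empty pattern embeds vacuously, and a matrix without rows or columns has
      room for no other.\<close>
    have "is_submatrix P M \<longleftrightarrow> k = 0"
    proof
      show "k = 0" if "is_submatrix P M"
        using that True unfolding is_submatrix_iff dim by auto
      show "is_submatrix P M" if "k = 0"
        using that unfolding is_submatrix_iff dim by (auto simp: strict_mono_on_def)
    qed
    then show ?thesis
      using exec_cMain_trivial[where s = s and T = ?T and U = U, OF dims True] U size by simp
  next
    case False
    then have pos: "0 < k" "0 < ?m" "0 < ?n"
      by simp_all
    note E = word_E_encode[OF inp] and EP = word_EP_encode[OF inp dim]
    have emb: "(\<exists>f. search_program.embedding (?m + ?n) (2 * k) (word_E (s 0) ?m ?n)
        (word_EP (s 0) (2 + ?m * ?n) k) f) \<longleftrightarrow> is_submatrix P M"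
      unfolding embedding_word[OF pos(2,3)]
      by (rule embedding_iff_submatrix[OF refl refl M(1) P E EP])
    have "s 26 = (\<lambda>_. 0)"
      by (simp add: s_def load_def)
    moreover have "\<exists>f. search_program.embedding (?m + ?n) (2 * k) (word_E (s 0) ?m ?n)
        (word_EP (s 0) (2 + ?m * ?n) k) f"
      if "line_graph.good_partition (?m + ?n) (word_E (s 0) ?m ?n) (param_d ?T k) Q"
        "\<forall>v. \<not> line_graph.mergeable (?m + ?n) (word_E (s 0) ?m ?n) (param_d ?T k) Q v"
        "0 < Q (?m + ?n - 1)" for Q
      unfolding emb by (rule stuck_submatrix[OF refl refl M(1) P E EP t M(2) pos(1) line_graph_word_E that])
    moreover have "?m * ?n + 2 + param_bound ?T k \<le> U"
      using U size by simp
    ultimately show ?thesis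
      using exec_cMain[where s = s and T = ?T and U = U, OF dims _ pos] unfolding emb by blast
  qed
  then show "exec (cMain ?T) s 0 0 = of_bool (is_submatrix P M)" "c_bounded U (cMain ?T) s"
    by simp_all
qed

theorem theorem43:
  fixes t :: nat and \<M> :: "nat mat set"
  assumes "t > 0"
    and "matrix_class \<M>"
    and "\<And>M. M \<in> \<M> \<Longrightarrow> zero_one_mat M"
    and "\<And>M. M \<in> \<M> \<Longrightarrow> \<not> is_submatrix (all_ones_mat t) M"
  shows "\<exists>h. computable h \<and>
    (\<exists>p c. \<forall>M\<in>\<M>. \<forall>k P. permutation_matrix k P \<longrightarrow>
       decides_within p (encode_mat M @ encode_mat P) (is_submatrix P M) (h k * mat_size M ^ c))"
proof -
  let ?T = "two_colour_bound t"
  let ?c = "cMain ?T"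
  \<comment> \<open>Polynomial in the loop bound alone; \<open>A\<close> and \<open>e\<close> depend
    only on the program, hence on \<open>t\<close>.\<close>
  obtain A e where time: "\<And>U. c_time U ?c \<le> A * (U + 1) ^ e"
    using poly_bounded_c_time[of ?c] unfolding poly_bounded_def by blast
  let ?h = "\<lambda>k. A * (param_bound ?T k + 2) ^ e"
  have "decides_within (c_comp ?c 61) (encode_mat M @ encode_mat P) (is_submatrix P M) (?h k * mat_size M ^ e)"
    if M: "M \<in> \<M>" and P: "permutation_matrix k P" for M k P
  proof -
    let ?U = "mat_size M + param_bound ?T k"
    note main = exec_cMain_decides[OF assms(1) assms(3,4)[OF M] P refl]
    from c_comp_correct[OF cMain_below main(2)] obtain s where
      s: "runs (c_comp ?c 61) (load (encode_mat M @ encode_mat P)) (c_time ?U ?c) s"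
      "\<forall>b<61. s b = exec ?c (load (encode_mat M @ encode_mat P)) b"
      by blast
    have size: "1 \<le> mat_size M"
      by (simp add: mat_size_def length_encode_mat)
    \<comment> \<open>The sum of size and parameter is replaced by a product, which separates the
      factor depending on \<open>k\<close> from the power of the size.\<close>
    have "?U + 1 \<le> mat_size M * (param_bound ?T k + 2)"
      using size by (cases "mat_size M") simp_all
    then have "A * (?U + 1) ^ e \<le> A * (mat_size M * (param_bound ?T k + 2)) ^ e"
      by (intro mult_left_mono power_mono) simp_all
    also have "\<dots> = ?h k * mat_size M ^ e"
      by (simp only: power_mult_distrib mult_ac)
    finally have "c_time ?U ?c \<le> ?h k * mat_size M ^ e"
      by (rule order_trans[OF time])
    then have "runs (c_comp ?c 61) (load (encode_mat M @ encode_mat P)) (?h k * mat_size M ^ e) s"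
      by (rule runs_mono[OF s(1)])
    moreover have "s 0 0 = (if is_submatrix P M then 1 else 0)"
      using s(2) main(1) by simp
    ultimately show ?thesis
      unfolding decides_within_def runs_def by blast
  qed
  then show ?thesis
    using computable_time_bound[of A ?T e] by blast
qed

end
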